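(* Let $u(x,t)$ be the unique positive solution on $\mathbb{S}^n\times[0,\infty)$ of the normalized Gauss curvature flow $$\frac{\partial u}{\partial t}=u-\frac1{\det(\bar g^{ik}(\bar\nabla_k\bar\nabla_ju+u\,\bar g_{kj}))},$$ where $u(\cdot,t)$ is the support function of the convex body $\Omega_t\subset\mathbb{R}^{n+1}$ and $V(\Omega_0)=V(B(1))$. Let $K(x,t)=1/\det(\bar\nabla^2u+u\bar g)$ and $\mathcal{E}_\infty=\lim_{t\to\infty}\mathcal{E}(\Omega_t)$. Then for all $t\ge0$, $$\frac1{\omega_n}\int_{\mathbb{S}^n}\log u(x,t)\,d\theta\ \ge\ \mathcal{E}_\infty+\int_t^\infty\frac1{\omega_n}\int_{\mathbb{S}^n}\left(\sqrt{\frac{K(x,s)}{u(x,s)}}-\sqrt{\frac{u(x,s)}{K(x,s)}}\right)^2d\theta(x)\,ds .$$ In particular $\mathcal{E}(\Omega_t)\ge\mathcal{E}_F(\Omega_t)\ge\mathcal{E}_\infty$ for all $t\ge 0$, where $\mathcal{E}_F(\Omega_t)=\frac1{\omega_n}\int_{\mathbb{S}^n}\log u(x,t)\,d\theta(x)$.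
   Context: $V$ is Lebesgue measure, $B(1)$ the unit ball of $\mathbb{R}^{n+1}$; $\bar g,\bar\nabla$ are the standard metric and covariant derivative on $\mathbb{S}^n$, $d\theta$ the surface measure and $\omega_n$ the area of $\mathbb{S}^n$. Solutions are smooth with $\bar\nabla^2u+u\bar g>0$. For a compact convex body $\Omega$ with nonempty interior and $z_0\in\Omega$, $u_{z_0}(x)=\max_{z\in\Omega}\langle x,z-z_0\rangle$ and $$\mathcal{E}(\Omega)=\sup_{u_{z_0}>0}\frac1{\omega_n}\int_{\mathbb{S}^n}\log u_{z_0}\,d\theta,$$ the supremum being over $z_0\in\Omega$ with $u_{z_0}>0$ on $\mathbb{S}^n$. Along the flow $\mathcal{E}(\Omega_t)$ is nonnegative and non-increasing in $t$, so $\mathcal{E}_\infty$ exists. The positive solution for all $t\geq 0$ is the one obtained by placing at the origin the limit point of the un-normalized flow $\partial_sw=-1/\det(\bar\nabla^2w+w\bar g)$ and rescaling; it is unique for a given convex body $\Omega_0$. *)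

theory Defs
  imports "HOL-Analysis.Analysis"
begin

section \<open>Smooth functions\<close>

text \<open>Only meant for open \<open>S\<close>. In finite dimensions, \<open>f\<close> is of class \<open>C\<^sup>k\<^sup>+\<^sup>1\<close> iff it is
  differentiable and all its directional derivatives are of class \<open>C\<^sup>k\<close>.\<close>

primrec C_k_on :: "nat \<Rightarrow> ('a::euclidean_space \<Rightarrow> 'b::real_normed_vector) \<Rightarrow> 'a set \<Rightarrow> bool" where
  "C_k_on 0 f S \<longleftrightarrow> continuous_on S f"
| "C_k_on (Suc k) f S \<longleftrightarrow>
     (\<forall>x\<in>S. f differentiable (at x)) \<and> (\<forall>v. C_k_on k (\<lambda>x. frechet_derivative f (at x) v) S)"

text \<open>Smoothness on an arbitrary subset, such as \<open>\<S>\<^sup>n \<times> [0,\<infinity>)\<close> inside \<open>\<real>\<^sup>n\<^sup>+\<^sup>1 \<times> \<real>\<close>: existence of a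
  smooth extension to an open neighbourhood. At \<open>t = 0\<close> this is smoothness up to the boundary.\<close>

definition smooth_on :: "'a::euclidean_space set \<Rightarrow> ('a \<Rightarrow> 'b::real_normed_vector) \<Rightarrow> bool" where
  "smooth_on A f \<longleftrightarrow>
     (\<exists>U F. open U \<and> A \<subseteq> U \<and> (\<forall>k. C_k_on k F U) \<and> (\<forall>x\<in>A. F x = f x))"

section \<open>Surface measure of the unit sphere\<close>

text \<open>The measure \<open>d\<theta>\<close> of polar coordinates \<open>dx = r\<^sup>n dr d\<theta>\<close> in \<open>\<real>\<^sup>n\<^sup>+\<^sup>1\<close>: the area of a
  Borel set \<open>A\<close> of directions is \<open>n + 1\<close> times the volume of the cone \<open>{r x | 0 < r < 1, x \<in> A}\<close>.
  Note that \<open>sgn x = x / |x|\<close> and \<open>CARD('n) = n + 1\<close>.\<close>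

definition sphere_measure :: "(real^'n) measure" where
  "sphere_measure =
     scale_measure (of_nat CARD('n))
       (distr (restrict_space lborel (ball 0 1 - {0})) (restrict_space borel (sphere 0 1)) sgn)"

definition sphere_avg :: "(real^'n \<Rightarrow> real) \<Rightarrow> real" where
  "sphere_avg f = 1 / measure sphere_measure (sphere (0::real^'n) 1) * (LINT x|sphere_measure. f x)"

section \<open>Covariant derivatives on the unit sphere\<close>

text \<open>A function \<open>f\<close> on the sphere is differentiated through its radially constant extension
  \<open>f \<circ> sgn\<close>; hence all operators below depend only on the values of \<open>f\<close> on the sphere. The metric
  is the one induced by the inner product of the ambient space, and the Levi-Civita derivative is
  the tangential part of the ambient derivative.\<close>

definition tangent_space :: "real^'n \<Rightarrow> (real^'n) set" where
  "tangent_space x = {X. x \<bullet> X = 0}"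

definition tangent_proj :: "real^'n \<Rightarrow> real^'n \<Rightarrow> real^'n" where
  "tangent_proj x v = v - (x \<bullet> v) *\<^sub>R x"

definition sphere_grad :: "(real^'n \<Rightarrow> real) \<Rightarrow> real^'n \<Rightarrow> real^'n" where
  "sphere_grad f x = (THE D. GDERIV (f \<circ> sgn) x :> D)"

definition cov_deriv :: "(real^'n \<Rightarrow> real^'n) \<Rightarrow> real^'n \<Rightarrow> real^'n \<Rightarrow> real^'n" where
  "cov_deriv W x X = tangent_proj x (frechet_derivative (W \<circ> sgn) (at x) X)"

text \<open>The Hessian as a bilinear form on the tangent space at \<open>x\<close> is
  \<open>(X, Y) \<mapsto> sphere_hess f x X \<bullet> Y\<close>, i.e. one index of the covariant Hessian has been raised.\<close>

definition sphere_hess :: "(real^'n \<Rightarrow> real) \<Rightarrow> real^'n \<Rightarrow> real^'n \<Rightarrow> real^'n" where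
  "sphere_hess f x X = cov_deriv (sphere_grad f) x X"

text \<open>The endomorphism of the tangent space with components
  \<open>g\<^sup>i\<^sup>k (\<nabla>\<^sub>k \<nabla>\<^sub>j f + f g\<^sub>k\<^sub>j)\<close>, and positivity of the corresponding bilinear form.\<close>

definition radii_op :: "(real^'n \<Rightarrow> real) \<Rightarrow> real^'n \<Rightarrow> real^'n \<Rightarrow> real^'n" where
  "radii_op f x X = sphere_hess f x X + f x *\<^sub>R X"

definition radii_positive :: "(real^'n \<Rightarrow> real) \<Rightarrow> real^'n \<Rightarrow> bool" where
  "radii_positive f x \<longleftrightarrow> (\<forall>X\<in>tangent_space x. X \<noteq> 0 \<longrightarrow> radii_op f x X \<bullet> X > 0)"

text \<open>The determinant of an endomorphism \<open>A\<close> of the tangent space at the unit vector \<open>x\<close>. Extending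
  \<open>A\<close> by the identity on the normal line \<open>\<real> x\<close> does not change it: in a basis \<open>x, e\<^sub>1, \<dots>, e\<^sub>n\<close> with
  \<open>e\<^sub>i\<close> tangent, the extension has the block diagonal matrix with blocks \<open>1\<close> and the matrix of \<open>A\<close>.\<close>

definition tangent_det :: "real^'n \<Rightarrow> (real^'n \<Rightarrow> real^'n) \<Rightarrow> real" where
  "tangent_det x A = det (matrix (\<lambda>v. A (tangent_proj x v) + (x \<bullet> v) *\<^sub>R x))"

definition gauss_curv :: "(real^'n \<Rightarrow> real) \<Rightarrow> real^'n \<Rightarrow> real" where
  "gauss_curv f x = 1 / tangent_det x (radii_op f x)"

section \<open>Convex bodies and entropy\<close>

definition convex_body :: "(real^'n) set \<Rightarrow> bool" where
  "convex_body K \<longleftrightarrow> compact K \<and> convex K \<and> interior K \<noteq> {}"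

text \<open>The support function with respect to the base point \<open>z0\<close>. For compact nonempty \<open>K\<close> the
  supremum is a maximum.\<close>

definition support_fun :: "(real^'n) set \<Rightarrow> real^'n \<Rightarrow> real^'n \<Rightarrow> real" where
  "support_fun K z0 x = (SUP z\<in>K. x \<bullet> (z - z0))"

text \<open>For a convex body the supremum is over a nonempty set (the interior points of \<open>K\<close>) which is
  bounded above, as \<open>support_fun K z0 \<le> diameter K\<close> on the sphere.\<close>

definition entropy :: "(real^'n) set \<Rightarrow> real" where
  "entropy K = (SUP z0\<in>{z0\<in>K. \<forall>x\<in>sphere 0 1. support_fun K z0 x > 0}.
     sphere_avg (\<lambda>x. ln (support_fun K z0 x)))"

end

theory Submission
  imports Defs
begin

text \<open>
  With \<open>K = u - \<partial>\<^sub>t u = 1 / det(\<nabla>\<^sup>2u + u g)\<close>, the map \<open>y \<mapsto> |y| p(y/|y|, - ln |y|)\<close>, where \<open>p(x, t)\<close> is the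
  boundary point of \<open>\<Omega>\<^sub>t\<close> with normal \<open>x\<close>, sends the sphere of radius \<open>e\<^sup>-\<^sup>t\<close> to the boundary of
  \<open>e\<^sup>-\<^sup>t\<Omega>\<^sub>t\<close> and has Jacobian \<open>(u - \<partial>\<^sub>t u) det(\<nabla>\<^sup>2u + u g) = 1\<close>. It is injective because the bodies
  \<open>e\<^sup>-\<^sup>t\<Omega>\<^sub>t\<close> shrink strictly, so the change of variables formula shows that the volume of \<open>\<Omega>\<^sub>t\<close> stays
  that of the unit ball. Applied to the constant family \<open>\<Omega>\<^sub>t - z\<close>, the same computation gives that
  \<open>(u - x \<bullet> z) / K\<close> has average \<open>1\<close>, without any integration by parts.

  Translates \<open>v = u - e\<^sup>t x \<bullet> w\<close> solve the same equation, so the average of \<open>ln v\<close> has derivative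
  \<open>avg (1 - K / v) \<le> avg (v / K - 1) = 0\<close>. Starting from near-optimal base points \<open>z\<^sub>T\<close> of \<open>\<Omega>\<^sub>T\<close> this
  shows that the entropy decreases; for \<open>w = 0\<close> it gives the dissipation identity. If \<open>\<Omega>\<^sub>T\<close> contains a
  long segment \<open>[0, z]\<close>, the base point \<open>z / 2\<close> makes the entropy large, so \<open>\<Omega>\<^sub>T\<close> stays bounded; hence
  \<open>e\<^sup>t\<^sup>-\<^sup>T z\<^sub>T\<close>, the base point moved back to time \<open>t\<close>, tends to the origin, and
  \<open>avg (ln u) \<ge> \<E>\<^sub>\<infinity>\<close> follows.\<close>

section \<open>Change of variables over finite index types\<close>

text \<open>The change of variables reaches only the points that the shrinking bodies sweep out. The
  intersection of all the rescaled bodies is left over, so the first result is a volume identity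
  with a defect. The normalization of \<open>\<Omega> 0\<close> makes the defect null at time 0, and
  scaling makes it null at every later time.

  Positivity of \<open>u\<close> at all times keeps the origin an admissible base point forever, so
  the energy based at 0 can be followed to infinity. A translate by a nonzero \<open>w\<close> is
  admissible only until \<open>exp t *\<^sub>R w\<close> leaves the bounded bodies; this is why base
  points are carried backwards, from a late time to the time of interest.

  The dissipation integrand is the gap in \<open>1 - 1 / r \<le> r - 1\<close> at
  \<open>r = u / K\<close>, namely \<open>r + 1 / r - 2\<close>. The entropy estimates rest on the
  integrability of \<open>ln \<bar>x \<bullet> e\<bar>\<close> over the sphere, uniformly in the
  unit vector \<open>e\<close>. This bounds the bodies from above and, combined with the volume, the
  entropy from below, so that its limit exists.\<close>

typedef 'n ordered_index = "UNIV :: 'n set" ..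

lemma bij_Rep_ordered_index: "bij Rep_ordered_index"
  by (metis Abs_ordered_index_inverse Rep_ordered_index_inverse UNIV_I bijI')

instance ordered_index :: (finite) finite
proof
  show "finite (UNIV :: 'a ordered_index set)"
    using bij_Rep_ordered_index by (metis bij_betw_finite finite)
qed

instantiation ordered_index :: (finite) wellorder
begin

text \<open>The order is pulled back along an arbitrary injection into the naturals, which exists by
  finiteness; linearity and well-foundedness are inherited from there.\<close>

definition less_eq_ordered_index :: "'a ordered_index \<Rightarrow> 'a ordered_index \<Rightarrow> bool" where
  "less_eq_ordered_index a b \<longleftrightarrow>
     (SOME e. inj e) (Rep_ordered_index a) \<le> ((SOME e. inj e) (Rep_ordered_index b) :: nat)"

definition less_ordered_index :: "'a ordered_index \<Rightarrow> 'a ordered_index \<Rightarrow> bool" where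
  "less_ordered_index a b \<longleftrightarrow> a \<le> b \<and> \<not> b \<le> a"

instance
proof
  define e :: "'a \<Rightarrow> nat" where "e = (SOME e. inj e)"
  have "\<exists>e :: 'a \<Rightarrow> nat. inj e"
    using finite_imp_inj_to_nat_seg[OF finite[of "UNIV :: 'a set"]] by blast
  then have "inj e"
    unfolding e_def by (rule someI_ex)
  then have inj: "inj (e \<circ> Rep_ordered_index)"
    by (intro inj_compose) (auto simp: bij_is_inj bij_Rep_ordered_index)
  have le: "a \<le> b \<longleftrightarrow> (e \<circ> Rep_ordered_index) a \<le> (e \<circ> Rep_ordered_index) b" for a b
    by (simp add: less_eq_ordered_index_def e_def)
  have less: "a < b \<longleftrightarrow> (e \<circ> Rep_ordered_index) a < (e \<circ> Rep_ordered_index) b" for a b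
    by (auto simp: less_ordered_index_def le)
  fix x y z :: "'a ordered_index" and P
  show "x < y \<longleftrightarrow> x \<le> y \<and> \<not> y \<le> x"
    by (fact less_ordered_index_def)
  show "x \<le> x" "x \<le> y \<Longrightarrow> y \<le> z \<Longrightarrow> x \<le> z" "x \<le> y \<or> y \<le> x"
    by (auto simp: le)
  show "x \<le> y \<Longrightarrow> y \<le> x \<Longrightarrow> x = y"
    by (intro injD[OF inj]) (simp add: le)
  show "(\<And>x. (\<And>y. y < x \<Longrightarrow> P y) \<Longrightarrow> P x) \<Longrightarrow> P x"
    by (rule measure_induct_rule[of "e \<circ> Rep_ordered_index"]) (simp add: less)
qed

end

definition reindex :: "real^'n \<Rightarrow> real^'n ordered_index" where
  "reindex v = (\<chi> i. v $ Rep_ordered_index i)"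

definition unindex :: "real^'n ordered_index \<Rightarrow> real^'n" where
  "unindex v = (\<chi> i. v $ Abs_ordered_index i)"

lemma unindex_reindex [simp]: "unindex (reindex v) = v"
  and reindex_unindex [simp]: "reindex (unindex w) = w"
  by (simp_all add: vec_eq_iff reindex_def unindex_def Abs_ordered_index_inverse
      Rep_ordered_index_inverse)

lemma linear_reindex: "linear reindex" and linear_unindex: "linear unindex"
  by (auto intro!: linearI simp: vec_eq_iff reindex_def unindex_def)

text \<open>Conjugating permutations by the bijection \<open>Rep_ordered_index\<close> matches the
  two Leibniz sums term by term, and conjugation preserves signs.\<close>

lemma det_reindex:
  fixes A :: "real^'n^'n"
  shows "det (\<chi> i j. A $ Rep_ordered_index i $ Rep_ordered_index j) = det A"
proof -
  let ?R = "Rep_ordered_index :: 'n ordered_index \<Rightarrow> 'n"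
  let ?m = "map_permutation UNIV ?R"
  have R: "bij ?R" by (fact bij_Rep_ordered_index)
  have inv: "inv_into UNIV ?R = Abs_ordered_index"
    by (metis Abs_ordered_index_inverse Rep_ordered_index_inverse UNIV_I inv_equality)
  have m: "?m p = ?R \<circ> p \<circ> Abs_ordered_index" for p
    using R by (simp add: map_permutation_def inv restrict_id_def bij_is_surj fun_eq_iff)
  have bij: "bij_betw ?m {p. p permutes UNIV} {p. p permutes UNIV}"
  proof (rule bij_betwI[where g = "\<lambda>p. Abs_ordered_index \<circ> p \<circ> ?R"])
    show "?m \<in> {p. p permutes UNIV} \<rightarrow> {p. p permutes UNIV}"
      using map_permutation_permutes[OF R] by auto
    show "(\<lambda>p. Abs_ordered_index \<circ> p \<circ> ?R) \<in> {p. p permutes UNIV} \<rightarrow> {p. p permutes UNIV}"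
    proof (intro Pi_I, clarsimp)
      fix p :: "'n \<Rightarrow> 'n" assume "p permutes UNIV"
      then have "bij p" by (rule permutes_bij)
      then have "bij (Abs_ordered_index \<circ> p \<circ> ?R)"
        using R bij_imp_bij_inv[OF R] unfolding inv by (intro bij_comp) auto
      then show "(Abs_ordered_index \<circ> p \<circ> ?R) permutes UNIV"
        by (intro bij_imp_permutes) auto
    qed
  qed (auto simp: m fun_eq_iff Abs_ordered_index_inverse Rep_ordered_index_inverse)
  have "det A = (\<Sum>p | p permutes UNIV. of_int (sign (?m p)) * (\<Prod>i\<in>UNIV. A $ i $ ?m p i))"
    unfolding det_def by (rule sum.reindex_bij_betw[OF bij, symmetric])
  also have "\<dots> = (\<Sum>p | p permutes UNIV. of_int (sign p) *
      (\<Prod>i\<in>UNIV. A $ ?R i $ ?R (p i)))"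
  proof (intro sum.cong refl arg_cong2[where f = "(*)"])
    fix p :: "'n ordered_index \<Rightarrow> 'n ordered_index" assume "p \<in> {p. p permutes UNIV}"
    then show "(of_int (sign (?m p)) :: real) = of_int (sign p)"
      using R by (subst sign_map_permutation) (auto simp: bij_is_inj)
    show "(\<Prod>i\<in>UNIV. A $ i $ ?m p i) = (\<Prod>i\<in>UNIV. A $ ?R i $ ?R (p i))"
      using prod.reindex_bij_betw[OF R, of "\<lambda>i. A $ i $ ?m p i"]
      by (simp add: m Rep_ordered_index_inverse)
  qed
  finally show ?thesis by (simp add: det_def)
qed

lemma det_matrix_reindex:
  fixes f :: "real^'n \<Rightarrow> real^'n"
  shows "det (matrix (\<lambda>v. reindex (f (unindex v)))) = det (matrix f)"
proof -
  have axis: "unindex (axis j 1) = axis (Rep_ordered_index j) 1" for j :: "'n ordered_index"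
    by (auto simp: unindex_def axis_def vec_eq_iff Abs_ordered_index_inverse Rep_ordered_index_inverse)
  have "matrix (\<lambda>v. reindex (f (unindex v)))
      = (\<chi> i j. matrix f $ Rep_ordered_index i $ Rep_ordered_index j)"
    by (simp add: matrix_def reindex_def axis vec_eq_iff)
  then show ?thesis
    by (simp add: det_reindex)
qed

lemma borel_measurable_reindex [measurable]: "reindex \<in> borel_measurable borel"
  and borel_measurable_unindex [measurable]: "unindex \<in> borel_measurable borel"
  by (auto intro!: borel_measurable_continuous_onI linear_continuous_on linear_reindex linear_unindex
      simp flip: linear_conv_bounded_linear)

text \<open>Boxes determine Lebesgue measure, and a relabelling of the coordinates pulls a box back
  to a box with the same side lengths.\<close>

lemma lborel_distr_reindex: "distr lborel borel (reindex :: real^'n::finite \<Rightarrow> real^'n ordered_index) = lborel"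
proof (rule lborel_eqI[symmetric])
  fix l u :: "real^'n ordered_index"
  assume le: "\<And>b. b \<in> Basis \<Longrightarrow> l \<bullet> b \<le> u \<bullet> b"
  have R: "bij (Rep_ordered_index :: 'n ordered_index \<Rightarrow> 'n)" by (fact bij_Rep_ordered_index)
  have vimage: "reindex -` box l u = box (unindex l) (unindex u)"
  proof -
    have eq: "(\<forall>i. P (Rep_ordered_index i) i) \<longleftrightarrow> (\<forall>j. P j (Abs_ordered_index j))"
      for P :: "'n \<Rightarrow> 'n ordered_index \<Rightarrow> bool"
      by (metis Abs_ordered_index_inverse Rep_ordered_index_inverse UNIV_I)
    have "v \<in> reindex -` box l u \<longleftrightarrow> v \<in> box (unindex l) (unindex u)" for v
      using eq[of "\<lambda>j i. l $ i < v $ j \<and> v $ j < u $ i"]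
      by (simp add: mem_box_cart reindex_def unindex_def)
    then show ?thesis by blast
  qed
  have le': "l $ i \<le> u $ i" for i
    using le[of "axis i 1"] by (simp add: inner_axis)
  have prod: "(\<Prod>b\<in>Basis. (u - l) \<bullet> b) = (\<Prod>i\<in>UNIV. (u - l) $ i)" for u l :: "real^'a"
  proof -
    have basis: "Basis = range (\<lambda>i::'a. axis i (1::real))" by (auto simp: Basis_vec_def)
    show ?thesis
      unfolding basis by (subst prod.reindex) (auto intro!: injI simp: axis_eq_axis inner_axis)
  qed
  have "emeasure (distr lborel borel reindex) (box l u) = emeasure lborel (box (unindex l) (unindex u))"
    by (subst emeasure_distr) (auto simp: vimage)
  also have "\<dots> = (\<Prod>b\<in>Basis. (unindex u - unindex l) \<bullet> b)"
    by (rule emeasure_lborel_box) (auto simp: Basis_vec_def inner_axis unindex_def le')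
  also have "(\<Prod>b\<in>Basis. (unindex u - unindex l) \<bullet> b) = (\<Prod>b\<in>Basis. (u - l) \<bullet> b)"
    unfolding prod prod.reindex_bij_betw[OF R, of "\<lambda>i. (unindex u - unindex l) $ i", symmetric]
    by (simp add: unindex_def Rep_ordered_index_inverse)
  finally show "emeasure (distr lborel borel reindex) (box l u) = (\<Prod>b\<in>Basis. (u - l) \<bullet> b)" .
qed simp

text \<open>The library states the change of variables formula only for vectors whose index type is
  well-ordered; \<^const>\<open>reindex\<close> transports it to arbitrary finite index types.\<close>

lemma measure_injective_image:
  fixes f :: "real^'n \<Rightarrow> real^'n"
  assumes S: "S \<in> sets borel" and fS: "f ` S \<in> sets borel"
    and der: "\<And>x. x \<in> S \<Longrightarrow> (f has_derivative f' x) (at x within S)"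
    and inj: "inj_on f S"
    and int: "set_integrable lborel S (\<lambda>x. \<bar>det (matrix (f' x))\<bar>)"
  shows "measure lborel (f ` S) = (LINT x:S|lborel. \<bar>det (matrix (f' x))\<bar>)"
proof -
  define g where "g = (\<lambda>y. reindex (f (unindex y)))"
  define g' where "g' = (\<lambda>y v. reindex (f' (unindex y) (unindex v)))"
  define J where "J = (\<lambda>x. \<bar>det (matrix (f' x))\<bar>)"
  have image: "reindex ` A = unindex -` A" for A :: "(real^'n) set"
    by (force simp: image_iff)
  have borel: "unindex -` A \<in> sets borel" if "A \<in> sets borel" for A :: "(real^'n) set"
    using measurable_sets[OF borel_measurable_unindex that] by simp
  have J: "\<bar>det (matrix (g' y))\<bar> = J (unindex y)" for y
    unfolding g'_def J_def det_matrix_reindex ..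
  have mr: "measure lborel (reindex ` A) = measure lborel A" if A: "A \<in> sets borel" for A :: "(real^'n) set"
  proof -
    have "measure lborel (reindex ` A) = measure (distr lborel borel reindex) (unindex -` A)"
      by (simp add: lborel_distr_reindex image)
    also have "\<dots> = measure lborel (reindex -` unindex -` A)"
      using borel[OF A] by (subst measure_distr) auto
    also have "reindex -` unindex -` A = A" by auto
    finally show ?thesis .
  qed
  have gS: "g ` (reindex ` S) = reindex ` (f ` S)"
    by (simp add: g_def image_image)
  have indJ: "(\<lambda>x. indicator S x *\<^sub>R J x) \<in> borel_measurable borel"
    using int unfolding set_integrable_def J_def by (auto dest: borel_measurable_integrable)
  have ind: "indicator (reindex ` S) y *\<^sub>R J (unindex y)
      = (\<lambda>x. indicator S x *\<^sub>R J x) (unindex y)" for y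
    by (auto simp: image indicator_def)
  have ind': "indicator (reindex ` S) (reindex x) = (indicator S x :: real)" for x
    by (auto simp: image indicator_def)
  have meas: "(\<lambda>y. indicator (reindex ` S) y *\<^sub>R J (unindex y)) \<in> borel_measurable borel"
    unfolding ind using measurable_compose[OF borel_measurable_unindex indJ] .
  have "integrable (distr lborel borel reindex) (\<lambda>y. indicator (reindex ` S) y *\<^sub>R J (unindex y))"
    using int by (subst integrable_distr_eq[OF _ meas]) (simp_all add: ind' J_def set_integrable_def)
  then have int': "set_integrable lborel (reindex ` S) (\<lambda>y. \<bar>det (matrix (g' y))\<bar>)"
    by (simp add: set_integrable_def lborel_distr_reindex J)
  have lint: "(LINT y:reindex ` S|lborel. \<bar>det (matrix (g' y))\<bar>) = (LINT x:S|lborel. J x)"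
    unfolding set_lebesgue_integral_def J
    by (subst lborel_distr_reindex[symmetric], subst integral_distr[OF _ meas]) (simp_all add: ind')
  have "measure lebesgue (g ` (reindex ` S)) = integral (reindex ` S) (\<lambda>y. \<bar>det (matrix (g' y))\<bar>)"
  proof (rule measure_differentiable_image_eq)
    show "reindex ` S \<in> sets lebesgue"
      unfolding image using borel[OF S] by (simp add: sets_completionI_sets)
    show "inj_on g (reindex ` S)"
      using inj unfolding inj_on_def g_def by (auto dest!: arg_cong[where f = unindex])
    show "(\<lambda>y. \<bar>det (matrix (g' y))\<bar>) integrable_on reindex ` S"
      by (rule set_borel_integral_eq_integral(1)[OF int'])
    fix y assume "y \<in> reindex ` S"
    then have y: "unindex y \<in> S" by auto
    have bl: "bounded_linear (reindex :: real^'n \<Rightarrow> _)" "bounded_linear (unindex :: _ \<Rightarrow> real^'n)"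
      using linear_reindex linear_unindex by (auto simp: linear_conv_bounded_linear)
    have "((f \<circ> unindex) has_derivative (f' (unindex y) \<circ> unindex)) (at y within reindex ` S)"
      using der[OF y]
      by (intro diff_chain_within) (auto intro!: bounded_linear_imp_has_derivative bl simp: image_image)
    from bounded_linear.has_derivative[OF bl(1) this]
    show "(g has_derivative g' y) (at y within reindex ` S)"
      by (simp add: g_def g'_def o_def)
  qed
  also have "\<dots> = (LINT x:S|lborel. J x)"
    using set_borel_integral_eq_integral(2)[OF int'] lint by simp
  finally show ?thesis
    unfolding gS J_def[symmetric] using mr[OF fS] borel[OF fS] by (simp add: image)
qed

section \<open>Shrinking families of support functions\<close>

lemma det_matrix_compose:
  fixes f g :: "real^'n \<Rightarrow> real^'n"
  assumes "linear f" "linear g"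
  shows "det (matrix (f \<circ> g)) = det (matrix f) * det (matrix g)"
  using assms by (simp add: matrix_compose det_mul)

text \<open>A rotation taking a basis vector to \<open>x\<close> conjugates the map to the identity
  matrix with a single column replaced, which Cramer's lemma evaluates.\<close>

lemma det_rank_one_update:
  fixes x w :: "real^'n"
  assumes x: "norm x = 1"
  shows "det (matrix (\<lambda>v. v + (x \<bullet> v) *\<^sub>R w)) = 1 + x \<bullet> w"
proof -
  obtain k :: 'n where True by simp
  have "norm x = norm (axis k 1 :: real^'n)" using x by simp
  then obtain T :: "real^'n \<Rightarrow> real^'n"
    where T: "orthogonal_transformation T" and Tk: "T (axis k 1) = x"
    using orthogonal_transformation_exists[of "axis k 1" x] by metis
  have linT: "linear T" and inner: "\<And>v w. T v \<bullet> T w = v \<bullet> w"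
    using T by (auto simp: orthogonal_transformation_def)
  obtain c where c: "T c = w"
    using orthogonal_transformation_surj[OF T] by (metis surjD)
  let ?f = "\<lambda>v. v + (x \<bullet> v) *\<^sub>R w" and ?g = "\<lambda>v. v + (axis k 1 \<bullet> v) *\<^sub>R c"
  have linf: "linear ?f" and ling: "linear ?g"
    by (auto intro!: linearI simp: inner_add_right algebra_simps)
  have "?f \<circ> T = T \<circ> ?g"
    by (auto simp: linear_add[OF linT] linear_cmul[OF linT] c inner simp flip: Tk)
  then have "det (matrix ?f) * det (matrix T) = det (matrix T) * det (matrix ?g)"
    using det_matrix_compose[OF linf linT] det_matrix_compose[OF linT ling]
    by (metis (no_types, lifting))
  moreover have "det (matrix T) \<noteq> 0"
    using T by (simp add: orthogonal_transformation_inj linT det_nz_iff_inj)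
  ultimately have "det (matrix ?f) = det (matrix ?g)" by simp
  also have "matrix ?g = (\<chi> i j. if j = k then (mat 1 *v (axis k 1 + c)) $ i else mat 1 $ i $ j)"
    by (simp add: vec_eq_iff matrix_def inner_axis' flip: axis_def) (auto simp: mat_def axis_def)
  also have "det \<dots> = (axis k 1 + c) $ k * det (mat 1 :: real^'n^'n)"
    by (rule cramer_lemma)
  also have "c $ k = x \<bullet> w"
    by (simp add: inner inner_axis' flip: Tk c)
  then have "(axis k 1 + c) $ k * det (mat 1 :: real^'n^'n) = 1 + x \<bullet> w"
    by (simp add: axis_def)
  finally show ?thesis .
qed

text \<open>Since \<open>f\<close> need not be symmetric, the argument is a homotopy rather than a
  product of eigenvalues: the segment from the identity to \<open>f\<close> keeps a positive
  quadratic form, so the determinant never vanishes on it and keeps the sign of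
  \<open>det (mat 1) = 1\<close>.\<close>

lemma det_pos:
  fixes f :: "real^'n \<Rightarrow> real^'n"
  assumes lin: "linear f" and pos: "\<And>v. v \<noteq> 0 \<Longrightarrow> v \<bullet> f v > 0"
  shows "det (matrix f) > 0"
proof -
  define A where "A s = s *\<^sub>R matrix f + (1 - s) *\<^sub>R mat 1" for s :: real
  have nz: "det (A s) \<noteq> 0" if s: "0 \<le> s" "s \<le> 1" for s
  proof -
    have "A s *v v \<noteq> 0" if v: "v \<noteq> 0" for v
    proof -
      have "v \<bullet> (A s *v v) = s * (v \<bullet> f v) + (1 - s) * (v \<bullet> v)"
        using fun_cong[OF matrix_vector_mul(2)[OF lin], of v]
        by (simp add: A_def matrix_vector_mult_add_rdistrib inner_add_right flip: scaleR_matrix_vector_assoc)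
      also have "\<dots> > 0"
      proof (cases "s = 0")
        case False
        then show ?thesis using s pos[OF v] v by (intro add_pos_nonneg) auto
      qed (use v in auto)
      finally show ?thesis by force
    qed
    then show ?thesis
      using invertible_det_nz matrix_left_invertible_ker invertible_left_inverse by metis
  qed
  have cont: "continuous_on {0..1} (\<lambda>s. det (A s))"
    unfolding A_def det_def by (intro continuous_intros)
  show ?thesis
  proof (rule ccontr)
    assume "\<not> det (matrix f) > 0"
    then have "det (A 1) \<le> 0" "0 \<le> det (A 0)" by (simp_all add: A_def)
    from IVT2'[OF this _ cont] obtain s where "0 \<le> s" "s \<le> 1" "det (A s) = 0" by auto
    with nz show False by blast
  qed
qed


text \<open>Here \<open>h y t = y \<bullet> p y t\<close> is a time-dependent support function, one-homogeneous in \<open>y\<close>, with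
  spatial gradient \<open>p\<close>; \<open>L\<close> is the spatial derivative of \<open>p\<close> at unit vectors and \<open>q\<close> its time
  derivative.\<close>

locale support_family =
  fixes p q :: "real^'n \<Rightarrow> real \<Rightarrow> real^'n" and L :: "real^'n \<Rightarrow> real \<Rightarrow> real^'n \<Rightarrow> real^'n"
  assumes p_deriv: "y \<noteq> 0 \<Longrightarrow> t \<ge> 0 \<Longrightarrow>
      ((\<lambda>z. p (fst z) (snd z)) has_derivative
        (\<lambda>w. (1 / norm y) *\<^sub>R L (sgn y) t (fst w) + snd w *\<^sub>R q (sgn y) t))
      (at (y, t) within (- {0}) \<times> {0..})"
    and p_sgn: "p (sgn y) t = p y t"
    and L_radial: "norm x = 1 \<Longrightarrow> t \<ge> 0 \<Longrightarrow> L x t x = 0"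
    and L_tangent: "norm x = 1 \<Longrightarrow> t \<ge> 0 \<Longrightarrow> x \<bullet> L x t v = 0"
    and L_pos: "norm x = 1 \<Longrightarrow> t \<ge> 0 \<Longrightarrow> x \<bullet> v = 0 \<Longrightarrow> v \<noteq> 0 \<Longrightarrow> v \<bullet> L x t v > 0"
    and h_pos: "norm x = 1 \<Longrightarrow> t \<ge> 0 \<Longrightarrow> x \<bullet> p x t > 0"
    and shrinking: "norm x = 1 \<Longrightarrow> t \<ge> 0 \<Longrightarrow> x \<bullet> q x t < x \<bullet> p x t"
    and tangent_ineq: "norm x = 1 \<Longrightarrow> norm y = 1 \<Longrightarrow> t \<ge> 0 \<Longrightarrow> y \<bullet> p x t \<le> y \<bullet> p y t"
begin

lemma p_deriv_space:
  assumes "y \<noteq> 0" "t \<ge> 0"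
  shows "((\<lambda>y. p y t) has_derivative (\<lambda>v. (1 / norm y) *\<^sub>R L (sgn y) t v)) (at y)"
proof -
  have "((\<lambda>z. p (fst z) (snd z)) has_derivative
        (\<lambda>w. (1 / norm y) *\<^sub>R L (sgn y) t (fst w) + snd w *\<^sub>R q (sgn y) t))
      (at (y, t) within (\<lambda>y. (y, t)) ` (- {0}))"
    by (rule has_derivative_subset[OF p_deriv]) (use assms in auto)
  moreover have "((\<lambda>y. (y, t)) has_derivative (\<lambda>v. (v, 0))) (at y within - {0})"
    by (auto intro!: derivative_eq_intros)
  ultimately have "((\<lambda>y. p y t) has_derivative (\<lambda>v. (1 / norm y) *\<^sub>R L (sgn y) t v)) (at y within - {0})"
    by (auto dest: has_derivative_in_compose[rotated])
  then show ?thesis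
    using assms by (simp add: at_within_open[of _ "- {0}"] open_Compl)
qed

lemma p_deriv_time:
  assumes "y \<noteq> 0" "t \<ge> 0"
  shows "((\<lambda>t. p y t) has_vector_derivative q (sgn y) t) (at t within {0..})"
proof -
  have lin: "linear (\<lambda>w. (1 / norm y) *\<^sub>R L (sgn y) t (fst w) + snd w *\<^sub>R q (sgn y) t)"
    using p_deriv[OF assms] by (rule has_derivative_linear)
  have L0: "(1 / norm y) *\<^sub>R L (sgn y) t 0 = 0"
    using linear_0[OF lin] by (simp add: zero_prod_def)
  have "((\<lambda>z. p (fst z) (snd z)) has_derivative
        (\<lambda>w. (1 / norm y) *\<^sub>R L (sgn y) t (fst w) + snd w *\<^sub>R q (sgn y) t))
      (at (y, t) within (\<lambda>t. (y, t)) ` {0..})"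
    by (rule has_derivative_subset[OF p_deriv]) (use assms in auto)
  moreover have "((\<lambda>t. (y, t)) has_derivative (\<lambda>s. (0, s))) (at t within {0..})"
    by (auto intro!: derivative_eq_intros)
  ultimately show ?thesis
    unfolding has_vector_derivative_def using L0
    by (auto dest: has_derivative_in_compose[rotated])
qed

lemma linear_L:
  assumes x: "norm x = 1" and t: "t \<ge> 0"
  shows "linear (L x t)"
proof -
  have "x \<noteq> 0" and s: "sgn x = x" using x by (auto simp: sgn_div_norm)
  from p_deriv_space[OF this(1) t] have "linear (\<lambda>v. (1 / norm x) *\<^sub>R L (sgn x) t v)"
    by (rule has_derivative_linear)
  then show ?thesis by (simp add: x s)
qed

text \<open>The gradient of a support function is the boundary point itself: the other term of the
  product rule, \<open>y\<close> against the derivative of \<open>p\<close>, vanishes because that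
  derivative is tangential.\<close>

lemma h_deriv:
  assumes "y \<noteq> 0" "t \<ge> 0"
  shows "((\<lambda>y. y \<bullet> p y t) has_derivative (\<lambda>v. v \<bullet> p y t)) (at y)"
proof -
  have "sgn y \<bullet> L (sgn y) t v = 0" for v
    using assms by (intro L_tangent) (auto simp: norm_sgn)
  then have "y \<bullet> L (sgn y) t v = 0" for v
    using assms by (simp add: sgn_div_norm)
  then show ?thesis
    by (auto intro!: derivative_eq_intros p_deriv_space assms simp: fun_eq_iff)
qed

lemma p_cont: "continuous_on ((- {0}) \<times> {0..}) (\<lambda>z. p (fst z) (snd z))"
  unfolding continuous_on_eq_continuous_within
proof
  fix z :: "(real^'n) \<times> real" assume "z \<in> (- {0}) \<times> {0..}"
  then obtain y t where z: "z = (y, t)" and "y \<noteq> 0" "t \<ge> 0" by blast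
  then show "continuous (at z within (- {0}) \<times> {0..}) (\<lambda>z. p (fst z) (snd z))"
    unfolding z by (intro has_derivative_continuous[OF p_deriv])
qed

text \<open>The time derivative is \<open>exp (- t)\<close> times
  \<open>x \<bullet> q x t - x \<bullet> p x t\<close>, which \<open>shrinking\<close> makes
  negative.\<close>

lemma h_strict_decreasing:
  assumes x: "norm x = 1" and s: "0 \<le> s" "s < t"
  shows "exp (- t) * (x \<bullet> p x t) < exp (- s) * (x \<bullet> p x s)"
proof (rule DERIV_neg_imp_decreasing_open[OF s(2)])
  have x0: "x \<noteq> 0" and sgn: "sgn x = x" using x by (auto simp: sgn_div_norm)
  have "((\<lambda>t. x \<bullet> p x t) has_vector_derivative x \<bullet> q (sgn x) t) (at t within {0..})" if "t \<ge> 0" for t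
    using p_deriv_time[OF x0 that] bounded_linear.has_vector_derivative[OF bounded_linear_inner_right]
    by blast
  then have d: "((\<lambda>t. x \<bullet> p x t) has_real_derivative x \<bullet> q x t) (at t within {0..})" if "t \<ge> 0" for t
    using that by (simp add: sgn has_real_derivative_iff_has_vector_derivative)
  show "\<exists>y. ((\<lambda>t. exp (- t) * (x \<bullet> p x t)) has_real_derivative y) (at r) \<and> y < 0"
    if r: "s < r" "r < t" for r
  proof (intro exI conjI)
    have "at r within {0..} = at r" using r s by (intro at_within_open_subset[of _ "{0<..}"]) auto
    with d[of r] have "((\<lambda>t. x \<bullet> p x t) has_real_derivative x \<bullet> q x r) (at r)" using r s by simp
    then show "((\<lambda>t. exp (- t) * (x \<bullet> p x t)) has_real_derivative
        exp (- r) * (x \<bullet> q x r - x \<bullet> p x r)) (at r)"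
      by (auto intro!: derivative_eq_intros simp: algebra_simps)
    show "exp (- r) * (x \<bullet> q x r - x \<bullet> p x r) < 0"
      using shrinking[OF x, of r] r s by (simp add: mult_pos_neg)
  qed
  have "continuous_on {0..} (\<lambda>t. x \<bullet> p x t)"
    using d by (intro DERIV_continuous_on) auto
  then have "continuous_on {s..t} (\<lambda>t. x \<bullet> p x t)"
    by (rule continuous_on_subset) (use s in auto)
  then show "continuous_on {s..t} (\<lambda>t. exp (- t) * (x \<bullet> p x t))"
    by (intro continuous_on_mult continuous_on_exp continuous_on_minus continuous_on_id)
qed

lemma h_decreasing:
  assumes "norm x = 1" "0 \<le> s" "s \<le> t"
  shows "exp (- t) * (x \<bullet> p x t) \<le> exp (- s) * (x \<bullet> p x s)"
  using h_strict_decreasing[OF assms(1,2), of t] assms(3) by (cases "s = t") auto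

text \<open>The support function minus the linear function of \<open>w\<close> has a local minimum
  at \<open>x\<close>, so its gradient \<open>p x t - w\<close> vanishes. Homogeneity first extends
  the inequality from unit vectors to a full neighbourhood of \<open>x\<close>.\<close>

lemma p_eq_of_touching:
  assumes x: "norm x = 1" and t: "t \<ge> 0"
    and le: "\<And>y. norm y = 1 \<Longrightarrow> y \<bullet> w \<le> y \<bullet> p y t" and eq: "x \<bullet> w = x \<bullet> p x t"
  shows "p x t = w"
proof -
  have x0: "x \<noteq> 0" using x by auto
  have le': "y \<bullet> w \<le> y \<bullet> p y t" if "y \<noteq> 0" for y
  proof -
    have "norm y * (sgn y \<bullet> w) \<le> norm y * (sgn y \<bullet> p y t)"
      using le[of "sgn y"] that by (intro mult_left_mono) (auto simp: norm_sgn p_sgn)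
    then show ?thesis using that by (simp add: sgn_div_norm)
  qed
  have "((\<lambda>y. y \<bullet> p y t - y \<bullet> w) has_derivative (\<lambda>v. v \<bullet> p x t - v \<bullet> w)) (at x)"
    by (intro has_derivative_diff h_deriv x0 t) (auto intro!: derivative_eq_intros)
  then have "(\<lambda>v. v \<bullet> p x t - v \<bullet> w) = (\<lambda>v. 0)"
    by (rule has_derivative_local_min[where f = "\<lambda>y. y \<bullet> p y t - y \<bullet> w"])
      (use eq le' x0 in \<open>auto simp: eventually_at_filter intro!: eventually_mono[OF t1_space_nhds[OF x0]]\<close>)
  from fun_cong[OF this, of "p x t - w"] show ?thesis
    by (simp flip: inner_diff_right)
qed

text \<open>If two normals shared a boundary point, the support function would be linear on the
  segment between them and \<open>p\<close> constant along it. The derivative of \<open>p\<close> at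
  \<open>x\<close> towards \<open>y\<close> would then vanish, against the positivity of
  \<open>L\<close> on tangent vectors.\<close>

lemma p_inj:
  assumes x: "norm x = 1" and y: "norm y = 1" and t: "t \<ge> 0" and eq: "p x t = p y t"
  shows "x = y"
proof -
  define c where "c s = x + s *\<^sub>R (y - x)" for s
  have x0: "x \<noteq> 0" and sgn: "sgn x = x" using x by (auto simp: sgn_div_norm)
  \<comment> \<open>The common point has positive height over both normals, so they are not
    antipodal and the segment between them avoids the origin.\<close>
  have "y \<noteq> - x"
    using h_pos[OF x t] h_pos[OF y t] eq by auto
  have c0: "c s \<noteq> 0" if s: "0 \<le> s" "s \<le> 1" for s
  proof
    assume "c s = 0"
    then have *: "(1 - s) *\<^sub>R x = - (s *\<^sub>R y)" by (simp add: c_def algebra_simps add_eq_0_iff)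
    from arg_cong[OF this, of norm] have "s = 1/2" using s x y by simp
    with * have "x = - y" by (simp add: scaleR_left.minus flip: scaleR_minus_right)
    with \<open>y \<noteq> - x\<close> show False by simp
  qed
  have pc: "p (c s) t = p x t" if s: "0 \<le> s" "s \<le> 1" for s
  proof -
    let ?z = "sgn (c s)"
    have z: "norm ?z = 1" using c0[OF s] by (simp add: norm_sgn)
    \<comment> \<open>Convexity of the support function, combined with the assumption that both ends
      share their point, bounds it by the height of that point; the converse is
      \<open>tangent_ineq\<close>, so the point touches in direction \<open>c s\<close> as
      well.\<close>
    have "c s \<bullet> p (c s) t = (1 - s) * (x \<bullet> p (c s) t) + s * (y \<bullet> p (c s) t)"
      by (simp add: c_def inner_add_left inner_diff_left algebra_simps)
    also have "\<dots> \<le> (1 - s) * (x \<bullet> p x t) + s * (y \<bullet> p y t)"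
      using tangent_ineq[OF z x t] tangent_ineq[OF z y t] s
      by (intro add_mono mult_left_mono) (auto simp: p_sgn)
    also have "\<dots> = c s \<bullet> p x t"
      by (simp add: c_def inner_add_left inner_diff_left algebra_simps eq)
    finally have "norm (c s) * (?z \<bullet> p (c s) t) \<le> norm (c s) * (?z \<bullet> p x t)"
      using c0[OF s] by (simp add: sgn_div_norm)
    then have "?z \<bullet> p ?z t \<le> ?z \<bullet> p x t"
      using c0[OF s] by (simp add: p_sgn)
    then have "?z \<bullet> p x t = ?z \<bullet> p ?z t"
      using tangent_ineq[OF x z t] by simp
    then have "p ?z t = p x t"
      using tangent_ineq[OF x _ t] by (intro p_eq_of_touching[OF z t]) auto
    then show ?thesis by (simp add: p_sgn)
  qed
  have "((\<lambda>z. p z t) has_derivative L x t) (at (c 0) within c ` {0..1})"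
    using has_derivative_at_withinI[OF p_deriv_space[OF x0 t]] by (simp add: c_def x sgn)
  moreover have "(c has_derivative (\<lambda>s. s *\<^sub>R (y - x))) (at 0 within {0..1})"
    unfolding c_def by (auto intro!: derivative_eq_intros)
  ultimately have d1: "((\<lambda>s. p (c s) t) has_derivative (\<lambda>s. L x t (s *\<^sub>R (y - x)))) (at 0 within {0..1})"
    by (rule has_derivative_in_compose[rotated])
  have "((\<lambda>s. p (c s) t) has_derivative (\<lambda>s. 0)) (at 0 within {0..1})"
    by (rule has_derivative_transform[where f = "\<lambda>s. p x t"]) (auto simp: pc)
  with d1 have "(\<lambda>s. L x t (s *\<^sub>R (y - x))) = (\<lambda>s. 0)"
    by (intro frechet_derivative_unique_within_closed_interval[of 0 1 0]) auto
  from fun_cong[OF this, of 1] have "L x t (y - x) = 0" by simp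
  \<comment> \<open>\<open>L\<close> kills the radial part of \<open>y - x\<close>; positivity
    applies to the tangential part, which must therefore be zero.\<close>
  define v where "v = y - x - (x \<bullet> (y - x)) *\<^sub>R x"
  have xv: "x \<bullet> v = 0" using x by (simp add: v_def inner_diff_right norm_eq_1)
  have "L x t v = 0"
    using \<open>L x t (y - x) = 0\<close> linear_L[OF x t]
    by (simp add: v_def linear_diff linear_cmul L_radial[OF x t])
  with L_pos[OF x t xv] have "v = 0" by force
  then obtain a where a: "y = a *\<^sub>R x" by (metis v_def eq_iff_diff_eq_0 diff_eq_eq scaleR_left.add scaleR_one)
  then have "\<bar>a\<bar> = 1" using x y by simp
  then show ?thesis using a \<open>y \<noteq> - x\<close> by (auto simp: abs_if split: if_splits)
qed

section \<open>The sweeping map and its Jacobian\<close>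

definition G :: "real^'n \<Rightarrow> real^'n" where
  "G y = norm y *\<^sub>R p y (- ln (norm y))"

text \<open>The derivative of \<open>- ln (norm y)\<close> gives \<open>q\<close> its minus sign,
  and the prefactor \<open>norm y\<close> cancels the \<open>1 / norm y\<close> in the derivatives
  of \<open>p\<close> and of the logarithm.\<close>

definition G' :: "real^'n \<Rightarrow> real^'n \<Rightarrow> real^'n" where
  "G' y v = (sgn y \<bullet> v) *\<^sub>R (p y (- ln (norm y)) - q (sgn y) (- ln (norm y)))
            + L (sgn y) (- ln (norm y)) v"

text \<open>The Jacobian of \<open>G\<close> at \<open>exp (- t) *\<^sub>R x\<close>: the inward
  normal speed of the rescaled bodies, up to the factor \<open>exp (- t)\<close>, times the
  determinant of \<open>L\<close> extended by the identity on the normal line.\<close>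

definition J :: "real^'n \<Rightarrow> real \<Rightarrow> real" where
  "J x t = (x \<bullet> p x t - x \<bullet> q x t) * det (matrix (\<lambda>v. L x t v + (x \<bullet> v) *\<^sub>R x))"

lemma G_deriv:
  assumes y: "y \<in> cball 0 1 - {0}"
  shows "(G has_derivative G' y) (at y within cball 0 1 - {0})"
proof -
  let ?D = "cball 0 1 - {0} :: (real^'n) set" and ?t = "\<lambda>y. - ln (norm y)"
  have y0: "y \<noteq> 0" and t: "?t z \<ge> 0" if "z \<in> ?D" for z using y that by auto
  have x: "norm (sgn y) = 1" using y0 y by (simp add: norm_sgn)
  have "((\<lambda>z. p (fst z) (snd z)) has_derivative
        (\<lambda>w. (1 / norm y) *\<^sub>R L (sgn y) (?t y) (fst w) + snd w *\<^sub>R q (sgn y) (?t y)))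
      (at (y, ?t y) within (\<lambda>y. (y, ?t y)) ` ?D)"
    by (rule has_derivative_subset[OF p_deriv]) (use y t in auto)
  moreover have "(norm has_derivative (\<lambda>v. v \<bullet> sgn y)) (at y within ?D)"
    using has_derivative_at_withinI[OF has_derivative_norm] y by blast
  then have "((\<lambda>y. (y, ?t y)) has_derivative (\<lambda>v. (v, - (v \<bullet> sgn y * inverse (norm y))))) (at y within ?D)"
    using y by (intro has_derivative_Pair has_derivative_ident has_derivative_minus has_derivative_ln) auto
  then have "((\<lambda>y. (y, ?t y)) has_derivative (\<lambda>v. (v, - (v \<bullet> sgn y / norm y)))) (at y within ?D)"
    by (simp add: divide_inverse)
  ultimately have "((\<lambda>y. p y (?t y)) has_derivative (\<lambda>v. (1 / norm y) *\<^sub>R L (sgn y) (?t y) v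
      + (- (v \<bullet> sgn y / norm y)) *\<^sub>R q (sgn y) (?t y))) (at y within ?D)"
    by (auto dest: has_derivative_in_compose[rotated])
  from has_derivative_scaleR[OF has_derivative_at_withinI[OF has_derivative_norm] this]
  have "((\<lambda>y. norm y *\<^sub>R p y (?t y)) has_derivative (\<lambda>v. norm y *\<^sub>R ((1 / norm y) *\<^sub>R L (sgn y) (?t y) v
      + (- (v \<bullet> sgn y / norm y)) *\<^sub>R q (sgn y) (?t y)) + (v \<bullet> sgn y) *\<^sub>R p y (?t y))) (at y within ?D)"
    using y by auto
  also have "(\<lambda>v. norm y *\<^sub>R ((1 / norm y) *\<^sub>R L (sgn y) (?t y) v
      + (- (v \<bullet> sgn y / norm y)) *\<^sub>R q (sgn y) (?t y)) + (v \<bullet> sgn y) *\<^sub>R p y (?t y)) = G' y"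
    using y by (auto simp: fun_eq_iff G'_def algebra_simps inner_commute)
  finally show ?thesis by (simp add: G_def[abs_def])
qed

lemma det_L_pos:
  assumes x: "norm x = 1" and t: "t \<ge> 0"
  shows "det (matrix (\<lambda>v. L x t v + (x \<bullet> v) *\<^sub>R x)) > 0"
proof (rule det_pos)
  note lin = linear_L[OF x t]
  show "linear (\<lambda>v. L x t v + (x \<bullet> v) *\<^sub>R x)"
    by (auto intro!: linearI simp: linear_add[OF lin] linear_cmul[OF lin] algebra_simps)
  fix v :: "real^'n" assume v: "v \<noteq> 0"
  define w where "w = v - (x \<bullet> v) *\<^sub>R x"
  have xw: "x \<bullet> w = 0" using x by (simp add: w_def inner_diff_right norm_eq_1)
  have vw: "v = w + (x \<bullet> v) *\<^sub>R x" by (simp add: w_def)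
  have "L x t v = L x t w"
    by (subst vw) (simp only: linear_add[OF lin] linear_cmul[OF lin] L_radial[OF x t], simp)
  then have "v \<bullet> L x t v = w \<bullet> L x t w"
    by (subst vw) (simp add: inner_add_left L_tangent[OF x t])
  moreover have "w \<bullet> L x t w > 0 \<or> (w = 0 \<and> x \<bullet> v \<noteq> 0)"
    using L_pos[OF x t xw] v vw by force
  ultimately show "v \<bullet> (L x t v + (x \<bullet> v) *\<^sub>R x) > 0"
    by (auto simp: inner_add_right inner_commute[of v x] add_pos_nonneg
        zero_less_mult_iff)
qed

text \<open>The extension \<open>?M\<close> of \<open>L\<close> preserves the component along
  \<open>x\<close>, so the rank-one map \<open>?N\<close> applied after it replaces the normal image
  \<open>x\<close> by \<open>p x t - q x t\<close>. The determinant of \<open>?N\<close> is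
  \<open>1 + x \<bullet> ?w\<close>, which is the speed factor of \<open>J\<close>.\<close>

lemma det_G':
  assumes y: "y \<in> cball 0 1 - {0}"
  shows "\<bar>det (matrix (G' y))\<bar> = J (sgn y) (- ln (norm y))"
proof -
  define t where "t = - ln (norm y)"
  define x where "x = sgn y"
  have t0: "t \<ge> 0" and x1: "norm x = 1" using y by (auto simp: t_def x_def norm_sgn)
  note lin = linear_L[OF x1 t0]
  let ?w = "p x t - q x t - x"
  let ?N = "\<lambda>v. v + (x \<bullet> v) *\<^sub>R ?w" and ?M = "\<lambda>v. L x t v + (x \<bullet> v) *\<^sub>R x"
  have "x \<bullet> ?M v = x \<bullet> v" for v
    using x1 by (simp add: inner_add_right L_tangent[OF x1 t0] norm_eq_1)
  then have "G' y = ?N \<circ> ?M"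
    by (simp add: fun_eq_iff G'_def x_def t_def p_sgn algebra_simps)
  moreover have "linear ?N" "linear ?M"
    by (auto intro!: linearI simp: linear_add[OF lin] linear_cmul[OF lin] algebra_simps)
  ultimately have "det (matrix (G' y)) = (1 + x \<bullet> ?w) * det (matrix ?M)"
    by (simp only: det_matrix_compose det_rank_one_update[OF x1])
  also have "\<dots> = J x t"
    using x1 by (simp add: J_def inner_diff_right norm_eq_1)
  finally have "det (matrix (G' y)) = J x t" .
  moreover have "J x t > 0"
    using det_L_pos[OF x1 t0] shrinking[OF x1 t0] by (simp add: J_def)
  ultimately show ?thesis by (simp add: x_def t_def)
qed

lemma G_polar:
  assumes "y \<in> cball 0 1 - {0}"
  obtains x t where "norm x = 1" "t \<ge> 0" "y = exp (- t) *\<^sub>R x" "G y = exp (- t) *\<^sub>R p x t"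
proof
  show "norm (sgn y) = 1" "- ln (norm y) \<ge> 0" "y = exp (- (- ln (norm y))) *\<^sub>R sgn y"
    "G y = exp (- (- ln (norm y))) *\<^sub>R p (sgn y) (- ln (norm y))"
    using assms by (auto simp: norm_sgn G_def p_sgn) (simp add: sgn_div_norm)
qed

lemma G_inj: "inj_on G (cball 0 1 - {0})"
proof (rule inj_onI)
  fix y y' assume y: "y \<in> cball 0 1 - {0}" and y': "y' \<in> cball 0 1 - {0}" and eq: "G y = G y'"
  obtain x t where x: "norm x = 1" "t \<ge> 0" "y = exp (- t) *\<^sub>R x" "G y = exp (- t) *\<^sub>R p x t"
    using G_polar[OF y] .
  obtain x' t' where x': "norm x' = 1" "t' \<ge> 0" "y' = exp (- t') *\<^sub>R x'" "G y' = exp (- t') *\<^sub>R p x' t'"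
    using G_polar[OF y'] .
  have *: "exp (- t) *\<^sub>R p x t = exp (- t') *\<^sub>R p x' t'"
    using x x' eq by simp
  \<comment> \<open>If \<open>t < t'\<close>, the common point lies in the later body, whose height
    over \<open>x\<close> is strictly smaller than the height which the point has as a boundary
    point at time \<open>t\<close>.\<close>
  have aux: "t' \<le> t" if "exp (- t) *\<^sub>R p x t = exp (- t') *\<^sub>R p x' t'" "norm x = 1" "t \<ge> 0"
    "norm x' = 1" "t' \<ge> 0" for x x' t t'
  proof (rule ccontr)
    assume "\<not> t' \<le> t"
    then have "exp (- t') * (x \<bullet> p x t') < exp (- t) * (x \<bullet> p x t)"
      using that by (intro h_strict_decreasing) auto
    also have "\<dots> = x \<bullet> (exp (- t) *\<^sub>R p x t)" by simp
    also have "\<dots> = exp (- t') * (x \<bullet> p x' t')" unfolding that(1) by simp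
    also have "\<dots> \<le> exp (- t') * (x \<bullet> p x t')"
      using tangent_ineq[of x' x t'] that by simp
    finally show False by simp
  qed
  from aux[OF * x(1,2) x'(1,2)] aux[OF *[symmetric] x'(1,2) x(1,2)] have "t = t'" by simp
  with * have "p x t = p x' t" by simp
  from p_inj[OF x(1) x'(1) x(2) this] show "y = y'"
    using x x' \<open>t = t'\<close> by simp
qed

section \<open>The region swept out\<close>

definition body :: "(real^'n) set" where
  "body = {z. \<forall>x. norm x = 1 \<longrightarrow> x \<bullet> z \<le> x \<bullet> p x 0}"

text \<open>The intersection of the bodies at time \<open>t\<close> rescaled by
  \<open>exp (- t)\<close>, over all \<open>t \<ge> 0\<close>: the points which the shrinking
  boundaries never reach.\<close>

definition core :: "(real^'n) set" where
  "core = {z. \<forall>t\<ge>0. \<forall>x. norm x = 1 \<longrightarrow> x \<bullet> z \<le> exp (- t) * (x \<bullet> p x t)}"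

lemma h_cont: "continuous_on ({x. norm x = 1} \<times> {0..}) (\<lambda>z. exp (- snd z) * (fst z \<bullet> p (fst z) (snd z)))"
  by (intro continuous_intros continuous_on_subset[OF p_cont]) auto

text \<open>A point of \<open>body\<close> that some later rescaled body misses has a last time
  \<open>s\<close> up to \<open>s0\<close> at which it still satisfies all support inequalities.
  Directions violated at times just after \<open>s\<close> accumulate, by compactness of the sphere,
  at a direction of contact.\<close>

lemma touching_time:
  assumes z: "z \<in> body" and s0: "s0 \<ge> 0" and x0: "norm x0 = 1"
    and out: "exp (- s0) * (x0 \<bullet> p x0 s0) < x0 \<bullet> z"
  obtains x s where "norm x = 1" "s \<ge> 0" "x \<bullet> z = exp (- s) * (x \<bullet> p x s)"
    "\<And>y. norm y = 1 \<Longrightarrow> y \<bullet> z \<le> exp (- s) * (y \<bullet> p y s)"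
proof -
  define H where "H x s = exp (- s) * (x \<bullet> p x s)" for x s
  define A where "A = {s \<in> {0..s0}. \<forall>x. norm x = 1 \<longrightarrow> x \<bullet> z \<le> H x s}"
  have contH: "continuous_on ({x. norm x = 1} \<times> {0..}) (\<lambda>z. H (fst z) (snd z))"
    unfolding H_def by (rule h_cont)
  have seqH: "(\<lambda>n. H (X n) (S n)) \<longlonglongrightarrow> H x s"
    if "X \<longlonglongrightarrow> x" "S \<longlonglongrightarrow> s" "\<And>n. norm (X n) = 1" "\<And>n. S n \<ge> 0" "norm x = 1" "s \<ge> 0" for X S x s
    using continuous_on_tendsto_compose[OF contH tendsto_Pair[OF that(1,2)]] that by auto
  have "0 \<in> A" using z s0 by (auto simp: A_def body_def H_def)
  have "closed A"
  proof (rule closed_sequential_limits[THEN iffD2], intro allI impI, elim conjE)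
    fix S s assume S: "\<forall>n. S n \<in> A" "S \<longlonglongrightarrow> s"
    have "closed {0..s0}" by simp
    then have s: "s \<in> {0..s0}" by (rule closed_sequentially[of _ S]) (use S in \<open>auto simp: A_def\<close>)
    moreover have "x \<bullet> z \<le> H x s" if "norm x = 1" for x
    proof (rule LIMSEQ_le_const)
      show "(\<lambda>n. H x (S n)) \<longlonglongrightarrow> H x s"
        using S s that by (intro seqH) (auto simp: A_def)
      show "\<exists>N. \<forall>n\<ge>N. x \<bullet> z \<le> H x (S n)"
        using S that by (auto simp: A_def)
    qed
    ultimately show "s \<in> A" by (auto simp: A_def)
  qed
  moreover have "bounded A" by (rule bounded_subset[of "{0..s0}"]) (auto simp: A_def)
  ultimately have "compact A" by (simp add: compact_eq_bounded_closed)
  then obtain s where s: "s \<in> A" "\<And>r. r \<in> A \<Longrightarrow> r \<le> s"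
    using compact_attains_sup[of A] \<open>0 \<in> A\<close> by blast
  have sle: "0 \<le> s" "s \<le> s0" and sA: "\<And>x. norm x = 1 \<Longrightarrow> x \<bullet> z \<le> H x s"
    using s(1) by (auto simp: A_def)
  have "s \<noteq> s0" using sA[OF x0] out by (auto simp: H_def)
  then have "s < s0" using sle by simp
  \<comment> \<open>Times in the interval from \<open>s\<close> (excluded) to \<open>s0\<close> that
    tend to \<open>s\<close>; maximality of \<open>s\<close> gives each of them a violated direction
    \<open>X n\<close>.\<close>
  define S where "S n = s + (s0 - s) / real (Suc n)" for n
  have S: "S \<longlonglongrightarrow> s"
    unfolding S_def using tendsto_add[OF tendsto_const LIMSEQ_Suc[OF lim_const_over_n[of "s0 - s"]], of s]
    by simp
  have Sgt: "s < S n" "S n \<le> s0" for n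
  proof -
    show "s < S n" using \<open>s < s0\<close> by (simp add: S_def)
    have "(s0 - s) / real (Suc n) \<le> s0 - s" using \<open>s < s0\<close> by (simp add: divide_le_eq)
    then show "S n \<le> s0" by (simp add: S_def)
  qed
  have notA: "S n \<notin> A" for n using s(2)[of "S n"] Sgt(1)[of n] by auto
  have "\<exists>x. norm x = 1 \<and> H x (S n) < x \<bullet> z" for n
    using notA[of n] Sgt[of n] sle by (auto simp: A_def not_le)
  then obtain X where X: "\<And>n. norm (X n) = 1" "\<And>n. H (X n) (S n) < X n \<bullet> z" by metis
  have "compact (sphere 0 1 :: (real^'n) set)" by simp
  then obtain x r where x: "x \<in> sphere 0 1" and r: "strict_mono r" "(X \<circ> r) \<longlonglongrightarrow> x"
    unfolding compact_def using X(1) by (metis dist_0_norm mem_sphere)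
  have "H x s \<le> x \<bullet> z"
  proof (rule LIMSEQ_le)
    show "(\<lambda>n. H (X (r n)) (S (r n))) \<longlonglongrightarrow> H x s"
      using r x X LIMSEQ_subseq_LIMSEQ[OF S r(1)] sle Sgt(1)
      by (intro seqH) (auto simp: o_def less_imp_le intro: order_trans)
    show "(\<lambda>n. X (r n) \<bullet> z) \<longlonglongrightarrow> x \<bullet> z"
      using r by (auto intro!: tendsto_intros simp: o_def)
    show "\<exists>N. \<forall>n\<ge>N. H (X (r n)) (S (r n)) \<le> X (r n) \<bullet> z"
      using X(2) by (auto intro: less_imp_le)
  qed
  with sA[of x] x have "x \<bullet> z = H x s" by auto
  with that[of x s] x sle sA show ?thesis by (auto simp: H_def)
qed

lemma G_image: "G ` (cball 0 1 - {0}) = body - core"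
proof (intro equalityI subsetI)
  fix z assume "z \<in> G ` (cball 0 1 - {0})"
  then obtain x t where x: "norm x = 1" "t \<ge> 0" "z = exp (- t) *\<^sub>R p x t"
    by (auto elim!: G_polar[rotated] simp: image_iff) (metis G_polar Diff_iff mem_cball_0 singletonD)
  have "y \<bullet> z \<le> y \<bullet> p y 0" if y: "norm y = 1" for y
  proof -
    have "y \<bullet> z \<le> exp (- t) * (y \<bullet> p y t)"
      using tangent_ineq[OF x(1) y x(2)] by (simp add: x(3))
    also have "\<dots> \<le> exp (- 0) * (y \<bullet> p y 0)"
      by (rule h_decreasing[OF y]) (use x in auto)
    finally show ?thesis by simp
  qed
  \<comment> \<open>Any time after \<open>t\<close> would do: strict shrinking puts the boundary
    point of time \<open>t\<close> outside the later body, hence outside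
    \<open>core\<close>.\<close>
  moreover have "exp (- (t + 1)) * (x \<bullet> p x (t + 1)) < x \<bullet> z"
    using h_strict_decreasing[OF x(1,2), of "t + 1"] by (simp add: x(3))
  ultimately show "z \<in> body - core"
    using x by (auto simp: body_def core_def not_le intro!: exI[of _ "t + 1"] exI[of _ x])
next
  fix z assume z: "z \<in> body - core"
  then obtain s0 x0 where "s0 \<ge> 0" "norm x0 = 1" "exp (- s0) * (x0 \<bullet> p x0 s0) < x0 \<bullet> z"
    by (auto simp: core_def not_le)
  with touching_time z obtain x s where x: "norm x = 1" "s \<ge> 0" "x \<bullet> z = exp (- s) * (x \<bullet> p x s)"
    and le: "\<And>y. norm y = 1 \<Longrightarrow> y \<bullet> z \<le> exp (- s) * (y \<bullet> p y s)"
    by (metis DiffD1)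
  have "p x s = exp s *\<^sub>R z"
  proof (rule p_eq_of_touching[OF x(1,2)])
    fix y :: "real^'n" assume "norm y = 1"
    from mult_left_mono[OF le[OF this], of "exp s"]
    show "y \<bullet> exp s *\<^sub>R z \<le> y \<bullet> p y s" by (simp add: exp_minus field_simps)
  qed (simp add: x exp_minus)
  then have "z = exp (- s) *\<^sub>R p x s" by (simp add: exp_minus)
  also have "\<dots> = G (exp (- s) *\<^sub>R x)"
    using p_sgn[of "exp (- s) *\<^sub>R x"] p_sgn[of x] x by (simp add: G_def sgn_scaleR)
  finally show "z \<in> G ` (cball 0 1 - {0})"
    using x by (intro image_eqI) auto
qed

lemma closed_body: "closed body" and closed_core: "closed core"
proof -
  have "body = (\<Inter>x\<in>{x. norm x = 1}. {z. x \<bullet> z \<le> x \<bullet> p x 0})"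
    by (auto simp: body_def)
  also have "closed \<dots>" by (intro closed_INT ballI closed_halfspace_le)
  finally show "closed body" .
  have "core = (\<Inter>t\<in>{0..}. \<Inter>x\<in>{x. norm x = 1}. {z. x \<bullet> z \<le> exp (- t) * (x \<bullet> p x t)})"
    by (auto simp: core_def)
  also have "closed \<dots>" by (intro closed_INT ballI closed_halfspace_le)
  finally show "closed core" .
qed

lemma core_subset_body: "core \<subseteq> body"
  by (force simp: core_def body_def dest: spec[of _ 0])

lemma bounded_body: "bounded body"
proof -
  have "compact ((\<lambda>x. x \<bullet> p x 0) ` sphere 0 1)"
  proof (intro compact_continuous_image continuous_intros)
    have "continuous_on (sphere 0 1) (\<lambda>x. (\<lambda>z. p (fst z) (snd z)) (x, 0))"
      by (rule continuous_on_compose2[OF p_cont]) (auto intro!: continuous_intros)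
    then show "continuous_on (sphere 0 1) (\<lambda>x. p x 0)" by simp
  qed auto
  then obtain C where C0: "\<forall>r\<in>(\<lambda>x. x \<bullet> p x 0) ` sphere 0 1. norm r \<le> C"
    by (meson bounded_iff compact_imp_bounded)
  have C: "x \<bullet> p x 0 \<le> C" if "norm x = 1" for x
    using C0 that by (force dest: bspec[of _ _ "x \<bullet> p x 0"])
  have "norm z \<le> max 0 C" if z: "z \<in> body" for z
  proof (cases "z = 0")
    case False
    then have "norm (sgn z) = 1" by (simp add: norm_sgn)
    with z C[of "sgn z"] have "sgn z \<bullet> z \<le> C"
      unfolding body_def by (auto dest!: spec[of _ "sgn z"])
    then show ?thesis using False by (simp add: sgn_div_norm dot_square_norm power2_eq_square field_simps)
  qed simp
  then show ?thesis by (auto simp: bounded_iff)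
qed

text \<open>The unit sphere stands for time 0 and the puncture for infinite time, so the punctured
  closed ball parametrizes exactly \<open>body - core\<close>.\<close>

lemma measure_body:
  assumes "set_integrable lborel (cball 0 1 - {0}) (\<lambda>y. J (sgn y) (- ln (norm y)))"
  shows "measure lborel body = measure lborel core
    + (LINT y:cball 0 1 - {0}|lborel. J (sgn y) (- ln (norm y)))"
proof -
  let ?D = "cball 0 1 - {0} :: (real^'n) set"
  have fin: "body \<in> fmeasurable lborel" "core \<in> fmeasurable lborel"
    using bounded_body core_subset_body closed_body closed_core
    by (auto intro!: fmeasurable_compact bounded_subset[OF bounded_body] simp: compact_eq_bounded_closed)
  have cong: "set_lebesgue_integral lborel ?D (\<lambda>y. \<bar>det (matrix (G' y))\<bar>)
      = set_lebesgue_integral lborel ?D (\<lambda>y. J (sgn y) (- ln (norm y)))"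
    by (rule set_lebesgue_integral_cong) (auto simp: det_G')
  have int: "set_integrable lborel ?D (\<lambda>y. \<bar>det (matrix (G' y))\<bar>)"
    using assms by (subst set_integrable_cong[OF refl refl]) (auto simp: det_G')
  have "measure lborel (G ` ?D) = (LINT y:?D|lborel. \<bar>det (matrix (G' y))\<bar>)"
    by (rule measure_injective_image)
      (use G_deriv G_inj int closed_body closed_core in \<open>auto simp: G_image\<close>)
  also have "measure lborel (G ` ?D) = measure lborel body - measure lborel core"
    unfolding G_image using fin core_subset_body by (intro measure_Diff) (auto simp: fmeasurable_def)
  finally show ?thesis using cong by simp
qed

end

section \<open>Averages over the sphere\<close>

lemma borel_measurable_sgn_vec: "(sgn :: 'a::euclidean_space \<Rightarrow> 'a) \<in> borel_measurable borel"
  unfolding sgn_div_norm[abs_def] by measurable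

lemma measurable_sgn_cone:
  "sgn \<in> measurable (restrict_space lborel (ball 0 1 - {0})) (restrict_space borel (sphere 0 (1::real) :: (real^'n) set))"
  by (rule measurable_restrict_space2)
    (auto simp: space_restrict_space norm_sgn intro!: measurable_restrict_space1 borel_measurable_sgn_vec)

lemma space_sphere_measure [simp]: "space sphere_measure = (sphere 0 1 :: (real^'n) set)"
  by (simp add: sphere_measure_def space_scale_measure space_restrict_space)

lemma sets_sphere_measure [measurable_cong]:
  "sets (sphere_measure :: (real^'n) measure) = sets (restrict_space borel (sphere 0 1))"
  by (simp add: sphere_measure_def)

text \<open>The scaling factor becomes a constant density so that the integral rules for densities
  and image measures apply to \<open>sphere_measure\<close>.\<close>

lemma sphere_measure_density:
  "(sphere_measure :: (real^'n) measure) = density (distr (restrict_space lborel (ball 0 1 - {0}))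
     (restrict_space borel (sphere 0 1)) sgn) (\<lambda>_. ennreal (real CARD('n)))"
  unfolding sphere_measure_def
  by (rule measure_eqI) (auto simp: emeasure_density_const ennreal_of_nat_eq_real_of_nat)

lemma emeasure_sphere_measure_space:
  "emeasure sphere_measure (sphere (0::real^'n) 1) = ennreal (real CARD('n) * measure lborel (ball (0::real^'n) 1))"
proof -
  have cone: "sgn -` sphere 0 1 \<inter> (ball 0 1 - {0}) = ball (0::real^'n) 1 - {0}"
    by (auto simp: norm_sgn)
  have "emeasure sphere_measure (sphere (0::real^'n) 1)
      = ennreal (real CARD('n)) * emeasure lborel (ball (0::real^'n) 1 - {0})"
    unfolding sphere_measure_def
    by (subst emeasure_scale_measure, subst emeasure_distr[OF measurable_sgn_cone])
      (auto simp: emeasure_restrict_space space_restrict_space ennreal_of_nat_eq_real_of_nat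
        sets_restrict_space cone intro!: image_eqI[of _ _ UNIV])
  also have "emeasure lborel (ball (0::real^'n) 1 - {0}) = emeasure lborel (ball (0::real^'n) 1)"
    by (subst emeasure_Diff) auto
  also have "\<dots> = ennreal (measure lborel (ball (0::real^'n) 1))"
    using emeasure_lborel_ball_finite[of "0::real^'n" 1]
    by (intro emeasure_eq_ennreal_measure) (simp add: less_top)
  finally show ?thesis by (simp add: ennreal_mult')
qed

lemma finite_measure_sphere: "finite_measure (sphere_measure :: (real^'n) measure)"
  by (rule finite_measureI) (simp add: emeasure_sphere_measure_space)

lemma measure_sphere_measure_space:
  "measure sphere_measure (sphere (0::real^'n) 1) = real CARD('n) * measure lborel (ball (0::real^'n) 1)"
  by (simp add: measure_def emeasure_sphere_measure_space)

lemma measure_ball_pos: "measure lborel (ball (0::real^'n) 1) > 0"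
  using content_ball_pos[of 1 "0 :: real^'n"] by simp

lemma measure_sphere_pos: "measure sphere_measure (sphere (0::real^'n) 1) > 0"
  by (simp add: measure_sphere_measure_space measure_ball_pos del: measure_lborel_Icc)

lemma continuous_on_sphere_measurable:
  fixes f :: "real^'n \<Rightarrow> real"
  shows "continuous_on (sphere 0 1) f \<Longrightarrow> f \<in> borel_measurable sphere_measure"
  using borel_measurable_continuous_on_restrict[of "sphere 0 1" f]
  by (simp cong: measurable_cong_sets add: measurable_cong_sets[OF sets_sphere_measure refl])

lemma continuous_on_sphere_integrable:
  fixes f :: "real^'n \<Rightarrow> real"
  assumes "continuous_on (sphere 0 1) f"
  shows "integrable sphere_measure f"
proof -
  interpret finite_measure "sphere_measure :: (real^'n) measure" by (rule finite_measure_sphere)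
  have "bounded (f ` sphere 0 1)"
    using assms by (intro compact_imp_bounded compact_continuous_image) auto
  then obtain B where "\<And>x. x \<in> sphere 0 1 \<Longrightarrow> norm (f x) \<le> B"
    unfolding bounded_iff by blast
  then show ?thesis
    using assms by (intro integrable_const_bound[of _ B] continuous_on_sphere_measurable AE_I2) simp_all
qed

lemma sphere_avg_add:
  "integrable sphere_measure f \<Longrightarrow> integrable sphere_measure g \<Longrightarrow>
    sphere_avg (\<lambda>x. f x + g x) = sphere_avg f + sphere_avg (g :: real^'n \<Rightarrow> real)"
  by (simp add: sphere_avg_def add_divide_distrib)

lemma sphere_avg_diff:
  "integrable sphere_measure f \<Longrightarrow> integrable sphere_measure g \<Longrightarrow>
    sphere_avg (\<lambda>x. f x - g x) = sphere_avg f - sphere_avg (g :: real^'n \<Rightarrow> real)"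
  by (simp add: sphere_avg_def diff_divide_distrib)

lemma sphere_avg_const [simp]: "sphere_avg (\<lambda>x::real^'n. c) = c"
  using measure_sphere_pos[where 'n='n] by (simp add: sphere_avg_def measure_def)

lemma sphere_avg_mono:
  assumes "integrable sphere_measure f" "integrable sphere_measure g"
    "\<And>x. x \<in> sphere 0 1 \<Longrightarrow> f x \<le> g x"
  shows "sphere_avg f \<le> sphere_avg (g :: real^'n \<Rightarrow> real)"
  unfolding sphere_avg_def using assms measure_sphere_pos[where 'n='n]
  by (intro mult_left_mono integral_mono) auto

lemma sphere_avg_cong:
  "(\<And>x. x \<in> sphere 0 1 \<Longrightarrow> f x = g x) \<Longrightarrow> sphere_avg f = sphere_avg (g :: real^'n \<Rightarrow> real)"
  unfolding sphere_avg_def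
  by (intro arg_cong2[where f = "(*)"] refl Bochner_Integration.integral_cong) auto

text \<open>The factor \<open>CARD('n)\<close> occurs both in the surface integral and in the total
  area and cancels. This is the bridge between sphere averages and volumes.\<close>

lemma sphere_avg_cone:
  fixes f :: "real^'n \<Rightarrow> real"
  assumes f: "f \<in> borel_measurable sphere_measure"
  shows "sphere_avg f = (LINT y:ball 0 1 - {0}|lborel. f (sgn y)) / measure lborel (ball (0::real^'n) 1)"
proof -
  have f': "f \<in> borel_measurable (restrict_space borel (sphere 0 1))"
    using f by (simp add: measurable_cong_sets[OF sets_sphere_measure refl])
  have "(LINT x|sphere_measure. f x) = (LINT x|distr (restrict_space lborel (ball 0 1 - {0}))
     (restrict_space borel (sphere 0 1)) sgn. real CARD('n) *\<^sub>R f x)"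
    unfolding sphere_measure_density using f' by (intro integral_density) auto
  also have "\<dots> = (LINT y|restrict_space lborel (ball 0 1 - {0}). real CARD('n) *\<^sub>R f (sgn y))"
    using f' by (intro integral_distr measurable_sgn_cone) auto
  also have "\<dots> = real CARD('n) * (LINT y:ball 0 1 - {0}|lborel. f (sgn y))"
    by (subst integral_restrict_space) (auto simp: set_lebesgue_integral_def mult.left_commute)
  finally show ?thesis
    by (simp add: sphere_avg_def measure_sphere_measure_space)
qed

lemma sphere_avg_cone_integrable:
  fixes f :: "real^'n \<Rightarrow> real"
  assumes f: "integrable sphere_measure f"
  shows "set_integrable lborel (ball 0 1 - {0}) (\<lambda>y. f (sgn y))"
proof -
  have meas: "f \<in> borel_measurable (restrict_space borel (sphere 0 1))"
    using borel_measurable_integrable[OF f] by (simp add: measurable_cong_sets[OF sets_sphere_measure refl])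
  have "integrable (distr (restrict_space lborel (ball 0 1 - {0}))
     (restrict_space borel (sphere 0 1)) sgn) (\<lambda>x. real CARD('n) *\<^sub>R f x)"
    using f meas unfolding sphere_measure_density by (subst (asm) integrable_density) auto
  then have "integrable (distr (restrict_space lborel (ball 0 1 - {0}))
     (restrict_space borel (sphere 0 1)) sgn) f"
    by simp
  then have "integrable (restrict_space lborel (ball 0 1 - {0})) (\<lambda>y. f (sgn y))"
    using meas by (subst (asm) integrable_distr_eq[OF measurable_sgn_cone]) auto
  then show ?thesis
    by (subst (asm) integrable_restrict_space) (auto simp: set_integrable_def)
qed

lemma sphere_null_set: "sphere (0::real^'n) 1 \<in> null_sets lborel"
  using negligible_sphere[of "0::real^'n" 1]
  by (simp add: negligible_iff_null_sets null_sets_completion_iff)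

text \<open>The bounding sphere is a null set. The closed ball is the form needed for sweeping,
  where the boundary sphere carries the initial time.\<close>

lemma sphere_avg_closed_cone:
  fixes f :: "real^'n \<Rightarrow> real"
  assumes f: "integrable sphere_measure f"
  shows "set_integrable lborel (cball 0 1 - {0}) (\<lambda>y. f (sgn y))"
    and "sphere_avg f = (LINT y:cball 0 1 - {0}|lborel. f (sgn y)) / measure lborel (ball (0::real^'n) 1)"
proof -
  have AE: "AE y in lborel. (y :: real^'n) \<notin> sphere 0 1"
    by (rule AE_not_in[OF sphere_null_set])
  have f': "f \<in> borel_measurable (restrict_space borel (sphere 0 1))"
    using borel_measurable_integrable[OF f] by (simp add: measurable_cong_sets[OF sets_sphere_measure refl])
  have "sgn \<in> measurable (restrict_space borel (cball 0 1 - {0})) (restrict_space borel (sphere 0 (1::real) :: (real^'n) set))"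
    by (rule measurable_restrict_space2)
      (auto simp: space_restrict_space norm_sgn intro!: measurable_restrict_space1 borel_measurable_sgn_vec)
  from measurable_compose[OF this f']
  have meas: "(\<lambda>y. indicator (cball 0 1 - {0}) y *\<^sub>R f (sgn y)) \<in> borel_measurable borel"
    by (subst (asm) borel_measurable_restrict_space_iff) auto
  have ae: "AE y in lborel. indicator (cball 0 1 - {0}) y *\<^sub>R f (sgn y)
      = indicator (ball 0 1 - {0}) y *\<^sub>R f (sgn y)"
    using AE by eventually_elim (auto simp: indicator_def)
  have int: "set_integrable lborel (ball 0 1 - {0}) (\<lambda>y. f (sgn y))"
    by (rule sphere_avg_cone_integrable[OF f])
  then have meas': "(\<lambda>y. indicator (ball 0 1 - {0}) y *\<^sub>R f (sgn y)) \<in> borel_measurable borel"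
    unfolding set_integrable_def by (auto dest: borel_measurable_integrable)
  show "set_integrable lborel (cball 0 1 - {0}) (\<lambda>y. f (sgn y))"
    using int meas meas' ae unfolding set_integrable_def by (subst integrable_cong_AE) auto
  show "sphere_avg f = (LINT y:cball 0 1 - {0}|lborel. f (sgn y)) / measure lborel (ball (0::real^'n) 1)"
    unfolding sphere_avg_cone[OF borel_measurable_integrable[OF f]] set_lebesgue_integral_def
    using meas meas' ae by (subst integral_cong_AE[OF _ _ ae]) auto
qed

text \<open>Fubini over the product of the sphere with the interval, where the continuous integrand
  is bounded by compactness; the fundamental theorem evaluates the inner time integral.\<close>

lemma sphere_avg_FTC:
  fixes f f' :: "real^'n \<Rightarrow> real \<Rightarrow> real"
  assumes ab: "a \<le> b"
    and cont: "continuous_on (sphere 0 1 \<times> {a..b}) (\<lambda>z. f' (fst z) (snd z))"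
    and der: "\<And>x s. x \<in> sphere 0 1 \<Longrightarrow> s \<in> {a..b} \<Longrightarrow> (f x has_real_derivative f' x s) (at s within {a..b})"
    and int: "integrable sphere_measure (\<lambda>x. f x a)" "integrable sphere_measure (\<lambda>x. f x b)"
  shows "set_integrable lborel {a..b} (\<lambda>s. sphere_avg (\<lambda>x. f' x s))"
    and "(LINT s:{a..b}|lborel. sphere_avg (\<lambda>x. f' x s)) = sphere_avg (\<lambda>x. f x b) - sphere_avg (\<lambda>x. f x a)"
proof -
  let ?S = "sphere 0 1 :: (real^'n) set" and ?M = "sphere_measure :: (real^'n) measure"
  interpret M: finite_measure ?M by (rule finite_measure_sphere)
  interpret pair_sigma_finite ?M lborel ..
  define g where "g x s = indicator {a..b} s * f' x s" for x s
  define g' where "g' z = indicator (?S \<times> {a..b}) z *\<^sub>R f' (fst z) (snd z)" for z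
  have compact: "compact (?S \<times> {a..b})" by (intro compact_Times) auto
  have "g' \<in> borel_measurable (borel \<Otimes>\<^sub>M borel)"
    unfolding g'_def borel_prod using cont compact
    by (intro borel_measurable_continuous_on_indicator borel_compact) auto
  \<comment> \<open>The sphere carries a restricted sigma-algebra, so joint measurability is
    obtained in the ambient product and pulled back along the identity.\<close>
  moreover have "(\<lambda>z. z) \<in> measurable (?M \<Otimes>\<^sub>M lborel) (borel \<Otimes>\<^sub>M borel)"
  proof (rule measurable_pair)
    have "(\<lambda>x. x) \<in> measurable ?M borel"
      by (simp add: measurable_cong_sets[OF sets_sphere_measure refl] measurable_restrict_space1)
    from measurable_compose[OF measurable_fst this]
    show "fst \<circ> (\<lambda>z. z) \<in> measurable (?M \<Otimes>\<^sub>M lborel) borel" by (simp add: o_def)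
    show "snd \<circ> (\<lambda>z. z) \<in> measurable (?M \<Otimes>\<^sub>M lborel) borel"
      using measurable_snd[of ?M lborel] by (simp add: o_def)
  qed
  ultimately have "g' \<in> borel_measurable (?M \<Otimes>\<^sub>M lborel)"
    by (rule measurable_compose[rotated])
  moreover have gg': "case_prod g z = g' z" if "z \<in> space (?M \<Otimes>\<^sub>M lborel)" for z
    using that by (auto simp: g_def g'_def space_pair_measure indicator_def)
  ultimately have meas: "case_prod g \<in> borel_measurable (?M \<Otimes>\<^sub>M lborel)"
    by (simp cong: measurable_cong)
  have "bounded ((\<lambda>z. f' (fst z) (snd z)) ` (?S \<times> {a..b}))"
    by (intro compact_imp_bounded compact_continuous_image cont compact)
  then obtain B where B: "\<And>x s. x \<in> ?S \<Longrightarrow> s \<in> {a..b} \<Longrightarrow> norm (f' x s) \<le> B"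
    by (force simp: bounded_iff)
  have emeasure: "emeasure (?M \<Otimes>\<^sub>M lborel) (?S \<times> {a..b}) < \<infinity>"
    using ab sets.top[of ?M]
    by (subst lborel.emeasure_pair_measure_Times) (auto simp: emeasure_sphere_measure_space ennreal_mult_less_top)
  have integ: "integrable (?M \<Otimes>\<^sub>M lborel) (case_prod g)"
  proof (rule integrableI_bounded_set[OF _ meas emeasure])
    show "?S \<times> {a..b} \<in> sets (?M \<Otimes>\<^sub>M lborel)"
      using sets.top[of ?M] by (intro pair_measureI) auto
    show "AE z in ?M \<Otimes>\<^sub>M lborel. z \<in> ?S \<times> {a..b} \<longrightarrow> norm (case_prod g z) \<le> B"
      using B by (intro AE_I2) (auto simp: g_def)
    show "AE z in ?M \<Otimes>\<^sub>M lborel. z \<notin> ?S \<times> {a..b} \<longrightarrow> case_prod g z = 0"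
      by (intro AE_I2) (auto simp: g_def space_pair_measure indicator_def)
  qed
  have avg: "sphere_avg (\<lambda>x. g x s) = indicator {a..b} s * sphere_avg (\<lambda>x. f' x s)" for s
    by (simp add: sphere_avg_def g_def)
  have inner: "(LINT s|lborel. g x s) = f x b - f x a" if x: "x \<in> ?S" for x
  proof -
    have "continuous_on {a..b} (\<lambda>s. (\<lambda>z. f' (fst z) (snd z)) (x, s))"
      by (rule continuous_on_compose2[OF cont]) (use x in \<open>auto intro!: continuous_intros\<close>)
    then have "(LINT s|lborel. indicator {a..b} s *\<^sub>R f' x s) = f x b - f x a"
      using der[OF x] by (intro integral_FTC_atLeastAtMost ab)
        (auto simp flip: has_real_derivative_iff_has_vector_derivative)
    then show ?thesis by (simp add: g_def)
  qed
  have "integrable lborel (\<lambda>s. LINT x|?M. g x s)"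
    using integ by (rule integrable_snd)
  then have "integrable lborel (\<lambda>s. sphere_avg (\<lambda>x. g x s))"
    by (simp add: sphere_avg_def)
  then show "set_integrable lborel {a..b} (\<lambda>s. sphere_avg (\<lambda>x. f' x s))"
    by (simp add: set_integrable_def avg)
  have "(LINT s|lborel. LINT x|?M. g x s) = (LINT x|?M. LINT s|lborel. g x s)"
    by (rule Fubini_integral[OF integ])
  also have "\<dots> = (LINT x|?M. f x b - f x a)"
    by (intro Bochner_Integration.integral_cong) (auto simp: inner)
  finally have "(LINT s|lborel. sphere_avg (\<lambda>x. g x s)) = sphere_avg (\<lambda>x. f x b - f x a)"
    by (simp add: sphere_avg_def)
  then show "(LINT s:{a..b}|lborel. sphere_avg (\<lambda>x. f' x s)) = sphere_avg (\<lambda>x. f x b) - sphere_avg (\<lambda>x. f x a)"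
    using int by (simp add: set_lebesgue_integral_def avg sphere_avg_diff)
qed

section \<open>A uniform lower bound for averages of logarithms\<close>

lemma lborel_distr_orthogonal:
  fixes T :: "real^'n \<Rightarrow> real^'n"
  assumes T: "orthogonal_transformation T"
  shows "distr lborel borel T = lborel"
proof (rule lborel_eqI[symmetric])
  have T': "orthogonal_transformation (inv T)"
    by (rule orthogonal_transformation_inv[OF T])
  have linT: "linear T" "linear (inv T)"
    using T T' by (auto simp: orthogonal_transformation_def)
  have borelT [measurable]: "T \<in> borel_measurable borel"
    using linT(1) by (intro borel_measurable_continuous_onI linear_continuous_on)
      (simp add: linear_conv_bounded_linear)
  have vimage: "T -` A = inv T ` A" for A
    using orthogonal_transformation_bij[OF T] by (simp add: bij_vimage_eq_inv_image)
  have det: "\<bar>det (matrix (inv T))\<bar> = 1"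
    using orthogonal_transformation_det[OF T'] .
  fix l u :: "real^'n"
  assume le: "\<And>b. b \<in> Basis \<Longrightarrow> l \<bullet> b \<le> u \<bullet> b"
  have borel: "inv T ` box l u \<in> sets borel"
    using measurable_sets[OF borelT, of "box l u"] by (simp add: vimage)
  have bdd: "bounded (inv T ` box l u)"
    by (intro bounded_linear_image bounded_box) (use linT in \<open>simp add: linear_conv_bounded_linear\<close>)
  have "measure lborel (inv T ` box l u) = (LINT y:box l u|lborel. \<bar>det (matrix (inv T))\<bar>)"
  proof (rule measure_injective_image[OF _ borel])
    show "(inv T has_derivative inv T) (at x within box l u)" for x
      using linT by (intro bounded_linear_imp_has_derivative) (simp add: linear_conv_bounded_linear)
    show "inj_on (inv T) (box l u)"
      using orthogonal_transformation_inj[OF T'] by (rule inj_on_subset) simp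
    show "set_integrable lborel (box l u) (\<lambda>x. \<bar>det (matrix (inv T))\<bar>)"
      by (simp add: det set_integrable_def emeasure_lborel_box_eq)
  qed simp
  then have "measure lborel (inv T ` box l u) = measure lborel (box l u)"
    by (simp add: det set_lebesgue_integral_def)
  moreover have "emeasure lborel A = ennreal (measure lborel A)" if "bounded A" for A :: "(real^'n) set"
    using emeasure_bounded_finite[OF that] by (intro emeasure_eq_ennreal_measure) (simp add: less_top)
  ultimately have "emeasure lborel (inv T ` box l u) = emeasure lborel (box l u)"
    using bdd by (simp only: bounded_box)
  then show "emeasure (distr lborel borel T) (box l u) = (\<Prod>b\<in>Basis. (u - l) \<bullet> b)"
    using le by (simp add: emeasure_distr vimage)
qed simp

lemma inverse_sqrt_integral_finite:
  "(\<integral>\<^sup>+s. ennreal (2 / sqrt \<bar>s\<bar>) * indicator {-1..1} s \<partial>lborel) < (\<infinity> :: ennreal)"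
proof -
  \<comment> \<open>The positive half of the integrand, with antiderivative
    \<open>4 * sqrt s\<close>. The open interval ends at 2 so that it contains the endpoint 1; the
    negative half follows by reflection.\<close>
  define g :: "real \<Rightarrow> ennreal" where "g s = ennreal (indicator {0<..<2} s * (2 / sqrt s))" for s
  have g [measurable]: "g \<in> borel_measurable borel" by (simp add: g_def[abs_def])
  have "set_integrable lborel (einterval (ereal 0) (ereal 2)) (\<lambda>s. 2 / sqrt s)"
  proof (rule interval_integral_FTC_nonneg(1)[where F = "\<lambda>s. 4 * sqrt s" and A = 0 and B = "4 * sqrt 2"])
    show "((\<lambda>s. 4 * sqrt s) has_real_derivative 2 / sqrt x) (at x)" if "ereal 0 < ereal x" for x
      using that by (auto intro!: derivative_eq_intros simp: field_simps)
    show "isCont (\<lambda>s. 2 / sqrt s) x" if "ereal 0 < ereal x" for x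
      using that by (auto intro!: continuous_intros)
    show "AE x in lborel. ereal 0 < ereal x \<longrightarrow> ereal x < ereal 2 \<longrightarrow> 0 \<le> 2 / sqrt x" by simp
    have "((\<lambda>s. 4 * sqrt s) \<longlongrightarrow> 4 * sqrt 0) (at_right 0)" by (intro tendsto_intros)
    then show "(((\<lambda>s. 4 * sqrt s) \<circ> real_of_ereal) \<longlongrightarrow> 0) (at_right (ereal 0))"
      by (simp add: ereal_tendsto_simps1)
    have "((\<lambda>s. 4 * sqrt s) \<longlongrightarrow> 4 * sqrt 2) (at_left 2)" by (intro tendsto_intros)
    then show "(((\<lambda>s. 4 * sqrt s) \<circ> real_of_ereal) \<longlongrightarrow> 4 * sqrt 2) (at_left (ereal 2))"
      by (simp add: ereal_tendsto_simps1)
  qed simp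
  then have int: "integrable lborel (\<lambda>s. indicator {0<..<2} s * (2 / sqrt s) :: real)"
    by (simp add: set_integrable_def)
  have fin: "(\<integral>\<^sup>+s. g s \<partial>lborel) < \<infinity>"
    unfolding g_def using int by (subst nn_integral_eq_integral) (auto simp: indicator_def)
  have "(\<integral>\<^sup>+s. ennreal (2 / sqrt \<bar>s\<bar>) * indicator {-1..1} s \<partial>lborel) \<le> (\<integral>\<^sup>+s. g s + g (- s) \<partial>lborel)"
  proof (intro nn_integral_mono)
    fix s :: real
    \<comment> \<open>At \<open>s = 0\<close> the left side is harmless, because
      \<open>2 / sqrt 0\<close> is \<open>2 / 0 = 0\<close>.\<close>
    consider "s = 0" | "s > 0" | "s < 0" by linarith
    then show "ennreal (2 / sqrt \<bar>s\<bar>) * indicator {-1..1} s \<le> g s + g (- s)"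
      by cases (auto simp: g_def indicator_def)
  qed
  also have "\<dots> = (\<integral>\<^sup>+s. g s \<partial>lborel) + (\<integral>\<^sup>+s. g (- s) \<partial>lborel)"
    by (rule nn_integral_add) auto
  also have "(\<integral>\<^sup>+s. g (- s) \<partial>lborel) = (\<integral>\<^sup>+s. g s \<partial>distr lborel borel uminus)"
    by (subst nn_integral_distr) auto
  also have "\<dots> = (\<integral>\<^sup>+s. g s \<partial>lborel)" by (simp add: lborel_distr_uminus)
  finally show ?thesis using fin by (simp add: ennreal_add_less_top order_le_less_trans)
qed

text \<open>Rotation invariance makes the integral independent of \<open>e\<close>. For a coordinate
  direction the ball is enlarged to a cube, where the integrand is a product and only one factor is
  singular.\<close>

lemma ball_inverse_sqrt_integral:
  obtains C where "C \<ge> 0" "\<And>e :: real^'n. norm e = 1 \<Longrightarrow>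
    integrable lborel (\<lambda>y. indicator (ball 0 1) y * (2 / sqrt \<bar>y \<bullet> e\<bar>)) \<and>
    (LINT y|lborel. indicator (ball 0 1) y * (2 / sqrt \<bar>y \<bullet> e\<bar>)) \<le> C"
proof -
  define \<phi> :: "real^'n \<Rightarrow> real^'n \<Rightarrow> ennreal"
    where "\<phi> e y = ennreal (indicator (ball 0 1) y * (2 / sqrt \<bar>y \<bullet> e\<bar>))" for e y
  have meas: "(\<lambda>y. indicator (ball 0 1) y * (2 / sqrt \<bar>y \<bullet> e\<bar>)) \<in> borel_measurable borel"
    for e :: "real^'n"
  proof -
    have "(\<lambda>y. sqrt \<bar>y \<bullet> e\<bar>) \<in> borel_measurable borel"
      by (intro borel_measurable_continuous_onI continuous_intros)
    moreover have "indicator (ball (0::real^'n) 1) \<in> borel_measurable borel"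
      by (intro borel_measurable_indicator) simp
    ultimately show ?thesis by measurable
  qed
  then have [measurable]: "\<phi> e \<in> borel_measurable borel" for e
    unfolding \<phi>_def by (intro measurable_compose[OF _ measurable_ennreal])
  obtain k :: 'n where True by simp
  define a :: "real^'n" where "a = axis k 1"
  have a: "a \<in> Basis" "norm a = 1" by (simp_all add: a_def)
  define f :: "real^'n \<Rightarrow> real \<Rightarrow> ennreal" where
    "f b s = (if b = a then ennreal (2 / sqrt \<bar>s\<bar>) else 1) * indicator {-1..1} s" for b s
  have "(\<integral>\<^sup>+y. \<phi> a y \<partial>lborel) \<le> (\<integral>\<^sup>+y. (\<Prod>b\<in>Basis. f b (y \<bullet> b)) \<partial>lborel)"
  proof (intro nn_integral_mono)
    fix y :: "real^'n"
    show "\<phi> a y \<le> (\<Prod>b\<in>Basis. f b (y \<bullet> b))"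
    proof (cases "norm y < 1")
      case True
      then have "\<bar>y \<bullet> b\<bar> \<le> 1" if "b \<in> Basis" for b
        using Basis_le_norm[OF that, of y] by linarith
      then have "f b (y \<bullet> b) = (if b = a then ennreal (2 / sqrt \<bar>y \<bullet> a\<bar>) else 1)" if "b \<in> Basis" for b
        using that by (force simp: f_def abs_le_iff)
      then show ?thesis using True a by (simp add: prod.delta \<phi>_def)
    qed (simp add: \<phi>_def)
  qed
  also have "\<dots> = (\<Prod>b\<in>Basis. \<integral>\<^sup>+s. f b s \<partial>lborel)"
    by (rule nn_integral_lborel_prod) (auto simp: f_def)
  also have "\<dots> < \<infinity>"
  proof -
    have "(\<integral>\<^sup>+s. f b s \<partial>lborel) < \<infinity>" for b
      using inverse_sqrt_integral_finite by (cases "b = a") (simp_all add: f_def)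
    then show ?thesis by (simp add: less_top[symmetric] ennreal_prod_eq_top)
  qed
  finally have fin: "(\<integral>\<^sup>+y. \<phi> a y \<partial>lborel) < \<infinity>" .
  have rot: "(\<integral>\<^sup>+y. \<phi> e y \<partial>lborel) = (\<integral>\<^sup>+y. \<phi> a y \<partial>lborel)" if e: "norm e = 1" for e
  proof -
    obtain T where T: "orthogonal_transformation T" "T a = e"
      using orthogonal_transformation_exists[of a e] a e by metis
    then have "T \<in> borel_measurable borel"
      by (intro borel_measurable_continuous_onI linear_continuous_on)
        (simp add: orthogonal_transformation_def linear_conv_bounded_linear)
    then have "(\<integral>\<^sup>+y. \<phi> e y \<partial>distr lborel borel T) = (\<integral>\<^sup>+y. \<phi> e (T y) \<partial>lborel)"
      by (intro nn_integral_distr) auto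
    also have "(\<lambda>y. \<phi> e (T y)) = \<phi> a"
    proof
      fix y
      have "T y \<bullet> e = y \<bullet> a" using T by (metis orthogonal_transformation_def)
      then show "\<phi> e (T y) = \<phi> a y"
        by (simp add: \<phi>_def orthogonal_transformation_norm[OF T(1)] indicator_def)
    qed
    finally show ?thesis by (simp add: lborel_distr_orthogonal[OF T(1)])
  qed
  show ?thesis
  proof (rule that[of "enn2real (\<integral>\<^sup>+y. \<phi> a y \<partial>lborel)"])
    fix e :: "real^'n" assume e: "norm e = 1"
    let ?f = "\<lambda>y. indicator (ball 0 1) y * (2 / sqrt \<bar>y \<bullet> e\<bar>) :: real"
    have "integrable lborel ?f"
    proof (rule integrableI_nonneg)
      show "?f \<in> borel_measurable lborel" using meas[of e] by simp
      show "(\<integral>\<^sup>+y. ?f y \<partial>lborel) < \<infinity>" using fin rot[OF e] by (simp only: \<phi>_def)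
    qed auto
    moreover have "(LINT y|lborel. ?f y) = enn2real (\<integral>\<^sup>+y. \<phi> e y \<partial>lborel)"
      unfolding \<phi>_def by (rule integral_eq_nn_integral) (use meas[of e] in auto)
    ultimately show "integrable lborel ?f \<and> (LINT y|lborel. ?f y) \<le> enn2real (\<integral>\<^sup>+y. \<phi> a y \<partial>lborel)"
      by (simp add: rot[OF e])
  qed simp
qed

text \<open>The logarithmic singularity of \<open>\<bar>x \<bullet> e\<bar>\<close> at the equator
  is dominated by an inverse square root, whose integral is bounded uniformly in \<open>e\<close>.
  In the application \<open>f\<close> is a normalized support function of a body containing a
  segment in direction \<open>e\<close>.\<close>

lemma sphere_avg_ln_lower_bound:
  obtains C where
    "\<And>(e :: real^'n) f. \<lbrakk>norm e = 1; continuous_on (sphere 0 1) f; \<And>x. x \<in> sphere 0 1 \<Longrightarrow> f x > 0;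
      \<And>x. x \<in> sphere 0 1 \<Longrightarrow> \<bar>x \<bullet> e\<bar> \<le> f x\<rbrakk> \<Longrightarrow> sphere_avg (\<lambda>x. ln (f x)) \<ge> - C"
proof -
  obtain C where C: "C \<ge> 0" "\<And>e :: real^'n. norm e = 1 \<Longrightarrow>
    integrable lborel (\<lambda>y. indicator (ball 0 1) y * (2 / sqrt \<bar>y \<bullet> e\<bar>)) \<and>
    (LINT y|lborel. indicator (ball 0 1) y * (2 / sqrt \<bar>y \<bullet> e\<bar>)) \<le> C"
    using ball_inverse_sqrt_integral by blast
  let ?V = "measure lborel (ball (0::real^'n) 1)"
  show ?thesis
  proof (rule that[of "C / ?V"])
    fix e :: "real^'n" and f
    assume e: "norm e = 1" and cont: "continuous_on (sphere 0 1) f"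
      and pos: "\<And>x. x \<in> sphere 0 1 \<Longrightarrow> f x > 0" and le: "\<And>x. x \<in> sphere 0 1 \<Longrightarrow> \<bar>x \<bullet> e\<bar> \<le> f x"
    have "continuous_on (sphere 0 1) (\<lambda>x. ln (f x))"
      using cont pos by (intro continuous_intros) force+
    then have int: "integrable sphere_measure (\<lambda>x. ln (f x))"
      by (rule continuous_on_sphere_integrable)
    let ?g = "\<lambda>y. indicator (ball 0 1 - {0}) y *\<^sub>R ln (f (sgn y))"
    have intg: "integrable lborel ?g"
      using sphere_avg_cone_integrable[OF int] by (simp add: set_integrable_def)
    have "e \<noteq> 0" using e by auto
    \<comment> \<open>On this hyperplane the majorant takes the value \<open>2 / 0 = 0\<close> and
      need not dominate, so the hyperplane is discarded as a null set.\<close>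
    then have "{y. e \<bullet> y = 0} \<in> null_sets lborel"
      using negligible_hyperplane[of e 0] e borel_closed[OF closed_hyperplane[of e 0]]
      by (auto simp: negligible_iff_null_sets null_sets_completion_iff)
    then have "AE y in lborel. e \<bullet> y \<noteq> 0"
      by (auto dest: AE_not_in)
    then have "AE y in lborel. - ?g y \<le> indicator (ball 0 1) y * (2 / sqrt \<bar>y \<bullet> e\<bar>)"
    proof eventually_elim
      fix y assume y: "e \<bullet> y \<noteq> 0"
      show "- ?g y \<le> indicator (ball 0 1) y * (2 / sqrt \<bar>y \<bullet> e\<bar>)"
      proof (cases "y \<in> ball 0 1 - {0}")
        case True
        define r where "r = \<bar>y \<bullet> e\<bar>"
        have r: "r > 0" using y by (simp add: r_def inner_commute)
        have "norm (sgn y) = 1" using True by (simp add: norm_sgn)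
        then have fy: "\<bar>sgn y \<bullet> e\<bar> \<le> f (sgn y)" using le by simp
        have "r = norm y * \<bar>sgn y \<bullet> e\<bar>" using True by (simp add: r_def sgn_div_norm abs_mult)
        also have "\<dots> \<le> \<bar>sgn y \<bullet> e\<bar>" using True by (intro mult_left_le_one_le) auto
        finally have "r \<le> f (sgn y)" using fy by simp
        then have "- ln (f (sgn y)) \<le> - ln r" using r by simp
        \<comment> \<open>Writing the logarithm through \<open>1 / sqrt r\<close> before using
          \<open>ln a \<le> a - 1\<close> gives an integrable bound; the direct bound by
          \<open>1 / r\<close> would not be integrable.\<close>
        also have "- ln r = 2 * ln (1 / sqrt r)" using r by (simp add: ln_div ln_sqrt)
        also have "\<dots> \<le> 2 * (1 / sqrt r)"
          using ln_le_minus_one[of "1 / sqrt r"] r by simp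
        finally show ?thesis using True by (simp add: r_def)
      next
        case False
        then show ?thesis by (auto simp: indicator_def)
      qed
    qed
    then have "(LINT y|lborel. - ?g y) \<le> (LINT y|lborel. indicator (ball 0 1) y * (2 / sqrt \<bar>y \<bullet> e\<bar>))"
      using C(2)[OF e] intg by (intro integral_mono_AE) auto
    also have "\<dots> \<le> C" using C(2)[OF e] by blast
    finally have "- C \<le> (LINT y:ball 0 1 - {0}|lborel. ln (f (sgn y)))"
      by (simp add: set_lebesgue_integral_def)
    then show "sphere_avg (\<lambda>x. ln (f x)) \<ge> - (C / ?V)"
      unfolding sphere_avg_cone[OF borel_measurable_integrable[OF int]]
      using measure_ball_pos[where 'n = 'n] by (simp add: field_simps)
  qed
qed

section \<open>Volume along the flow\<close>

lemma has_derivative_sgn: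
  fixes y :: "'a::real_inner"
  assumes "y \<noteq> 0"
  shows "(sgn has_derivative (\<lambda>v. (1 / norm y) *\<^sub>R (v - (sgn y \<bullet> v) *\<^sub>R sgn y))) (at y)"
proof -
  have sgn: "sgn = (\<lambda>y::'a. inverse (norm y) *\<^sub>R y)"
    by (simp add: fun_eq_iff sgn_div_norm)
  have "((\<lambda>y. inverse (norm y)) has_derivative
      (\<lambda>v. - (inverse (norm y) * (v \<bullet> sgn y) * inverse (norm y)))) (at y)"
    by (rule Deriv.has_derivative_inverse[OF _ has_derivative_norm[OF assms]]) (use assms in simp)
  from has_derivative_scaleR[OF this has_derivative_ident]
  have "(sgn has_derivative
      (\<lambda>v. inverse (norm y) *\<^sub>R v + (- (inverse (norm y) * (v \<bullet> sgn y) * inverse (norm y))) *\<^sub>R y)) (at y)"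
    by (subst sgn)
  moreover have "inverse (norm y) *\<^sub>R v + (- (inverse (norm y) * (v \<bullet> sgn y) * inverse (norm y))) *\<^sub>R y
      = (1 / norm y) *\<^sub>R (v - (sgn y \<bullet> v) *\<^sub>R sgn y)" for v
    by (simp add: sgn_div_norm[of y] inner_commute[of v] inverse_eq_divide scaleR_diff_right)
  ultimately show ?thesis by simp
qed

text \<open>The extension \<open>F\<close> is a parameter so that two-sided derivatives on the open
  set \<open>U\<close> are available even at \<open>t = 0\<close>. Its second derivatives make the
  boundary point map differentiable.\<close>

locale gauss_flow =
  fixes u :: "real^'n \<Rightarrow> real \<Rightarrow> real" and \<Omega> :: "real \<Rightarrow> (real^'n) set"
    and U :: "((real^'n) \<times> real) set" and F :: "(real^'n) \<times> real \<Rightarrow> real"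
  assumes domain: "norm x = 1 \<Longrightarrow> t \<ge> 0 \<Longrightarrow> (x, t) \<in> U"
    and F_diff: "z \<in> U \<Longrightarrow> F differentiable (at z)"
    and F_diff2: "z \<in> U \<Longrightarrow> (\<lambda>z. frechet_derivative F (at z) v) differentiable (at z)"
    and F_eq: "norm x = 1 \<Longrightarrow> t \<ge> 0 \<Longrightarrow> F (x, t) = u x t"
    and positive: "norm x = 1 \<Longrightarrow> t \<ge> 0 \<Longrightarrow> u x t > 0"
    and convex: "norm x = 1 \<Longrightarrow> t \<ge> 0 \<Longrightarrow> radii_positive (\<lambda>y. u y t) x"
    and flow: "norm x = 1 \<Longrightarrow> t \<ge> 0 \<Longrightarrow>
      (u x has_real_derivative u x t - 1 / tangent_det x (radii_op (\<lambda>y. u y t) x)) (at t within {0..})"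
    and body: "t \<ge> 0 \<Longrightarrow> convex_body (\<Omega> t)"
    and support: "norm x = 1 \<Longrightarrow> t \<ge> 0 \<Longrightarrow> u x t = support_fun (\<Omega> t) 0 x"
    and volume: "measure lebesgue (\<Omega> 0) = measure lebesgue (ball (0::real^'n) 1)"
begin

definition DF :: "(real^'n) \<times> real \<Rightarrow> (real^'n) \<times> real \<Rightarrow> real" where
  "DF z = frechet_derivative F (at z)"

text \<open>The spatial gradient of the extension. Its component normal to the sphere depends on the
  choice of \<open>F\<close>; only the tangential part enters \<open>P\<close>.\<close>

definition grad :: "(real^'n) \<times> real \<Rightarrow> real^'n" where
  "grad z = (\<Sum>b\<in>Basis. DF z (b, 0) *\<^sub>R b)"

text \<open>At \<open>(x, t)\<close> with \<open>x\<close> a unit vector, \<open>P\<close> is the point of the boundary of \<open>\<Omega> t\<close> with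
  outer normal \<open>x\<close>.\<close>

definition P :: "(real^'n) \<times> real \<Rightarrow> real^'n" where
  "P z = F z *\<^sub>R fst z + grad z - (fst z \<bullet> grad z) *\<^sub>R fst z"

definition DP :: "(real^'n) \<times> real \<Rightarrow> (real^'n) \<times> real \<Rightarrow> real^'n" where
  "DP z = frechet_derivative P (at z)"

definition p :: "real^'n \<Rightarrow> real \<Rightarrow> real^'n" where
  "p y t = P (sgn y, t)"

definition q :: "real^'n \<Rightarrow> real \<Rightarrow> real^'n" where
  "q x t = DP (x, t) (0, 1)"

text \<open>Projecting the argument first makes radial vectors map to 0. On tangent vectors this is
  the operator \<open>radii_op\<close>, as \<open>radii_op_eq\<close> shows.\<close>

definition L :: "real^'n \<Rightarrow> real \<Rightarrow> real^'n \<Rightarrow> real^'n" where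
  "L x t v = DP (x, t) (tangent_proj x v, 0)"

text \<open>The curvature is introduced as \<open>u\<close> minus its time derivative, so that joint
  continuity in \<open>(x, t)\<close> comes from the derivative of \<open>F\<close>; the flow
  equation identifies it with \<open>gauss_curv\<close>.\<close>

definition K :: "real^'n \<Rightarrow> real \<Rightarrow> real" where
  "K x t = u x t - DF (x, t) (0, 1)"

section \<open>Boundary points and curvature from the extension\<close>

lemma F_has_derivative: "z \<in> U \<Longrightarrow> (F has_derivative DF z) (at z)"
  using F_diff by (simp add: DF_def frechet_derivative_works)

lemma linear_DF: "z \<in> U \<Longrightarrow> linear (DF z)"
  by (rule has_derivative_linear[OF F_has_derivative])

lemma DF_grad:
  assumes "z \<in> U"
  shows "DF z (v, 0) = v \<bullet> grad z"
proof -
  have "linear (\<lambda>v::real^'n. (v, 0::real))" by (rule linearI) simp_all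
  from linear_compose[OF this linear_DF[OF assms]]
  have lin: "linear (\<lambda>v. DF z (v, 0))" by (simp add: o_def)
  have "DF z (v, 0) = DF z (\<Sum>b\<in>Basis. (v \<bullet> b) *\<^sub>R b, 0)"
    by (simp add: euclidean_representation)
  also have "\<dots> = (\<Sum>b\<in>Basis. (v \<bullet> b) * DF z (b, 0))"
    by (simp only: linear_sum[OF lin] linear_cmul[OF lin] real_scaleR_def)
  finally show ?thesis
    by (simp add: grad_def inner_sum_right mult.commute)
qed

lemma P_has_derivative: "z \<in> U \<Longrightarrow> (P has_derivative DP z) (at z)"
proof -
  assume z: "z \<in> U"
  have DF: "(\<lambda>z. DF z v) differentiable (at z)" for v
    using F_diff2[OF z] by (simp add: DF_def)
  have fst: "fst differentiable (at z)"
    by (auto intro!: differentiableI derivative_intros)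
  have grad: "grad differentiable (at z)"
    unfolding grad_def[abs_def] by (intro differentiable_sum differentiable_scaleR DF differentiable_const ballI finite_Basis)
  have "(\<lambda>z. F z *\<^sub>R fst z + grad z - (fst z \<bullet> grad z) *\<^sub>R fst z) differentiable (at z)"
    by (intro differentiable_diff differentiable_add differentiable_scaleR differentiable_inner F_diff[OF z] fst grad)
  then show ?thesis by (simp add: DP_def P_def[abs_def] frechet_derivative_works)
qed

lemma linear_DP: "z \<in> U \<Longrightarrow> linear (DP z)"
  by (rule has_derivative_linear[OF P_has_derivative])

lemma p_sgn: "p (sgn y) t = p y t"
  by (cases "y = 0") (simp_all add: p_def sgn_div_norm)

lemma inner_P: "norm x = 1 \<Longrightarrow> x \<bullet> P (x, t) = F (x, t)"
  by (simp add: P_def inner_add_right inner_diff_right norm_eq_1)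

lemma inner_p: "norm x = 1 \<Longrightarrow> t \<ge> 0 \<Longrightarrow> x \<bullet> p x t = u x t"
  by (simp add: p_def inner_P F_eq sgn_div_norm)

lemma inner_tangent_proj: "norm x = 1 \<Longrightarrow> x \<bullet> tangent_proj x v = 0"
  by (simp add: tangent_proj_def inner_diff_right norm_eq_1)

lemma tangent_proj_tangent: "x \<bullet> v = 0 \<Longrightarrow> tangent_proj x v = v"
  by (simp add: tangent_proj_def)

lemma sgn_curve_derivative:
  fixes H :: "(real^'n) \<times> real \<Rightarrow> 'b::real_normed_vector"
  assumes "y \<noteq> 0" "(H has_derivative H') (at (sgn y, t))"
  shows "((\<lambda>y. H (sgn y, t)) has_derivative (\<lambda>v. H' ((1 / norm y) *\<^sub>R tangent_proj (sgn y) v, 0))) (at y)"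
proof -
  have "((\<lambda>y. (sgn y, t)) has_derivative (\<lambda>v. ((1 / norm y) *\<^sub>R tangent_proj (sgn y) v, 0))) (at y)"
    unfolding tangent_proj_def using assms(1)
    by (intro has_derivative_Pair has_derivative_sgn has_derivative_const)
  from has_derivative_compose[OF this, of H] assms(2) show ?thesis by simp
qed

lemma p_has_derivative:
  assumes y: "y \<noteq> 0" and t: "t \<ge> 0"
  shows "((\<lambda>z. p (fst z) (snd z)) has_derivative
        (\<lambda>w. (1 / norm y) *\<^sub>R L (sgn y) t (fst w) + snd w *\<^sub>R q (sgn y) t)) (at (y, t))"
proof -
  have sU: "(sgn y, t) \<in> U" using y t by (intro domain) (auto simp: norm_sgn)
  note lin = linear_DP[OF sU]
  have "((\<lambda>z. sgn (fst z)) has_derivative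
      (\<lambda>w. (1 / norm y) *\<^sub>R (fst w - (sgn y \<bullet> fst w) *\<^sub>R sgn y))) (at (y, t))"
    using has_derivative_compose[OF has_derivative_fst[OF has_derivative_ident], of sgn _ "(y, t)"]
      has_derivative_sgn[OF y] by simp
  then have "((\<lambda>z. (sgn (fst z), snd z)) has_derivative
      (\<lambda>w. ((1 / norm y) *\<^sub>R tangent_proj (sgn y) (fst w), snd w))) (at (y, t))"
    unfolding tangent_proj_def by (intro has_derivative_Pair) (auto intro!: derivative_intros)
  from has_derivative_compose[OF this, of P] P_has_derivative[OF sU]
  have "((\<lambda>z. p (fst z) (snd z)) has_derivative
      (\<lambda>w. DP (sgn y, t) ((1 / norm y) *\<^sub>R tangent_proj (sgn y) (fst w), snd w))) (at (y, t))"
    by (simp add: p_def)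
  moreover have "DP (sgn y, t) ((1 / norm y) *\<^sub>R tangent_proj (sgn y) v, s)
      = (1 / norm y) *\<^sub>R L (sgn y) t v + s *\<^sub>R q (sgn y) t" for v s
  proof -
    have "((1 / norm y) *\<^sub>R tangent_proj (sgn y) v, s)
        = (1 / norm y) *\<^sub>R (tangent_proj (sgn y) v, 0::real) + s *\<^sub>R (0, 1)" by simp
    then show ?thesis by (simp only: linear_add[OF lin] linear_cmul[OF lin] L_def q_def)
  qed
  ultimately show ?thesis by simp
qed

lemma L_zero: "norm x = 1 \<Longrightarrow> t \<ge> 0 \<Longrightarrow> L x t x = 0"
  using linear_0[OF linear_DP[OF domain]] by (simp add: L_def tangent_proj_def norm_eq_1 zero_prod_def)

text \<open>The identity \<open>x \<bullet> P (x, t) = F (x, t)\<close> is differentiated along the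
  sphere. The derivative of the factor \<open>x\<close> already produces the tangential derivative
  of \<open>F\<close>, so nothing remains for \<open>x \<bullet> L x t v\<close>.\<close>

lemma L_tangent:
  assumes x: "norm x = 1" and t: "t \<ge> 0"
  shows "x \<bullet> L x t v = 0"
proof -
  have x0: "x \<noteq> 0" and sgn: "sgn x = x" using x by (auto simp: sgn_div_norm)
  have xU: "(sgn x, t) \<in> U" using x t by (simp add: sgn domain)
  have P': "((\<lambda>y. P (sgn y, t)) has_derivative L x t) (at x)"
    using sgn_curve_derivative[OF x0 P_has_derivative[OF xU]] by (simp add: L_def[abs_def] sgn x)
  have s': "(sgn has_derivative tangent_proj x) (at x)"
    using has_derivative_sgn[OF x0] by (simp add: sgn x tangent_proj_def[abs_def])
  have "((\<lambda>y. sgn y \<bullet> P (sgn y, t)) has_derivative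
      (\<lambda>v. sgn x \<bullet> L x t v + tangent_proj x v \<bullet> P (sgn x, t))) (at x)"
    by (rule has_derivative_inner[OF s' P'])
  then have "((\<lambda>y. F (sgn y, t)) has_derivative (\<lambda>v. x \<bullet> L x t v + tangent_proj x v \<bullet> P (x, t))) (at x)"
    unfolding sgn
    by (rule has_derivative_transform_within_open[where s = "- {0}"]) (auto simp: x0 inner_P norm_sgn)
  moreover have "((\<lambda>y. F (sgn y, t)) has_derivative (\<lambda>v. DF (x, t) (tangent_proj x v, 0))) (at x)"
    using sgn_curve_derivative[OF x0 F_has_derivative[OF xU]] by (simp add: sgn x)
  ultimately have "(\<lambda>v. x \<bullet> L x t v + tangent_proj x v \<bullet> P (x, t)) = (\<lambda>v. DF (x, t) (tangent_proj x v, 0))"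
    by (rule has_derivative_unique)
  from fun_cong[OF this, of v]
  have "x \<bullet> L x t v + tangent_proj x v \<bullet> P (x, t) = tangent_proj x v \<bullet> grad (x, t)"
    using DF_grad xU sgn by simp
  moreover have "tangent_proj x v \<bullet> P (x, t) = tangent_proj x v \<bullet> grad (x, t)"
    using inner_tangent_proj[OF x, of v]
    by (simp add: P_def inner_add_right inner_diff_right inner_commute[of _ x])
  ultimately show ?thesis by simp
qed

lemma inner_q:
  assumes x: "norm x = 1" and t: "t \<ge> 0"
  shows "x \<bullet> q x t = DF (x, t) (0, 1)"
proof -
  note xU = domain[OF x t]
  have line: "((\<lambda>s. (x, s)) has_derivative (\<lambda>s. (0, s))) (at t)"
    by (auto intro!: derivative_eq_intros)
  have "((\<lambda>s. x \<bullet> P (x, s)) has_derivative (\<lambda>s. x \<bullet> DP (x, t) (0, s))) (at t)"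
    using has_derivative_compose[OF line P_has_derivative[OF xU]] by (intro has_derivative_inner_right)
  moreover have "((\<lambda>s. F (x, s)) has_derivative (\<lambda>s. DF (x, t) (0, s))) (at t)"
    by (rule has_derivative_compose[OF line F_has_derivative[OF xU]])
  ultimately have "(\<lambda>s. x \<bullet> DP (x, t) (0, s)) = (\<lambda>s. DF (x, t) (0, s))"
    unfolding inner_P[OF x] by (rule has_derivative_unique)
  from fun_cong[OF this, of 1] show ?thesis by (simp add: q_def)
qed

lemma u_deriv:
  assumes x: "norm x = 1" and t: "t \<ge> 0"
  shows "(u x has_real_derivative u x t - K x t) (at t within {0..})"
proof -
  have line: "((\<lambda>s. (x, s)) has_derivative (\<lambda>s. (0, s))) (at t)"
    by (auto intro!: derivative_eq_intros)
  have "((\<lambda>s. F (x, s)) has_derivative (\<lambda>s. DF (x, t) (0, s))) (at t within {0..})"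
    by (rule has_derivative_at_withinI[OF has_derivative_compose[OF line F_has_derivative[OF domain[OF x t]]]])
  moreover have "(\<lambda>s. DF (x, t) (0, s)) = (*) (DF (x, t) (0, 1))"
  proof
    show "DF (x, t) (0, s) = DF (x, t) (0, 1) * s" for s
      using linear_cmul[OF linear_DF[OF domain[OF x t]], of s "(0, 1)"] by simp
  qed
  ultimately have "((\<lambda>s. F (x, s)) has_derivative (*) (DF (x, t) (0, 1))) (at t within {0..})"
    by simp
  then have "(u x has_derivative (*) (DF (x, t) (0, 1))) (at t within {0..})"
    by (rule has_derivative_transform[rotated 2]) (use t x in \<open>auto simp: F_eq\<close>)
  then show ?thesis by (simp add: has_field_derivative_def K_def)
qed

lemma K_eq:
  assumes x: "norm x = 1" and t: "t \<ge> 0"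
  shows "K x t = 1 / tangent_det x (radii_op (\<lambda>y. u y t) x)"
proof -
  let ?d = "u x t - 1 / tangent_det x (radii_op (\<lambda>y. u y t) x)"
  \<comment> \<open>The flow equation holds in the sense of derivatives within \<open>{0..}\<close>,
    one-sided at time 0, so the two derivatives are compared on an interval to the right of
    \<open>t\<close>.\<close>
  have sub: "{t..t+1} \<subseteq> {0..}" using t by auto
  have "(u x has_derivative (*) (u x t - K x t)) (at t within cbox t (t + 1))"
    using has_field_derivative_subset[OF u_deriv[OF x t] sub] by (simp add: has_field_derivative_def)
  moreover have "(u x has_derivative (*) ?d) (at t within cbox t (t + 1))"
    using has_field_derivative_subset[OF flow[OF x t] sub] by (simp add: has_field_derivative_def)
  ultimately have "(*) (u x t - K x t) = (*) ?d"
    by (intro frechet_derivative_unique_within_closed_interval[of t "t + 1" t]) auto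
  from fun_cong[OF this, of 1] show ?thesis by simp
qed

lemma gauss_curv_eq: "norm x = 1 \<Longrightarrow> t \<ge> 0 \<Longrightarrow> gauss_curv (\<lambda>y. u y t) x = K x t"
  by (simp add: gauss_curv_def K_eq)

lemma u_sgn_derivative:
  assumes y: "norm y = 1" and t: "t \<ge> 0"
  shows "(((\<lambda>y. u y t) \<circ> sgn) has_derivative (\<lambda>v. v \<bullet> (P (y, t) - F (y, t) *\<^sub>R y))) (at y)"
proof -
  have y0: "y \<noteq> 0" and sgn: "sgn y = y" using y by (auto simp: sgn_div_norm)
  have "((\<lambda>y. F (sgn y, t)) has_derivative (\<lambda>v. DF (y, t) (tangent_proj y v, 0))) (at y)"
    using sgn_curve_derivative[OF y0 F_has_derivative, of t] domain[OF y t] by (simp add: sgn y)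
  moreover have "DF (y, t) (tangent_proj y v, 0) = v \<bullet> (P (y, t) - F (y, t) *\<^sub>R y)" for v
    using DF_grad[OF domain[OF y t]]
    by (simp add: P_def tangent_proj_def inner_diff_left inner_diff_right inner_add_right inner_commute[of v y])
  ultimately have "((\<lambda>y. F (sgn y, t)) has_derivative (\<lambda>v. v \<bullet> (P (y, t) - F (y, t) *\<^sub>R y))) (at y)"
    by simp
  then show ?thesis
    by (rule has_derivative_transform_within_open[where s = "- {0}"]) (auto simp: y0 F_eq norm_sgn t)
qed

lemma sphere_grad_eq:
  assumes y: "norm y = 1" and t: "t \<ge> 0"
  shows "sphere_grad (\<lambda>y. u y t) y = P (y, t) - F (y, t) *\<^sub>R y"
  unfolding sphere_grad_def
proof (rule the_equality)
  show "GDERIV ((\<lambda>y. u y t) \<circ> sgn) y :> P (y, t) - F (y, t) *\<^sub>R y"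
    using u_sgn_derivative[OF y t] by (simp add: gderiv_def)
  fix D assume "GDERIV ((\<lambda>y. u y t) \<circ> sgn) y :> D"
  then have "(\<lambda>v. v \<bullet> D) = (\<lambda>v. v \<bullet> (P (y, t) - F (y, t) *\<^sub>R y))"
    unfolding gderiv_def using u_sgn_derivative[OF y t] by (rule has_derivative_unique)
  then show "D = P (y, t) - F (y, t) *\<^sub>R y"
    by (metis vector_eq_ldot)
qed

text \<open>On the sphere the gradient of \<open>u\<close> is \<open>P - F *\<^sub>R x\<close>.
  Differentiating it gives \<open>L\<close> minus \<open>u\<close> times the tangent vector, up to a
  normal term removed by the projection; this is the classical fact that the differential of the
  inverse Gauss map is the Hessian plus \<open>u\<close> times the metric.\<close>

lemma radii_op_eq:
  assumes x: "norm x = 1" and t: "t \<ge> 0" and v: "x \<bullet> v = 0"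
  shows "radii_op (\<lambda>y. u y t) x v = L x t v"
proof -
  have x0: "x \<noteq> 0" and sgn: "sgn x = x" using x by (auto simp: sgn_div_norm)
  have xU: "(sgn x, t) \<in> U" using x t by (simp add: sgn domain)
  have P': "((\<lambda>y. P (sgn y, t)) has_derivative L x t) (at x)"
    using sgn_curve_derivative[OF x0 P_has_derivative[OF xU]] by (simp add: L_def[abs_def] sgn x)
  have F': "((\<lambda>y. F (sgn y, t)) has_derivative (\<lambda>v. DF (x, t) (tangent_proj x v, 0))) (at x)"
    using sgn_curve_derivative[OF x0 F_has_derivative[OF xU]] by (simp add: sgn x)
  have s': "(sgn has_derivative tangent_proj x) (at x)"
    using has_derivative_sgn[OF x0] by (simp add: sgn x tangent_proj_def[abs_def])
  have "((\<lambda>y. P (sgn y, t) - F (sgn y, t) *\<^sub>R sgn y) has_derivative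
      (\<lambda>v. L x t v - (F (sgn x, t) *\<^sub>R tangent_proj x v + DF (x, t) (tangent_proj x v, 0) *\<^sub>R sgn x))) (at x)"
    by (intro has_derivative_diff P' has_derivative_scaleR F' s')
  then have "((sphere_grad (\<lambda>y. u y t) \<circ> sgn) has_derivative
      (\<lambda>v. L x t v - (F (x, t) *\<^sub>R tangent_proj x v + DF (x, t) (tangent_proj x v, 0) *\<^sub>R x))) (at x)"
    unfolding sgn by (rule has_derivative_transform_within_open[where s = "- {0}"])
      (auto simp: x0 sphere_grad_eq norm_sgn t)
  from frechet_derivative_at[OF this, symmetric]
  have "sphere_hess (\<lambda>y. u y t) x v
      = tangent_proj x (L x t v - (F (x, t) *\<^sub>R v + DF (x, t) (v, 0) *\<^sub>R x))"
    by (simp add: sphere_hess_def cov_deriv_def tangent_proj_tangent[OF v])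
  also have "\<dots> = L x t v - u x t *\<^sub>R v"
    using x v L_tangent[OF x t, of v]
    by (simp add: tangent_proj_def inner_diff_right inner_add_right norm_eq_1 F_eq t)
  finally show ?thesis by (simp add: radii_op_def)
qed

lemma L_pos: "norm x = 1 \<Longrightarrow> t \<ge> 0 \<Longrightarrow> x \<bullet> v = 0 \<Longrightarrow> v \<noteq> 0 \<Longrightarrow> v \<bullet> L x t v > 0"
  using convex[of x t] radii_op_eq[of x t v]
  by (auto simp: radii_positive_def tangent_space_def inner_commute)

lemma det_eq:
  assumes x: "norm x = 1" and t: "t \<ge> 0"
  shows "tangent_det x (radii_op (\<lambda>y. u y t) x) = det (matrix (\<lambda>v. L x t v + (x \<bullet> v) *\<^sub>R x))"
proof -
  have "radii_op (\<lambda>y. u y t) x (tangent_proj x v) = L x t v" for v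
    using inner_tangent_proj[OF x, of v]
    by (simp add: radii_op_eq[OF x t] L_def tangent_proj_tangent)
  then show ?thesis by (simp add: tangent_det_def)
qed

section \<open>The bodies and their boundary points\<close>

lemma support_le: "t \<ge> 0 \<Longrightarrow> norm x = 1 \<Longrightarrow> z \<in> \<Omega> t \<Longrightarrow> x \<bullet> z \<le> u x t"
proof -
  assume t: "t \<ge> 0" and x: "norm x = 1" and z: "z \<in> \<Omega> t"
  have "compact ((\<lambda>z. x \<bullet> (z - 0)) ` \<Omega> t)"
    using body[OF t] by (intro compact_continuous_image continuous_intros) (simp add: convex_body_def)
  then have "bdd_above ((\<lambda>z. x \<bullet> (z - 0)) ` \<Omega> t)"
    by (intro bounded_imp_bdd_above compact_imp_bounded)
  from cSUP_upper[OF z this] show ?thesis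
    by (simp add: support[OF x t] support_fun_def)
qed

lemma support_attained:
  assumes t: "t \<ge> 0" and x: "norm x = 1"
  obtains z where "z \<in> \<Omega> t" "x \<bullet> z = u x t"
proof -
  have c: "compact (\<Omega> t)" and ne: "\<Omega> t \<noteq> {}"
    using body[OF t] interior_subset[of "\<Omega> t"] by (auto simp: convex_body_def)
  have "continuous_on (\<Omega> t) (\<lambda>z. x \<bullet> z)" by (intro continuous_intros)
  from continuous_attains_sup[OF c ne this] obtain z where
    z: "z \<in> \<Omega> t" "\<And>y. y \<in> \<Omega> t \<Longrightarrow> x \<bullet> y \<le> x \<bullet> z" by blast
  have "support_fun (\<Omega> t) 0 x \<le> x \<bullet> z"
    unfolding support_fun_def using z by (intro cSUP_least ne) auto
  then show ?thesis
    using that[OF z(1)] support_le[OF t x z(1)] support[OF x t] by simp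
qed

text \<open>A closed convex set is the intersection of its supporting half-spaces; a separating
  hyperplane for an outside point yields the violated direction \<open>sgn (- a)\<close>.\<close>

lemma \<Omega>_eq:
  assumes t: "t \<ge> 0"
  shows "\<Omega> t = {z. \<forall>x. norm x = 1 \<longrightarrow> x \<bullet> z \<le> u x t}"
proof (intro equalityI subsetI)
  fix z assume z: "z \<in> {z. \<forall>x. norm x = 1 \<longrightarrow> x \<bullet> z \<le> u x t}"
  show "z \<in> \<Omega> t"
  proof (rule ccontr)
    assume "z \<notin> \<Omega> t"
    moreover have "closed (\<Omega> t)" "convex (\<Omega> t)"
      using body[OF t] by (auto simp: convex_body_def compact_imp_closed)
    ultimately obtain a b where ab: "a \<bullet> z < b" "\<And>x. x \<in> \<Omega> t \<Longrightarrow> b < a \<bullet> x"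
      using separating_hyperplane_closed_point[of "\<Omega> t" z] by blast
    have "\<Omega> t \<noteq> {}" using body[OF t] interior_subset[of "\<Omega> t"] by (auto simp: convex_body_def)
    then have "a \<noteq> 0" using ab by force
    then have n: "norm (sgn (- a)) = 1" by (simp add: norm_sgn)
    obtain y where y: "y \<in> \<Omega> t" "sgn (- a) \<bullet> y = u (sgn (- a)) t"
      using support_attained[OF t n] .
    have "sgn (- a) \<bullet> z \<le> sgn (- a) \<bullet> y" using z n y by auto
    then have "norm a * (sgn (- a) \<bullet> z) \<le> norm a * (sgn (- a) \<bullet> y)" by (simp add: mult_left_mono)
    then have "a \<bullet> y \<le> a \<bullet> z" using \<open>a \<noteq> 0\<close> by (simp add: sgn_div_norm)
    with ab y show False by force
  qed
qed (use support_le[OF t] in auto)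

text \<open>A point \<open>z\<close> of the body attaining the height \<open>u x t\<close> makes
  \<open>u\<close> minus the linear function of \<open>z\<close> minimal at \<open>x\<close> on the
  sphere. Hence the tangential parts of \<open>z\<close> and \<open>p x t\<close> agree, and the
  normal parts agree by the choice of \<open>z\<close>.\<close>

lemma p_in_\<Omega>:
  assumes x: "norm x = 1" and t: "t \<ge> 0"
  shows "p x t \<in> \<Omega> t"
proof -
  have x0: "x \<noteq> 0" and sgn: "sgn x = x" using x by (auto simp: sgn_div_norm)
  obtain z where z: "z \<in> \<Omega> t" "x \<bullet> z = u x t" using support_attained[OF t x] .
  let ?f = "\<lambda>y. ((\<lambda>y. u y t) \<circ> sgn) y - sgn y \<bullet> z"
  have s': "(sgn has_derivative tangent_proj x) (at x)"
    using has_derivative_sgn[OF x0] by (simp add: sgn x tangent_proj_def[abs_def])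
  have "(?f has_derivative (\<lambda>v. v \<bullet> (P (x, t) - F (x, t) *\<^sub>R x) - tangent_proj x v \<bullet> z)) (at x)"
    by (intro has_derivative_diff u_sgn_derivative x t has_derivative_inner_left s')
  moreover have "\<forall>\<^sub>F y in at x. ?f x \<le> ?f y"
    using eventually_neq_at_within[of 0]
  proof eventually_elim
    case (elim y)
    then show ?case using support_le[OF t _ z(1), of "sgn y"] z(2) by (simp add: sgn norm_sgn)
  qed
  ultimately have "(\<lambda>v. v \<bullet> (P (x, t) - F (x, t) *\<^sub>R x) - tangent_proj x v \<bullet> z) = (\<lambda>v. 0)"
    by (rule has_derivative_local_min)
  from fun_cong[OF this] have "v \<bullet> (P (x, t) - F (x, t) *\<^sub>R x) = tangent_proj x v \<bullet> z" for v by simp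
  then have "v \<bullet> P (x, t) = v \<bullet> z" for v
    using z(2) by (simp add: tangent_proj_def inner_diff_left inner_diff_right F_eq[OF x t] inner_commute algebra_simps)
  then have "P (x, t) = z" using vector_eq_ldot by blast
  then show ?thesis using z(1) by (simp add: p_def sgn)
qed

lemma p_le:
  assumes "norm x = 1" "norm y = 1" "t \<ge> 0"
  shows "y \<bullet> p x t \<le> y \<bullet> p y t"
  using support_le[OF assms(3,2) p_in_\<Omega>[OF assms(1,3)]] by (simp add: inner_p assms)

text \<open>The stationary family \<open>\<Omega> t0 - w\<close>: with zero time derivative,
  \<open>shrinking\<close> reduces to the positivity of the translated support function.\<close>

lemma translate_family:
  assumes t0: "t0 \<ge> 0" and w: "\<And>x. norm x = 1 \<Longrightarrow> x \<bullet> w < u x t0"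
  shows "support_family (\<lambda>y t. p y t0 - w) (\<lambda>y t. 0) (\<lambda>x t. L x t0)"
proof
  fix x y v :: "real^'n" and t :: real
  show "((\<lambda>z. p (fst z) t0 - w) has_derivative
      (\<lambda>w. (1 / norm y) *\<^sub>R L (sgn y) t0 (fst w) + snd w *\<^sub>R 0)) (at (y, t) within (- {0}) \<times> {0..})"
    if y: "y \<noteq> 0"
  proof -
    have "((\<lambda>z. (fst z, t0)) has_derivative (\<lambda>w. (fst w, 0))) (at (y, t))"
      by (auto intro!: derivative_eq_intros)
    from has_derivative_compose[OF this, of "\<lambda>z. p (fst z) (snd z)"
        "\<lambda>w. (1 / norm y) *\<^sub>R L (sgn y) t0 (fst w) + snd w *\<^sub>R q (sgn y) t0"] p_has_derivative[OF y t0]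
    have "((\<lambda>z. p (fst z) t0) has_derivative (\<lambda>w. (1 / norm y) *\<^sub>R L (sgn y) t0 (fst w))) (at (y, t))"
      by simp
    then have "((\<lambda>z. p (fst z) t0 - w) has_derivative (\<lambda>w. (1 / norm y) *\<^sub>R L (sgn y) t0 (fst w) - 0)) (at (y, t))"
      by (intro has_derivative_diff has_derivative_const)
    then show ?thesis by (simp add: has_derivative_at_withinI)
  qed
  show "p (sgn y) t0 - w = p y t0 - w" by (simp add: p_sgn)
  assume x: "norm x = 1"
  show "L x t0 x = 0" "x \<bullet> L x t0 v = 0" by (simp_all add: L_zero L_tangent x t0)
  show "x \<bullet> v = 0 \<Longrightarrow> v \<noteq> 0 \<Longrightarrow> 0 < v \<bullet> L x t0 v" by (rule L_pos[OF x t0])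
  show "0 < x \<bullet> (p x t0 - w)" "x \<bullet> 0 < x \<bullet> (p x t0 - w)"
    using w[OF x] by (simp_all add: inner_diff_right inner_p x t0)
  show "norm y = 1 \<Longrightarrow> y \<bullet> (p x t0 - w) \<le> y \<bullet> (p y t0 - w)"
    using p_le[OF x _ t0] by (simp add: inner_diff_right)
qed

text \<open>The stationary family with \<open>w = 0\<close> gives access to \<open>det_L_pos\<close>
  before \<open>K > 0\<close> is known; that positivity is in turn what \<open>shift_family\<close>
  requires for \<open>shrinking\<close>.\<close>

lemma det_pos_flow:
  assumes x: "norm x = 1" and t: "t \<ge> 0"
  shows "det (matrix (\<lambda>v. L x t v + (x \<bullet> v) *\<^sub>R x)) > 0"
proof -
  interpret support_family "\<lambda>y s. p y t - 0" "\<lambda>y s. 0" "\<lambda>x s. L x t"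
    by (rule translate_family[OF t]) (simp add: positive t)
  show ?thesis by (rule det_L_pos[OF x t])
qed

lemma K_pos: "norm x = 1 \<Longrightarrow> t \<ge> 0 \<Longrightarrow> K x t > 0"
  and K_det: "norm x = 1 \<Longrightarrow> t \<ge> 0 \<Longrightarrow> det (matrix (\<lambda>v. L x t v + (x \<bullet> v) *\<^sub>R x)) = 1 / K x t"
  using det_pos_flow[of x t] by (simp_all add: K_eq det_eq)

text \<open>The flow restarted at time \<open>t0\<close>. Here \<open>shrinking\<close> is exactly
  \<open>K > 0\<close>, since the normal component of \<open>q\<close> is
  \<open>u - K\<close>.\<close>

lemma shift_family:
  assumes t0: "t0 \<ge> 0"
  shows "support_family (\<lambda>y t. p y (t0 + t)) (\<lambda>y t. q y (t0 + t)) (\<lambda>x t. L x (t0 + t))"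
proof
  fix x y v :: "real^'n" and t :: real
  assume t: "t \<ge> 0"
  show "((\<lambda>z. p (fst z) (t0 + snd z)) has_derivative
      (\<lambda>w. (1 / norm y) *\<^sub>R L (sgn y) (t0 + t) (fst w) + snd w *\<^sub>R q (sgn y) (t0 + t)))
      (at (y, t) within (- {0}) \<times> {0..})"
    if y: "y \<noteq> 0"
  proof -
    have "((\<lambda>z. (fst z, t0 + snd z)) has_derivative (\<lambda>w. (fst w, snd w))) (at (y, t))"
      by (auto intro!: derivative_eq_intros)
    from has_derivative_compose[OF this, of "\<lambda>z. p (fst z) (snd z)"
        "\<lambda>w. (1 / norm y) *\<^sub>R L (sgn y) (t0 + t) (fst w) + snd w *\<^sub>R q (sgn y) (t0 + t)"]
      p_has_derivative[OF y, of "t0 + t"] t t0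
    have "((\<lambda>z. p (fst z) (t0 + snd z)) has_derivative
        (\<lambda>w. (1 / norm y) *\<^sub>R L (sgn y) (t0 + t) (fst w) + snd w *\<^sub>R q (sgn y) (t0 + t))) (at (y, t))"
      by simp
    then show ?thesis by (rule has_derivative_at_withinI)
  qed
  have t': "t0 + t \<ge> 0" using t t0 by simp
  assume x: "norm x = 1"
  show "L x (t0 + t) x = 0" "x \<bullet> L x (t0 + t) v = 0" by (simp_all add: L_zero L_tangent x t')
  show "x \<bullet> v = 0 \<Longrightarrow> v \<noteq> 0 \<Longrightarrow> 0 < v \<bullet> L x (t0 + t) v" by (rule L_pos[OF x t'])
  show "0 < x \<bullet> p x (t0 + t)" using positive[OF x t'] by (simp add: inner_p x t')
  show "x \<bullet> q x (t0 + t) < x \<bullet> p x (t0 + t)"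
    using K_pos[OF x t'] by (simp add: inner_p inner_q x t' K_def)
  show "norm y = 1 \<Longrightarrow> y \<bullet> p x (t0 + t) \<le> y \<bullet> p y (t0 + t)"
    using p_le[OF x _ t'] .
qed (simp add: p_sgn)

lemma scaled_support_decreasing:
  assumes x: "norm x = 1" and "0 \<le> s" "s \<le> t"
  shows "exp (- t) * u x t \<le> exp (- s) * u x s"
proof -
  interpret support_family "\<lambda>y t. p y (0 + t)" "\<lambda>y t. q y (0 + t)" "\<lambda>x t. L x (0 + t)"
    by (rule shift_family) simp
  show ?thesis using h_decreasing[OF assms] assms by (simp add: inner_p)
qed

section \<open>Continuity of the support function and the curvature\<close>

lemma continuous_on_F: "continuous_on U F"
  using F_has_derivative by (intro has_derivative_continuous_on) (blast intro: has_derivative_at_withinI)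

lemma continuous_on_DF: "continuous_on U (\<lambda>z. DF z v)"
  using F_diff2 by (intro continuous_at_imp_continuous_on ballI) (simp add: DF_def differentiable_imp_continuous_within)

lemma continuous_on_u: "continuous_on ({x. norm x = 1} \<times> {0..}) (\<lambda>z. u (fst z) (snd z))"
proof -
  have "continuous_on ({x. norm x = 1} \<times> {0..}) F"
    by (rule continuous_on_subset[OF continuous_on_F]) (auto intro: domain)
  then show ?thesis by (rule continuous_on_eq) (auto simp: F_eq)
qed

lemma continuous_on_K: "continuous_on ({x. norm x = 1} \<times> {0..}) (\<lambda>z. K (fst z) (snd z))"
proof -
  have "continuous_on ({x. norm x = 1} \<times> {0..}) (\<lambda>z. DF z (0, 1))"
    by (rule continuous_on_subset[OF continuous_on_DF]) (auto intro: domain)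
  then show ?thesis
    unfolding K_def using continuous_on_u by (intro continuous_on_diff) simp_all
qed

lemma continuous_on_u_slice:
  assumes "t \<ge> 0"
  shows "continuous_on (sphere 0 1) (\<lambda>x. u x t)"
proof -
  have "continuous_on (sphere 0 1) (\<lambda>x. (\<lambda>z. u (fst z) (snd z)) (x, t))"
    by (rule continuous_on_compose2[OF continuous_on_u]) (use assms in \<open>auto intro!: continuous_intros\<close>)
  then show ?thesis by simp
qed

lemma continuous_on_K_slice:
  assumes "t \<ge> 0"
  shows "continuous_on (sphere 0 1) (\<lambda>x. K x t)"
proof -
  have "continuous_on (sphere 0 1) (\<lambda>x. (\<lambda>z. K (fst z) (snd z)) (x, t))"
    by (rule continuous_on_compose2[OF continuous_on_K]) (use assms in \<open>auto intro!: continuous_intros\<close>)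
  then show ?thesis by simp
qed

section \<open>Volume of the bodies\<close>

lemma cone_volume: "set_integrable lborel (cball 0 1 - {0}) (\<lambda>y::real^'n. 1 :: real)"
    "(LINT y:cball (0::real^'n) 1 - {0}|lborel. 1) = measure lborel (ball (0::real^'n) 1)"
proof -
  have int: "integrable sphere_measure (\<lambda>x::real^'n. 1::real)"
    by (rule continuous_on_sphere_integrable) simp
  show "set_integrable lborel (cball 0 1 - {0}) (\<lambda>y::real^'n. 1 :: real)"
    using sphere_avg_closed_cone(1)[OF int] .
  show "(LINT y:cball (0::real^'n) 1 - {0}|lborel. 1) = measure lborel (ball (0::real^'n) 1)"
    using sphere_avg_closed_cone(2)[OF int] measure_ball_pos[where 'n = 'n] by (simp add: field_simps)
qed

text \<open>The part of \<open>\<Omega> t0\<close> which the flow restarted at \<open>t0\<close>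
  never sweeps out, written through \<open>u\<close>.\<close>

definition limit_core :: "real \<Rightarrow> (real^'n) set" where
  "limit_core t0 = {z. \<forall>t\<ge>0. \<forall>x. norm x = 1 \<longrightarrow> x \<bullet> z \<le> exp (- t) * u x (t0 + t)}"

text \<open>The Jacobian is the speed \<open>K\<close> times the determinant \<open>1 / K\<close>,
  so the swept region has exactly the volume of the unit ball.\<close>

lemma volume_core:
  assumes t0: "t0 \<ge> 0"
  shows "measure lborel (\<Omega> t0) = measure lborel (limit_core t0) + measure lborel (ball (0::real^'n) 1)"
    and "compact (limit_core t0)"
proof -
  interpret S: support_family "\<lambda>y t. p y (t0 + t)" "\<lambda>y t. q y (t0 + t)" "\<lambda>x t. L x (t0 + t)"
    by (rule shift_family[OF t0])
  have body: "S.body = \<Omega> t0"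
    unfolding S.body_def \<Omega>_eq[OF t0] using t0 by (auto simp: inner_p)
  have core: "S.core = limit_core t0"
    unfolding S.core_def limit_core_def using t0 by (auto simp: inner_p)
  have J: "S.J (sgn y) (- ln (norm y)) = 1" if "y \<in> cball 0 1 - {0}" for y
  proof -
    have n: "norm (sgn y) = 1" using that by (auto simp: norm_sgn)
    have "ln (norm y) \<le> 0" using that by simp
    then have t: "t0 - ln (norm y) \<ge> 0" using t0 by linarith
    then show ?thesis
      using K_det[OF n t] K_pos[OF n t] inner_p[OF n t] inner_q[OF n t] K_def[of "sgn y" "t0 - ln (norm y)"]
      by (simp add: S.J_def)
  qed
  have int: "set_integrable lborel (cball 0 1 - {0}) (\<lambda>y. S.J (sgn y) (- ln (norm y)))"
    using cone_volume(1) by (subst set_integrable_cong[OF refl refl J]) auto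
  have "(LINT y:cball 0 1 - {0}|lborel. S.J (sgn y) (- ln (norm y))) = measure lborel (ball (0::real^'n) 1)"
    unfolding cone_volume(2)[symmetric] by (rule set_lebesgue_integral_cong) (auto simp: J)
  with S.measure_body[OF int]
  show "measure lborel (\<Omega> t0) = measure lborel (limit_core t0) + measure lborel (ball (0::real^'n) 1)"
    by (simp add: body core)
  show "compact (limit_core t0)"
    using S.closed_core S.bounded_body S.core_subset_body
    by (simp add: compact_eq_bounded_closed bounded_subset core)
qed

text \<open>The volume hypothesis at time 0 forces \<open>limit_core 0\<close> to be null. The core
  at \<open>t0\<close> lies in its dilation by \<open>exp t0\<close>, so it is null too.\<close>

lemma volume_constant:
  assumes t0: "t0 \<ge> 0"
  shows "measure lborel (\<Omega> t0) = measure lborel (ball (0::real^'n) 1)"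
proof -
  have closed: "closed (\<Omega> 0)"
    using body[of 0] by (simp add: convex_body_def compact_imp_closed)
  then have "measure lborel (\<Omega> 0) = measure lborel (ball (0::real^'n) 1)"
    using volume by simp
  then have null: "measure lborel (limit_core 0) = 0"
    using volume_core(1)[of 0] by simp
  let ?S = "(\<lambda>z. exp t0 *\<^sub>R z) ` limit_core 0"
  have sub: "limit_core t0 \<subseteq> ?S"
  proof
    fix z assume z: "z \<in> limit_core t0"
    have zle: "x \<bullet> z \<le> exp (- t) * u x (t0 + t)" if "t \<ge> 0" "norm x = 1" for t x
      using z that by (auto simp: limit_core_def)
    have "exp (- t0) *\<^sub>R z \<in> limit_core 0"
      unfolding limit_core_def
    proof (intro CollectI allI impI)
      fix t :: real and x :: "real^'n" assume t: "0 \<le> t" and x: "norm x = 1"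
      show "x \<bullet> exp (- t0) *\<^sub>R z \<le> exp (- t) * u x (0 + t)"
      \<comment> \<open>Constraints from \<open>t0\<close> on are those of the restarted flow at
        time \<open>t - t0\<close>; earlier ones follow from the constraint at \<open>t0\<close>,
        because the rescaled support functions decrease.\<close>
      proof (cases "t0 \<le> t")
        case True
        then have "x \<bullet> z \<le> exp (- (t - t0)) * u x t"
          using zle[of "t - t0" x] x by simp
        then have "exp (- t0) * (x \<bullet> z) \<le> exp (- t0) * (exp (- (t - t0)) * u x t)"
          by simp
        then show ?thesis by (simp flip: mult.assoc exp_add)
      next
        case False
        have "x \<bullet> z \<le> u x t0" using zle[of 0 x] x by simp
        then have "exp (- t0) * (x \<bullet> z) \<le> exp (- t0) * u x t0" by simp
        also have "\<dots> \<le> exp (- t) * u x t"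
          using False by (intro scaled_support_decreasing x t) auto
        finally show ?thesis by simp
      qed
    qed
    then show "z \<in> ?S" by (intro image_eqI[of _ _ "exp (- t0) *\<^sub>R z"]) (simp_all add: exp_minus)
  qed
  have comp: "compact ?S" by (intro compact_scaling volume_core(2)) simp
  have "measure lborel ?S = measure lebesgue ((\<lambda>z. exp t0 *\<^sub>R z + 0) ` limit_core 0)"
    using comp by (simp add: compact_imp_closed)
  also have "\<dots> = \<bar>exp t0\<bar> ^ DIM(real^'n) * measure lebesgue (limit_core 0)"
    using measure_lebesgue_affine[of "exp t0" 0 "limit_core 0"] by (simp add: add.commute)
  also have "measure lebesgue (limit_core 0) = 0"
    using null volume_core(2)[of 0] by (simp add: compact_imp_closed)
  finally have "measure lborel ?S = 0" by simp
  moreover have "measure lborel (limit_core t0) \<le> measure lborel ?S"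
    using comp volume_core(2)[OF t0]
    by (intro measure_mono_fmeasurable sub) (auto simp: fmeasurable_compact compact_imp_closed)
  ultimately have "measure lborel (limit_core t0) = 0"
    using measure_nonneg[of lborel "limit_core t0"] by simp
  then show ?thesis using volume_core(1)[OF t0] by simp
qed

text \<open>Applying the same change of variables to the constant family \<open>\<Omega> t - w\<close> takes the place of
  the Minkowski formula for \<open>\<Omega> t\<close>.\<close>

lemma avg_support_over_K:
  assumes t0: "t0 \<ge> 0" and w: "\<And>x. norm x = 1 \<Longrightarrow> x \<bullet> w < u x t0"
  shows "sphere_avg (\<lambda>x. (u x t0 - x \<bullet> w) / K x t0) = 1"
proof -
  interpret S: support_family "\<lambda>y t. p y t0 - w" "\<lambda>y t. 0" "\<lambda>x t. L x t0"
    by (rule translate_family[OF assms])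
  have body_eq: "S.body = (\<lambda>z. z - w) ` \<Omega> t0"
  proof -
    have "S.body = {z. z + w \<in> \<Omega> t0}"
      unfolding S.body_def \<Omega>_eq[OF t0] using t0 by (auto simp: inner_p inner_diff_right inner_add_right le_diff_eq)
    also have "\<dots> = (\<lambda>z. z - w) ` \<Omega> t0"
      by (auto simp: image_iff intro!: bexI[of _ "_ + w"])
    finally show ?thesis .
  qed
  \<comment> \<open>A fixed bounded body rescaled by \<open>exp (- t)\<close> shrinks to the origin,
    so this family has no volume defect.\<close>
  have core: "S.core \<subseteq> {0}"
  proof
    fix z assume z: "z \<in> S.core"
    have "x \<bullet> z \<le> 0" if x: "norm x = 1" for x
    proof (rule tendsto_lowerbound)
      show "((\<lambda>t. exp (- t) * (x \<bullet> (p x t0 - w))) \<longlongrightarrow> 0) at_top"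
        by (intro tendsto_mult_left_zero filterlim_compose[OF exp_at_bot] filterlim_uminus_at_bot_at_top)
      show "\<forall>\<^sub>F t in at_top. x \<bullet> z \<le> exp (- t) * (x \<bullet> (p x t0 - w))"
        using eventually_ge_at_top[of 0]
        by eventually_elim (use z x in \<open>auto simp: S.core_def\<close>)
    qed simp
    moreover have "sgn z \<bullet> z = norm z"
      by (cases "z = 0") (simp_all add: sgn_div_norm dot_square_norm power2_eq_square)
    ultimately have "norm z \<le> 0" if "z \<noteq> 0"
      using that by (metis norm_sgn)
    then show "z \<in> {0}" by auto
  qed
  have "measure lborel S.core \<le> measure lborel {0 :: real^'n}"
    using core S.closed_core by (intro measure_mono_fmeasurable) (auto simp: fmeasurable_compact)
  then have core0: "measure lborel S.core = 0" using measure_nonneg[of lborel S.core] by simp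
  let ?g = "\<lambda>x. (u x t0 - x \<bullet> w) / K x t0"
  \<comment> \<open>With zero time derivative the speed factor is the translated support function
    itself, so the swept volume becomes the average in question.\<close>
  have J: "S.J (sgn y) (- ln (norm y)) = ?g (sgn y)" if "y \<in> cball 0 1 - {0}" for y
  proof -
    have n: "norm (sgn y) = 1" using that by (auto simp: norm_sgn)
    then show ?thesis using K_det[OF n t0] t0 by (simp add: S.J_def inner_p inner_diff_right)
  qed
  have "continuous_on (sphere 0 1) ?g"
    using K_pos[OF _ t0] by (intro continuous_intros continuous_on_u_slice continuous_on_K_slice t0) force+
  then have int: "integrable sphere_measure ?g" by (rule continuous_on_sphere_integrable)
  have intJ: "set_integrable lborel (cball 0 1 - {0}) (\<lambda>y. S.J (sgn y) (- ln (norm y)))"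
    using sphere_avg_closed_cone(1)[OF int] by (subst set_integrable_cong[OF refl refl J]) auto
  have "(LINT y:cball 0 1 - {0}|lborel. S.J (sgn y) (- ln (norm y)))
      = (LINT y:cball 0 1 - {0}|lborel. ?g (sgn y))"
    by (rule set_lebesgue_integral_cong) (use J in auto)
  then have "measure lborel ((\<lambda>z. z - w) ` \<Omega> t0) = (LINT y:cball 0 1 - {0}|lborel. ?g (sgn y))"
    using S.measure_body[OF intJ] core0 by (simp add: body_eq)
  moreover have "measure lborel ((\<lambda>z. z - w) ` \<Omega> t0) = measure lborel (\<Omega> t0)"
  proof -
    have "closed (\<Omega> t0)" using body[OF t0] by (simp add: convex_body_def compact_imp_closed)
    then show ?thesis
      using measure_translation_subtract[of w "\<Omega> t0"] S.closed_body by (simp add: body_eq)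
  qed
  ultimately show ?thesis
    unfolding sphere_avg_closed_cone(2)[OF int] using volume_constant[OF t0] measure_ball_pos[where 'n = 'n]
    by simp
qed

end

section \<open>Entropy along the flow\<close>

text \<open>The difference of the sides is \<open>(r - 1)\<^sup>2 / r\<close>. Used pointwise with
  \<open>r = v / K\<close>, it turns the known average of \<open>v / K\<close> into a sign for the
  energy derivative.\<close>

lemma one_minus_inverse_le: "r > 0 \<Longrightarrow> 1 - 1 / r \<le> r - (1::real)"
  using zero_le_square[of "r - 1"] by (simp add: field_simps power2_eq_square)

lemma ln_diff_le: "0 < a \<Longrightarrow> 0 < a + b \<Longrightarrow> ln (a + b) \<le> ln a + b / (a::real)"
  using ln_le_minus_one[of "(a + b) / a"] by (simp add: ln_div field_simps)

context gauss_flow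
begin

section \<open>Energies of translated solutions\<close>

lemma admissible_earlier:
  assumes w: "\<And>x. norm x = 1 \<Longrightarrow> x \<bullet> w < exp (- T) * u x T" and t: "0 \<le> t" "t \<le> T"
    and x: "norm x = 1"
  shows "exp t * (x \<bullet> w) < u x t"
proof -
  have "x \<bullet> w < exp (- t) * u x t"
    using w[OF x] scaled_support_decreasing[OF x t] by simp
  then have "exp t * (x \<bullet> w) < exp t * (exp (- t) * u x t)" by (rule mult_strict_left_mono) simp
  also have "\<dots> = u x t" by (simp add: exp_minus)
  finally show ?thesis .
qed

lemma ln_translated_integrable:
  assumes "t \<ge> 0" "\<And>x. norm x = 1 \<Longrightarrow> x \<bullet> w < u x t"
  shows "integrable sphere_measure (\<lambda>x. ln (u x t - x \<bullet> w))"
  using assms by (intro continuous_on_sphere_integrable continuous_intros continuous_on_u_slice) force+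

text \<open>The function \<open>exp t * (x \<bullet> w)\<close> solves \<open>v' = v\<close> and
  translation does not change the curvature, so the logarithm of the translated support function
  \<open>v\<close> has derivative \<open>(v - K) / v\<close>.\<close>

lemma energy_translated:
  assumes w: "\<And>x. norm x = 1 \<Longrightarrow> x \<bullet> w < exp (- T) * u x T" and ab: "0 \<le> a" "a \<le> b" "b \<le> T"
  shows "set_integrable lborel {a..b} (\<lambda>s. sphere_avg (\<lambda>x. 1 - K x s / (u x s - exp s * (x \<bullet> w))))"
    and "(LINT s:{a..b}|lborel. sphere_avg (\<lambda>x. 1 - K x s / (u x s - exp s * (x \<bullet> w))))
      = sphere_avg (\<lambda>x. ln (u x b - exp b * (x \<bullet> w))) - sphere_avg (\<lambda>x. ln (u x a - exp a * (x \<bullet> w)))"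
proof -
  have pos: "exp s * (x \<bullet> w) < u x s" if "norm x = 1" "a \<le> s" "s \<le> b" for x s
    using admissible_earlier[OF w] that ab by auto
  have sub: "sphere 0 1 \<times> {a..b} \<subseteq> {x. norm x = 1} \<times> {0..}" using ab by auto
  have cont: "continuous_on (sphere 0 1 \<times> {a..b})
      (\<lambda>z. 1 - K (fst z) (snd z) / (u (fst z) (snd z) - exp (snd z) * (fst z \<bullet> w)))"
    using pos by (intro continuous_intros continuous_on_subset[OF continuous_on_u sub]
        continuous_on_subset[OF continuous_on_K sub]) force
  have der: "((\<lambda>s. ln (u x s - exp s * (x \<bullet> w))) has_real_derivative
      1 - K x s / (u x s - exp s * (x \<bullet> w))) (at s within {a..b})"
    if "x \<in> sphere 0 1" "s \<in> {a..b}" for x s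
  proof -
    have x: "norm x = 1" and s: "0 \<le> s" "a \<le> s" "s \<le> b" using that ab by auto
    have "(u x has_real_derivative u x s - K x s) (at s within {a..b})"
      using ab by (intro has_field_derivative_subset[OF u_deriv[OF x s(1)]]) auto
    then have "((\<lambda>s. u x s - exp s * (x \<bullet> w)) has_real_derivative
        u x s - K x s - exp s * (x \<bullet> w)) (at s within {a..b})"
      by (auto intro!: derivative_eq_intros)
    from DERIV_chain2[OF DERIV_ln this] pos[OF x s(2,3)]
    show ?thesis by (simp add: field_simps)
  qed
  have int: "integrable sphere_measure (\<lambda>x. ln (u x s - exp s * (x \<bullet> w)))" if "s = a \<or> s = b" for s
    using ln_translated_integrable[of s "exp s *\<^sub>R w"] pos[of _ s] that ab by auto
  show "set_integrable lborel {a..b} (\<lambda>s. sphere_avg (\<lambda>x. 1 - K x s / (u x s - exp s * (x \<bullet> w))))"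
    by (rule sphere_avg_FTC(1)[OF ab(2) cont der]) (use int in auto)
  show "(LINT s:{a..b}|lborel. sphere_avg (\<lambda>x. 1 - K x s / (u x s - exp s * (x \<bullet> w))))
      = sphere_avg (\<lambda>x. ln (u x b - exp b * (x \<bullet> w))) - sphere_avg (\<lambda>x. ln (u x a - exp a * (x \<bullet> w)))"
    by (rule sphere_avg_FTC(2)[OF ab(2) cont der]) (use int in auto)
qed

lemma avg_K_ratio_nonpos:
  assumes t: "t \<ge> 0" and w: "\<And>x. norm x = 1 \<Longrightarrow> x \<bullet> w < u x t"
  shows "sphere_avg (\<lambda>x. 1 - K x t / (u x t - x \<bullet> w)) \<le> 0"
proof -
  have ne: "u x t - x \<bullet> w \<noteq> 0" "K x t \<noteq> 0" if "x \<in> sphere 0 1" for x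
    using w[of x] K_pos[of x t] t that by auto
  have c1: "continuous_on (sphere 0 1) (\<lambda>x. 1 - K x t / (u x t - x \<bullet> w))"
    by (intro continuous_intros continuous_on_u_slice continuous_on_K_slice t) (use ne in auto)
  have c2: "continuous_on (sphere 0 1) (\<lambda>x. (u x t - x \<bullet> w) / K x t)"
    by (intro continuous_intros continuous_on_u_slice continuous_on_K_slice t) (use ne in auto)
  have int: "integrable sphere_measure (\<lambda>x::real^'n. 1 :: real)"
    by (rule continuous_on_sphere_integrable) simp
  have "sphere_avg (\<lambda>x. 1 - K x t / (u x t - x \<bullet> w)) \<le> sphere_avg (\<lambda>x. (u x t - x \<bullet> w) / K x t - 1)"
  proof (rule sphere_avg_mono)
    fix x :: "real^'n" assume "x \<in> sphere 0 1"
    then have "(u x t - x \<bullet> w) / K x t > 0" using w[of x] K_pos[of x t] t by simp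
    from one_minus_inverse_le[OF this]
    show "1 - K x t / (u x t - x \<bullet> w) \<le> (u x t - x \<bullet> w) / K x t - 1" by simp
  qed (use c1 c2 in \<open>auto intro!: continuous_on_sphere_integrable continuous_intros\<close>)
  also have "\<dots> = 0"
    using continuous_on_sphere_integrable[OF c2] int avg_support_over_K[OF t w]
    by (subst sphere_avg_diff) auto
  finally show ?thesis .
qed

lemma energy_translated_antimono:
  assumes w: "\<And>x. norm x = 1 \<Longrightarrow> x \<bullet> w < exp (- T) * u x T" and ab: "0 \<le> a" "a \<le> b" "b \<le> T"
  shows "sphere_avg (\<lambda>x. ln (u x b - exp b * (x \<bullet> w))) \<le> sphere_avg (\<lambda>x. ln (u x a - exp a * (x \<bullet> w)))"
proof -
  have "sphere_avg (\<lambda>x. 1 - K x s / (u x s - exp s * (x \<bullet> w))) \<le> 0" if "s \<in> {a..b}" for s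
    using avg_K_ratio_nonpos[of s "exp s *\<^sub>R w"] admissible_earlier[OF w, of s] that ab by auto
  then have "(LINT s:{a..b}|lborel. sphere_avg (\<lambda>x. 1 - K x s / (u x s - exp s * (x \<bullet> w))))
      \<le> (LINT s:{a..b}|lborel. (0::real))"
    by (intro set_integral_mono energy_translated(1)[OF w ab]) (auto simp: set_integrable_def)
  moreover have "(LINT s:{a..b}|lborel. (0::real)) = 0"
    by (simp add: set_lebesgue_integral_def)
  ultimately show ?thesis
    using energy_translated(2)[OF w ab] by simp
qed

section \<open>The dissipation rate\<close>

definition D :: "real \<Rightarrow> real" where
  "D s = sphere_avg (\<lambda>x. (sqrt (gauss_curv (\<lambda>y. u y s) x / u x s)
                           - sqrt (u x s / gauss_curv (\<lambda>y. u y s) x))\<^sup>2)"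

lemma D_nonneg: "D s \<ge> 0"
  unfolding D_def sphere_avg_def
  by (intro mult_nonneg_nonneg Bochner_Integration.integral_nonneg) auto

text \<open>With \<open>r = K / u\<close> the square equals \<open>r + 1 / r - 2\<close>, that is
  \<open>(1 / r - 1) - (1 - r)\<close>, and \<open>1 / r\<close> has average 1 by
  \<open>avg_support_over_K\<close> at \<open>w = 0\<close>.\<close>

lemma D_eq:
  assumes s: "s \<ge> 0"
  shows "D s = - sphere_avg (\<lambda>x. 1 - K x s / u x s)"
proof -
  have ne: "u x s \<noteq> 0" "K x s \<noteq> 0" if "x \<in> sphere 0 1" for x
    using positive[of x s] K_pos[of x s] s that by auto
  have c1: "continuous_on (sphere 0 1) (\<lambda>x. 1 - K x s / u x s)"
    by (intro continuous_intros continuous_on_u_slice continuous_on_K_slice s) (use ne in auto)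
  have c2: "continuous_on (sphere 0 1) (\<lambda>x. u x s / K x s)"
    by (intro continuous_intros continuous_on_u_slice continuous_on_K_slice s) (use ne in auto)
  note i1 = continuous_on_sphere_integrable[OF c1] and i2 = continuous_on_sphere_integrable[OF c2]
  have int: "integrable sphere_measure (\<lambda>x::real^'n. 1 :: real)"
    by (rule continuous_on_sphere_integrable) simp
  have i3: "integrable sphere_measure (\<lambda>x. u x s / K x s - 1)"
    using i2 int by (rule Bochner_Integration.integrable_diff)
  have avg: "sphere_avg (\<lambda>x. u x s / K x s) = 1"
    using avg_support_over_K[OF s, of 0] positive s by simp
  have "D s = sphere_avg (\<lambda>x. (u x s / K x s - 1) - (1 - K x s / u x s))"
    unfolding D_def
  proof (rule sphere_avg_cong)
    fix x :: "real^'n" assume "x \<in> sphere 0 1"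
    then have x: "norm x = 1" by simp
    define r where "r = K x s / u x s"
    have r: "r > 0" using positive[OF x s] K_pos[OF x s] by (simp add: r_def)
    have "sqrt r * sqrt (1 / r) = 1"
      using r by (simp add: real_sqrt_divide)
    then have "(sqrt r - sqrt (1 / r))\<^sup>2 = r + 1 / r - 2"
      using r by (simp add: power2_diff)
    then show "(sqrt (gauss_curv (\<lambda>y. u y s) x / u x s) - sqrt (u x s / gauss_curv (\<lambda>y. u y s) x))\<^sup>2
        = (u x s / K x s - 1) - (1 - K x s / u x s)"
      by (simp add: gauss_curv_eq[OF x s] r_def)
  qed
  also have "\<dots> = - sphere_avg (\<lambda>x. 1 - K x s / u x s)"
    by (subst sphere_avg_diff[OF i3 i1], subst sphere_avg_diff[OF i2 int]) (simp add: avg)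
  finally show ?thesis .
qed

lemma energy_dissipation:
  assumes ab: "0 \<le> a" "a \<le> b"
  shows "set_integrable lborel {a..b} D"
    and "(LINT s:{a..b}|lborel. D s) = sphere_avg (\<lambda>x. ln (u x a)) - sphere_avg (\<lambda>x. ln (u x b))"
proof -
  have w: "x \<bullet> 0 < exp (- b) * u x b" if "norm x = 1" for x
    using positive[OF that, of b] ab by simp
  have D: "D s = - sphere_avg (\<lambda>x. 1 - K x s / (u x s - exp s * (x \<bullet> 0)))" if "s \<in> {a..b}" for s
    using D_eq[of s] that ab by simp
  note 1 = energy_translated[OF w ab order_refl]
  show "set_integrable lborel {a..b} D"
    using set_integrable_mult_right[OF 1(1), of "-1"]
    by (subst set_integrable_cong[OF refl refl D]) auto
  have "(LINT s:{a..b}|lborel. D s)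
      = (LINT s:{a..b}|lborel. - sphere_avg (\<lambda>x. 1 - K x s / (u x s - exp s * (x \<bullet> 0))))"
    by (rule set_lebesgue_integral_cong) (use D in auto)
  also have "\<dots> = - (sphere_avg (\<lambda>x. ln (u x b)) - sphere_avg (\<lambda>x. ln (u x a)))"
    using 1(2) by (simp add: set_lebesgue_integral_def)
  finally show "(LINT s:{a..b}|lborel. D s) = sphere_avg (\<lambda>x. ln (u x a)) - sphere_avg (\<lambda>x. ln (u x b))"
    by simp
qed

section \<open>Base points and monotonicity of the entropy\<close>

lemma support_fun_translate:
  assumes t: "t \<ge> 0" and x: "norm x = 1"
  shows "support_fun (\<Omega> t) z x = u x t - x \<bullet> z"
proof -
  obtain y where y: "y \<in> \<Omega> t" "x \<bullet> y = u x t" using support_attained[OF t x] .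
  show ?thesis
    unfolding support_fun_def
  proof (rule cSup_eq_maximum)
    show "u x t - x \<bullet> z \<in> (\<lambda>w. x \<bullet> (w - z)) ` \<Omega> t"
      using y by (auto simp: inner_diff_right intro!: image_eqI[of _ _ y])
  qed (use support_le[OF t x] in \<open>auto simp: inner_diff_right\<close>)
qed

definition admissible :: "real \<Rightarrow> (real^'n) set" where
  "admissible t = {z. \<forall>x. norm x = 1 \<longrightarrow> x \<bullet> z < u x t}"

lemma entropy_eq:
  assumes t: "t \<ge> 0"
  shows "entropy (\<Omega> t) = (SUP z\<in>admissible t. sphere_avg (\<lambda>x. ln (u x t - x \<bullet> z)))"
proof -
  have "{z \<in> \<Omega> t. \<forall>x\<in>sphere 0 1. support_fun (\<Omega> t) z x > 0} = admissible t"
    unfolding admissible_def \<Omega>_eq[OF t]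
    by (auto simp: support_fun_translate[OF t, unfolded \<Omega>_eq[OF t]] less_imp_le)
  moreover have "sphere_avg (\<lambda>x. ln (support_fun (\<Omega> t) z x)) = sphere_avg (\<lambda>x. ln (u x t - x \<bullet> z))" for z
    by (rule sphere_avg_cong) (simp add: support_fun_translate[OF t])
  ultimately show ?thesis by (simp add: entropy_def)
qed

lemma zero_admissible: "t \<ge> 0 \<Longrightarrow> 0 \<in> admissible t"
  by (simp add: admissible_def positive)

lemma admissible_in_\<Omega>: "t \<ge> 0 \<Longrightarrow> z \<in> admissible t \<Longrightarrow> z \<in> \<Omega> t"
  by (auto simp: admissible_def \<Omega>_eq less_imp_le)

text \<open>The work lies in showing that the real supremum is bounded: if the body lies within
  distance \<open>B\<close> of the origin, each translated support function is at most
  \<open>2 * B\<close>.\<close>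

lemma entropy_upper:
  assumes t: "t \<ge> 0" and z: "z \<in> admissible t"
  shows "sphere_avg (\<lambda>x. ln (u x t - x \<bullet> z)) \<le> entropy (\<Omega> t)"
  unfolding entropy_eq[OF t]
proof (rule cSUP_upper[OF z])
  have "bounded (\<Omega> t)" using body[OF t] by (simp add: convex_body_def compact_imp_bounded)
  then obtain B where B: "\<And>z. z \<in> \<Omega> t \<Longrightarrow> norm z \<le> B" by (auto simp: bounded_iff)
  show "bdd_above ((\<lambda>z. sphere_avg (\<lambda>x. ln (u x t - x \<bullet> z))) ` admissible t)"
  proof (rule bdd_aboveI2)
    fix z assume z: "z \<in> admissible t"
    then have adm: "x \<bullet> z < u x t" if "norm x = 1" for x using that by (simp add: admissible_def)
    have "sphere_avg (\<lambda>x. ln (u x t - x \<bullet> z)) \<le> sphere_avg (\<lambda>x::real^'n. ln (2 * B))"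
    proof (rule sphere_avg_mono)
      fix x :: "real^'n" assume "x \<in> sphere 0 1"
      then have x: "norm x = 1" by simp
      obtain y where y: "y \<in> \<Omega> t" "x \<bullet> y = u x t" using support_attained[OF t x] .
      have "u x t \<le> B"
        using norm_cauchy_schwarz[of x y] B[OF y(1)] x y(2) by simp
      moreover have "- (x \<bullet> z) \<le> B"
        using norm_cauchy_schwarz[of "- x" z] B[OF admissible_in_\<Omega>[OF t z]] x by simp
      ultimately show "ln (u x t - x \<bullet> z) \<le> ln (2 * B)"
        using adm[OF x] by (intro ln_mono) auto
    qed (use ln_translated_integrable[OF t adm] in \<open>auto intro!: continuous_on_sphere_integrable\<close>)
    then show "sphere_avg (\<lambda>x. ln (u x t - x \<bullet> z)) \<le> ln (2 * B)" by simp
  qed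
qed

text \<open>The translated solution has the constant vector
  \<open>w = exp (- T) *\<^sub>R z\<close>, and its base point at time \<open>s\<close> is
  \<open>exp s *\<^sub>R w\<close>.\<close>

lemma admissible_translate_back:
  assumes z: "z \<in> admissible T" and st: "0 \<le> s" "s \<le> T"
  shows "exp (s - T) *\<^sub>R z \<in> admissible s"
    and "sphere_avg (\<lambda>x. ln (u x T - x \<bullet> z)) \<le> sphere_avg (\<lambda>x. ln (u x s - x \<bullet> (exp (s - T) *\<^sub>R z)))"
proof -
  define w where "w = exp (- T) *\<^sub>R z"
  have w: "x \<bullet> w < exp (- T) * u x T" if "norm x = 1" for x
    using z that by (simp add: w_def admissible_def)
  have eq: "exp t * (x \<bullet> w) = x \<bullet> (exp (t - T) *\<^sub>R z)" for t x
    by (simp add: w_def exp_diff exp_minus divide_inverse)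
  show "exp (s - T) *\<^sub>R z \<in> admissible s"
    using admissible_earlier[OF w st] by (simp add: admissible_def eq)
  show "sphere_avg (\<lambda>x. ln (u x T - x \<bullet> z)) \<le> sphere_avg (\<lambda>x. ln (u x s - x \<bullet> (exp (s - T) *\<^sub>R z)))"
    using energy_translated_antimono[OF w st order_refl] by (simp add: eq)
qed

lemma entropy_antimono:
  assumes "0 \<le> s" "s \<le> t"
  shows "entropy (\<Omega> t) \<le> entropy (\<Omega> s)"
proof -
  have t: "t \<ge> 0" using assms by simp
  show ?thesis
    unfolding entropy_eq[OF t]
  proof (rule cSUP_least)
    show "admissible t \<noteq> {}" using zero_admissible[OF t] by auto
    fix z assume "z \<in> admissible t"
    note 1 = admissible_translate_back[OF this assms]
    show "sphere_avg (\<lambda>x. ln (u x t - x \<bullet> z)) \<le> entropy (\<Omega> s)"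
      using 1(2) entropy_upper[OF assms(1) 1(1)] by simp
  qed
qed

text \<open>The constant is independent of time and of \<open>z\<close>. The estimate is used in
  both directions: a point of definite size bounds the entropy below, and an entropy bound limits
  the size of all points.\<close>

lemma entropy_lower_bound:
  obtains C where "\<And>t z. t \<ge> 0 \<Longrightarrow> z \<in> \<Omega> t \<Longrightarrow> z \<noteq> 0 \<Longrightarrow> ln (norm z / 2) - C \<le> entropy (\<Omega> t)"
proof -
  obtain C where C: "\<And>(e :: real^'n) f. \<lbrakk>norm e = 1; continuous_on (sphere 0 1) f; \<And>x. x \<in> sphere 0 1 \<Longrightarrow> f x > 0;
      \<And>x. x \<in> sphere 0 1 \<Longrightarrow> \<bar>x \<bullet> e\<bar> \<le> f x\<rbrakk> \<Longrightarrow> sphere_avg (\<lambda>x. ln (f x)) \<ge> - C"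
    using sphere_avg_ln_lower_bound by blast
  show ?thesis
  proof (rule that[of C])
    fix t z assume t: "t \<ge> 0" and z: "z \<in> \<Omega> t" "z \<noteq> 0"
    \<comment> \<open>Seen from the midpoint \<open>z / 2\<close>, the body contains the segment
      with half-vectors \<open>z / 2\<close> and \<open>- z / 2\<close>, because it contains both
      \<open>z\<close> and the origin.\<close>
    have xz: "x \<bullet> z / 2 < u x t" "\<bar>x \<bullet> z\<bar> / 2 \<le> u x t - x \<bullet> z / 2" if "norm x = 1" for x
      using support_le[OF t that z(1)] positive[OF that t] by linarith+
    have adm: "z /\<^sub>R 2 \<in> admissible t" using xz(1) by (simp add: admissible_def)
    define f where "f x = (u x t - x \<bullet> z / 2) / (norm z / 2)" for x
    have cont: "continuous_on (sphere 0 1) f"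
      unfolding f_def by (intro continuous_intros continuous_on_u_slice t) (use z in auto)
    have pos: "f x > 0" if "x \<in> sphere 0 1" for x
      using xz(1)[of x] that z by (simp add: f_def)
    have le: "\<bar>x \<bullet> sgn z\<bar> \<le> f x" if "x \<in> sphere 0 1" for x
      using xz(2)[of x] that z by (simp add: f_def sgn_div_norm abs_mult field_simps)
    have "integrable sphere_measure (\<lambda>x. ln (f x))"
      using cont pos by (intro continuous_on_sphere_integrable continuous_intros) force+
    moreover have "integrable sphere_measure (\<lambda>x::real^'n. ln (norm z / 2))"
      by (intro continuous_on_sphere_integrable continuous_intros) (use z in auto)
    ultimately have "sphere_avg (\<lambda>x. ln (f x) + ln (norm z / 2)) = sphere_avg (\<lambda>x. ln (f x)) + ln (norm z / 2)"
      by (subst sphere_avg_add) auto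
    also have "sphere_avg (\<lambda>x. ln (f x) + ln (norm z / 2)) = sphere_avg (\<lambda>x. ln (u x t - x \<bullet> (z /\<^sub>R 2)))"
    proof (rule sphere_avg_cong)
      fix x :: "real^'n" assume x: "x \<in> sphere 0 1"
      have "ln (f x) + ln (norm z / 2) = ln (f x * (norm z / 2))"
        using pos[OF x] z by (subst ln_mult) auto
      also have "f x * (norm z / 2) = u x t - x \<bullet> (z /\<^sub>R 2)"
        using z by (simp add: f_def)
      finally show "ln (f x) + ln (norm z / 2) = ln (u x t - x \<bullet> (z /\<^sub>R 2))" .
    qed
    finally have "sphere_avg (\<lambda>x. ln (f x)) + ln (norm z / 2) \<le> entropy (\<Omega> t)"
      using entropy_upper[OF t adm] by simp
    moreover have "norm (sgn z) = 1" using z by (simp add: norm_sgn)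
    ultimately show "ln (norm z / 2) - C \<le> entropy (\<Omega> t)"
      using C[OF _ cont pos le] by fastforce
  qed
qed

text \<open>A body with the volume of the unit ball does not fit into a ball of radius
  \<open>1 / 2\<close>; this supplies the point of definite size needed for a lower bound on the
  entropy.\<close>

lemma \<Omega>_not_small:
  assumes t: "t \<ge> 0"
  obtains z where "z \<in> \<Omega> t" "norm z \<ge> 1 / 2"
proof (rule ccontr)
  assume "\<not> thesis"
  with that have sub: "\<Omega> t \<subseteq> cball 0 (1/2)" by (force simp: not_le)
  have "compact (\<Omega> t)" using body[OF t] by (simp add: convex_body_def)
  then have "measure lborel (\<Omega> t) \<le> measure lborel (cball (0::real^'n) (1/2))"
    using sub by (intro measure_mono_fmeasurable) (auto simp: fmeasurable_compact compact_imp_closed)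
  then have "measure lborel (ball (0::real^'n) 1) \<le> measure lborel (cball (0::real^'n) (1/2))"
    by (simp add: volume_constant[OF t])
  then have "unit_ball_vol (real CARD('n)) * 1 \<le> unit_ball_vol (real CARD('n)) * (1 / 2) ^ CARD('n)"
    by (simp add: content_ball content_cball)
  moreover have "unit_ball_vol (real CARD('n)) > 0" by simp
  ultimately have "1 \<le> (1 / 2 :: real) ^ CARD('n)"
    by (simp only: mult_le_cancel_left_pos)
  moreover have "(1 / 2 :: real) ^ CARD('n) < 1"
    using power_strict_decreasing[of 0 "CARD('n)" "1 / 2 :: real"] by simp
  ultimately show False by simp
qed

lemma entropy_tendsto:
  obtains E where "((\<lambda>\<tau>. entropy (\<Omega> \<tau>)) \<longlongrightarrow> E) at_top" "\<And>t. t \<ge> 0 \<Longrightarrow> E \<le> entropy (\<Omega> t)"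
proof -
  obtain C where C: "\<And>t z. t \<ge> 0 \<Longrightarrow> z \<in> \<Omega> t \<Longrightarrow> z \<noteq> 0 \<Longrightarrow> ln (norm z / 2) - C \<le> entropy (\<Omega> t)"
    using entropy_lower_bound by blast
  \<comment> \<open>The constant \<open>1 / 4\<close> is half of the norm \<open>1 / 2\<close>
    guaranteed by the volume.\<close>
  have low: "ln (1 / 4) - C \<le> entropy (\<Omega> t)" if t: "t \<ge> 0" for t
  proof -
    obtain z where z: "z \<in> \<Omega> t" "norm z \<ge> 1 / 2" using \<Omega>_not_small[OF t] .
    then have "z \<noteq> 0" by auto
    have "ln (1 / 4) \<le> ln (norm z / 2)" using z(2) by (intro ln_mono) auto
    then show ?thesis using C[OF t z(1) \<open>z \<noteq> 0\<close>] by simp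
  qed
  define E where "E = (INF t\<in>{0..}. entropy (\<Omega> t))"
  have bdd: "bdd_below ((\<lambda>t. entropy (\<Omega> t)) ` {0..})"
    using low by (intro bdd_belowI2) auto
  have E: "E \<le> entropy (\<Omega> t)" if "t \<ge> 0" for t
    unfolding E_def using that by (intro cINF_lower bdd) auto
  have "((\<lambda>\<tau>. entropy (\<Omega> \<tau>)) \<longlongrightarrow> E) at_top"
  proof (rule order_tendstoI)
    fix a assume "a < E"
    show "\<forall>\<^sub>F \<tau> in at_top. a < entropy (\<Omega> \<tau>)"
      using eventually_ge_at_top[of 0] by eventually_elim (use E \<open>a < E\<close> in force)
  next
    fix a assume "E < a"
    then obtain s where s: "s \<ge> 0" "entropy (\<Omega> s) < a"
      unfolding E_def by (subst (asm) cINF_less_iff[OF _ bdd]) auto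
    show "\<forall>\<^sub>F \<tau> in at_top. entropy (\<Omega> \<tau>) < a"
      using eventually_ge_at_top[of s]
      by eventually_elim (use entropy_antimono[OF s(1)] s(2) in force)
  qed
  with E that show ?thesis by blast
qed

text \<open>A point far from the origin at any time would push the entropy above its initial
  value.\<close>

lemma uniformly_bounded:
  obtains R where "R \<ge> 0" "\<And>t z. t \<ge> 0 \<Longrightarrow> z \<in> \<Omega> t \<Longrightarrow> norm z \<le> R"
proof -
  obtain C where C: "\<And>t z. t \<ge> 0 \<Longrightarrow> z \<in> \<Omega> t \<Longrightarrow> z \<noteq> 0 \<Longrightarrow> ln (norm z / 2) - C \<le> entropy (\<Omega> t)"
    using entropy_lower_bound by blast
  have "norm z \<le> 2 * exp (entropy (\<Omega> 0) + C)" if t: "t \<ge> 0" and z: "z \<in> \<Omega> t" for t z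
  proof (cases "z = 0")
    case False
    have "ln (norm z / 2) \<le> entropy (\<Omega> 0) + C"
      using C[OF t z False] entropy_antimono[OF order_refl t] by linarith
    then have "exp (ln (norm z / 2)) \<le> exp (entropy (\<Omega> 0) + C)" by simp
    then have "norm z / 2 \<le> exp (entropy (\<Omega> 0) + C)" using False by simp
    then show ?thesis by simp
  qed simp
  then show ?thesis by (intro that[of "2 * exp (entropy (\<Omega> 0) + C)"]) auto
qed

text \<open>Near-optimal base points \<open>z\<close> of \<open>\<Omega> T\<close> are transported back to \<open>exp (s - T) z\<close> at time \<open>s\<close>,
  which tends to the origin as \<open>T \<rightarrow> \<infinity>\<close>.\<close>

lemma energy_ge_limit:
  assumes s: "s \<ge> 0" and E: "\<And>t. t \<ge> 0 \<Longrightarrow> E \<le> entropy (\<Omega> t)"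
  shows "E \<le> sphere_avg (\<lambda>x. ln (u x s))"
proof (rule field_le_epsilon)
  fix e :: real assume e: "e > 0"
  obtain R where R: "R \<ge> 0" "\<And>t z. t \<ge> 0 \<Longrightarrow> z \<in> \<Omega> t \<Longrightarrow> norm z \<le> R"
    using uniformly_bounded by blast
  obtain x0 where x0: "x0 \<in> sphere 0 1" "\<And>x. x \<in> sphere 0 1 \<Longrightarrow> u x0 s \<le> u x s"
    using continuous_attains_inf[of "sphere 0 1", OF _ _ continuous_on_u_slice[OF s]] by auto
  define c where "c = u x0 s"
  have c: "c > 0" using positive[of x0 s] x0 s by (simp add: c_def)
  have "((\<lambda>T. exp (s - T) * R / c) \<longlongrightarrow> 0) at_top"
  proof -
    have "((\<lambda>T. exp (- T) * (exp s * R / c)) \<longlongrightarrow> 0) at_top"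
      by (intro tendsto_mult_left_zero filterlim_compose[OF exp_at_bot] filterlim_uminus_at_bot_at_top)
    then show ?thesis by (simp add: exp_diff exp_minus field_simps)
  qed
  then have "\<forall>\<^sub>F T in at_top. exp (s - T) * R / c < e / 2"
    using e by (intro order_tendstoD(2)) auto
  then have ev: "\<forall>\<^sub>F T in at_top. T \<ge> s \<and> exp (s - T) * R / c < e / 2"
    using eventually_ge_at_top by eventually_elim auto
  obtain T where T: "T \<ge> s" "exp (s - T) * R / c < e / 2"
    using eventually_happens'[OF trivial_limit_at_top_linorder ev] by blast
  have T0: "T \<ge> 0" using T s by simp
  \<comment> \<open>One half of \<open>e\<close> pays for the choice of a base point that is only
    near-optimal, the other half for its displacement from the origin at time
    \<open>s\<close>.\<close>
  have "E - e / 2 < (SUP z\<in>admissible T. sphere_avg (\<lambda>x. ln (u x T - x \<bullet> z)))"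
    using E[OF T0] e unfolding entropy_eq[OF T0] by simp
  then obtain z where z: "z \<in> admissible T" "E - e / 2 < sphere_avg (\<lambda>x. ln (u x T - x \<bullet> z))"
    using less_cSupD[of "(\<lambda>z. sphere_avg (\<lambda>x. ln (u x T - x \<bullet> z))) ` admissible T"] zero_admissible[OF T0]
    by auto
  define w where "w = exp (s - T) *\<^sub>R z"
  note moved = admissible_translate_back[OF z(1) s T(1), folded w_def]
  have adm: "x \<bullet> w < u x s" if "norm x = 1" for x using moved(1) that by (simp add: admissible_def)
  have int: "integrable sphere_measure (\<lambda>x. ln (u x s))"
    using ln_translated_integrable[OF s, of 0] positive s by simp
  have intc: "integrable sphere_measure (\<lambda>x::real^'n. e / 2)"
    by (rule continuous_on_sphere_integrable) simp
  have "E - e / 2 \<le> sphere_avg (\<lambda>x. ln (u x s - x \<bullet> w))" using z(2) moved(2) by simp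
  also have "\<dots> \<le> sphere_avg (\<lambda>x. ln (u x s) + e / 2)"
  proof (rule sphere_avg_mono)
    fix x :: "real^'n" assume x: "x \<in> sphere 0 1"
    have "norm w = exp (s - T) * norm z" by (simp add: w_def)
    also have "\<dots> \<le> exp (s - T) * R" using R(2)[OF T0 admissible_in_\<Omega>[OF T0 z(1)]] by simp
    finally have w: "norm w \<le> exp (s - T) * R" .
    \<comment> \<open>Concavity of the logarithm makes the error of moving the base point to the
      origin at most \<open>norm w\<close> divided by the minimum \<open>c\<close> of
      \<open>u\<close> at time \<open>s\<close>.\<close>
    have "ln (u x s - x \<bullet> w) \<le> ln (u x s) + (- (x \<bullet> w)) / u x s"
      using ln_diff_le[of "u x s" "- (x \<bullet> w)"] positive[of x s] adm[of x] x s by simp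
    also have "- (x \<bullet> w) \<le> exp (s - T) * R"
      using norm_cauchy_schwarz[of "- x" w] x w by simp
    also have "exp (s - T) * R / u x s \<le> exp (s - T) * R / c"
      using x0(2)[OF x] c R(1) by (intro divide_left_mono) (auto simp: c_def)
    also have "\<dots> \<le> e / 2" using T(2) by simp
    finally show "ln (u x s - x \<bullet> w) \<le> ln (u x s) + e / 2"
      using x s positive[of x s] by (simp add: divide_right_mono)
  qed (use ln_translated_integrable[OF s adm] int intc in auto)
  also have "\<dots> = sphere_avg (\<lambda>x. ln (u x s)) + e / 2"
    by (simp add: sphere_avg_add[OF int intc])
  finally show "E \<le> sphere_avg (\<lambda>x. ln (u x s)) + e" by simp
qed

text \<open>On bounded intervals the integral of \<open>D\<close> is an energy drop. The energies
  decrease and stay above \<open>E\<close>, so monotone convergence gives integrability on the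
  half-line with value the initial energy minus the limit energy, and that limit is at least
  \<open>E\<close>.\<close>

lemma total_dissipation:
  assumes t: "t \<ge> 0" and E: "\<And>t. t \<ge> 0 \<Longrightarrow> E \<le> entropy (\<Omega> t)"
  shows "set_integrable lborel {t..} D"
    and "E + (LINT s:{t..}|lborel. D s) \<le> sphere_avg (\<lambda>x. ln (u x t))"
proof -
  let ?e = "\<lambda>s. sphere_avg (\<lambda>x. ln (u x s))"
  define f where "f n s = indicator {t..t + real n} s *\<^sub>R D s" for n s
  have int: "integrable lborel (f n)" and lint: "(LINT s|lborel. f n s) = ?e t - ?e (t + real n)" for n
    using energy_dissipation[of t "t + real n"] t
    by (auto simp: f_def[abs_def] set_integrable_def set_lebesgue_integral_def)
  have mono: "mono (\<lambda>n. f n s)" for s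
    by (intro monoI) (auto simp: f_def indicator_def D_nonneg)
  have lim: "(\<lambda>n. f n s) \<longlonglongrightarrow> indicator {t..} s *\<^sub>R D s" for s
  proof (rule tendsto_eventually)
    have "\<forall>\<^sub>F n in sequentially. real n \<ge> s - t"
      by (rule eventually_sequentiallyI[of "nat \<lceil>s - t\<rceil>"]) linarith
    then show "\<forall>\<^sub>F n in sequentially. f n s = indicator {t..} s *\<^sub>R D s"
      by eventually_elim (auto simp: f_def indicator_def)
  qed
  have dec: "decseq (\<lambda>n. ?e (t + real n))"
  proof (intro decseq_SucI)
    fix n
    have "0 \<le> (LINT s:{t + real n..t + real (Suc n)}|lborel. D s)"
      unfolding set_lebesgue_integral_def by (intro Bochner_Integration.integral_nonneg) (auto simp: D_nonneg)
    then show "?e (t + real (Suc n)) \<le> ?e (t + real n)"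
      using energy_dissipation(2)[of "t + real n" "t + real (Suc n)"] t by simp
  qed
  have ge: "E \<le> ?e (t + real n)" for n
    by (rule energy_ge_limit[OF _ E]) (use t in auto)
  obtain L where L: "(\<lambda>n. ?e (t + real n)) \<longlonglongrightarrow> L" "\<And>n. L \<le> ?e (t + real n)"
    using decseq_convergent[OF dec, of E] ge by auto
  have "E \<le> L" by (rule LIMSEQ_le_const[OF L(1)]) (use ge in auto)
  have conv: "(\<lambda>n. LINT s|lborel. f n s) \<longlonglongrightarrow> ?e t - L"
    unfolding lint by (intro tendsto_intros L)
  have meas: "(\<lambda>s. indicator {t..} s *\<^sub>R D s) \<in> borel_measurable lborel"
    by (rule borel_measurable_LIMSEQ_real[OF lim]) (use int in \<open>auto dest: borel_measurable_integrable\<close>)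
  note mc = int AE_I2[OF mono] AE_I2[OF lim] conv meas
  show "set_integrable lborel {t..} D"
    unfolding set_integrable_def by (rule integrable_monotone_convergence[OF mc])
  have "(LINT s:{t..}|lborel. D s) = ?e t - L"
    unfolding set_lebesgue_integral_def by (rule integral_monotone_convergence[OF mc])
  with \<open>E \<le> L\<close> show "E + (LINT s:{t..}|lborel. D s) \<le> ?e t" by simp
qed

end

lemma C_k_on_2_D:
  assumes "C_k_on (Suc (Suc 0)) F U" "z \<in> U"
  shows "F differentiable (at z)" "(\<lambda>z. frechet_derivative F (at z) v) differentiable (at z)"
  using assms by auto

theorem lemma4p6:
  fixes u :: "real^'n \<Rightarrow> real \<Rightarrow> real" and \<Omega> :: "real \<Rightarrow> (real^'n) set"
  assumes dim: "CARD('n) \<ge> 2"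
    and smooth: "smooth_on (sphere 0 1 \<times> {0..}) (\<lambda>(x, t). u x t)"
    and positive: "\<And>x t. x \<in> sphere 0 1 \<Longrightarrow> t \<ge> 0 \<Longrightarrow> u x t > 0"
    and convex: "\<And>x t. x \<in> sphere 0 1 \<Longrightarrow> t \<ge> 0 \<Longrightarrow> radii_positive (\<lambda>y. u y t) x"
    and flow: "\<And>x t. x \<in> sphere 0 1 \<Longrightarrow> t \<ge> 0 \<Longrightarrow>
      (u x has_real_derivative u x t - 1 / tangent_det x (radii_op (\<lambda>y. u y t) x)) (at t within {0..})"
    and body: "\<And>t. t \<ge> 0 \<Longrightarrow> convex_body (\<Omega> t)"
    and support: "\<And>x t. x \<in> sphere 0 1 \<Longrightarrow> t \<ge> 0 \<Longrightarrow> u x t = support_fun (\<Omega> t) 0 x"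
    and volume: "measure lebesgue (\<Omega> 0) = measure lebesgue (ball (0::real^'n) 1)"
  shows "(\<forall>t\<ge>0.
      set_integrable lborel {t..}
        (\<lambda>s. sphere_avg (\<lambda>x. (sqrt (gauss_curv (\<lambda>y. u y s) x / u x s)
                              - sqrt (u x s / gauss_curv (\<lambda>y. u y s) x))\<^sup>2)) \<and>
      sphere_avg (\<lambda>x. ln (u x t)) \<ge>
        Lim at_top (\<lambda>\<tau>. entropy (\<Omega> \<tau>)) +
        (LINT s:{t..}|lborel.
          sphere_avg (\<lambda>x. (sqrt (gauss_curv (\<lambda>y. u y s) x / u x s)
                            - sqrt (u x s / gauss_curv (\<lambda>y. u y s) x))\<^sup>2)))
    \<and> (\<forall>t\<ge>0. entropy (\<Omega> t) \<ge> sphere_avg (\<lambda>x. ln (u x t))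
          \<and> sphere_avg (\<lambda>x. ln (u x t)) \<ge> Lim at_top (\<lambda>\<tau>. entropy (\<Omega> \<tau>)))"
proof -
  obtain U F where U: "sphere 0 1 \<times> {0..} \<subseteq> U" and F: "\<And>k. C_k_on k F U"
    and eq: "\<And>z. z \<in> sphere 0 1 \<times> {0..} \<Longrightarrow> F z = (case z of (x, t) \<Rightarrow> u x t)"
    using smooth unfolding smooth_on_def by blast
  interpret gauss_flow u \<Omega> U F
  proof
    show "(x, t) \<in> U" if "norm x = 1" "t \<ge> 0" for x t using U that by auto
    show "F differentiable (at z)" "(\<lambda>z. frechet_derivative F (at z) v) differentiable (at z)"
      if "z \<in> U" for z v using C_k_on_2_D[OF F that] by auto
    show "F (x, t) = u x t" if "norm x = 1" "t \<ge> 0" for x t using eq[of "(x, t)"] that by simp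
  qed (use positive convex flow body support volume in auto)
  obtain E where lim: "((\<lambda>\<tau>. entropy (\<Omega> \<tau>)) \<longlongrightarrow> E) at_top" and E: "\<And>t. t \<ge> 0 \<Longrightarrow> E \<le> entropy (\<Omega> t)"
    using entropy_tendsto by blast
  \<comment> \<open>\<open>Lim\<close> is a definite description, so its value can be identified
    only after convergence has been established.\<close>
  have Lim: "Lim at_top (\<lambda>\<tau>. entropy (\<Omega> \<tau>)) = E"
    by (rule tendsto_Lim[OF _ lim]) simp
  have "sphere_avg (\<lambda>x. ln (u x t)) \<le> entropy (\<Omega> t)" if "t \<ge> 0" for t
    using entropy_upper[OF that zero_admissible[OF that]] by simp
  then show ?thesis
    using total_dissipation[OF _ E] energy_ge_limit[OF _ E] unfolding Lim D_def[abs_def] by blast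
qed

end
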